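(* Let $M^{n+1}(c)$ be a complete simply connected $(n+1)$-dimensional Riemannian manifold of constant sectional curvature $c$, and let $\partial\Omega$ be a complete hypersurface in $M^{n+1}(c)$ bounding a closed compact domain $\Omega$. 1. Suppose that the ambient space is the Euclidean space $\mathbb{E}^{n+1}$ ($c=0$). If $\partial\Omega$ is a $k_0$-convex hypersurface, $k_0>0$, then $\partial\Omega$ can be enclosed in a spherical layer of width $$d\leqslant\frac{\sqrt2-1}{k_0}.$$ 2. Suppose that the ambient space is the sphere $S^{n+1}(k_1^2)$ ($c=k_1^2$, $k_1>0$). If $\partial\Omega$ is a $k_0$-convex hypersurface, $k_0>0$, then $\partial\Omega$ can be enclosed in a spherical layer of width $$d\leqslant\frac2{k_1}\arccos\sqrt{\cos k_1R}-R,$$ where $R=\frac1{k_1}\operatorname{arccot}\frac{k_0}{k_1}$ is the radius of a circle of curvature $k_0$ on the two-dimensional sphere of Gaussian curvature $k_1^2$. 3. Suppose that the ambient space is the Lobachevsky space $\mathbb{H}^{n+1}(-k_1^2)$ ($c=-k_1^2$, $k_1>0$). If $\partial\Omega$ is a $k_0$-convex hypersurface, $k_0>k_1$, then $\partial\Omega$ lies in a spherical layer of width $$d\leqslant\frac2{k_1}\operatorname{arcosh}\sqrt{\cosh k_1R}-R,$$ where $R=\frac1{k_1}\operatorname{arcoth}\frac{k_0}{k_1}$ is the radius of a circle of curvature $k_0$ on the two-dimensional Lobachevsky plane of Gaussian curvature $-k_1^2$.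
   Context: A locally convex hypersurface $\partial\Omega\subset M^{n+1}(c)$ (not necessarily regular) is called $\lambda$-convex if for every point $P\in\partial\Omega$ there is a sphere $S_P$ all of whose normal curvatures equal $\lambda$, passing through $P$, such that in a neighbourhood of $P$ the hypersurface $\partial\Omega$ lies on the convex side of $S_P$ (i.e. in the closed ball bounded by $S_P$). For a hypersurface of class $C^k$, $k\geqslant2$, $\lambda$-convexity is equivalent to all its normal curvatures, at every point and in every direction, satisfying $k_n\geqslant\lambda$ (with the sign convention that the boundary of a small ball has positive normal curvatures). A spherical layer is the closed region between two concentric spheres (possibly degenerate); its width is the difference of their radii. *)

theory Defs
  imports "HOL-Analysis.Analysis"
begin

section \<open>The model spaces of constant curvature\<close>

text \<open>
  A model space is a submanifold \<open>pts\<close> of a vector space carrying a constant symmetric bilinear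
  form.  The Riemannian metric is the restriction of that form to the tangent spaces, \<open>gdist\<close> is
  the induced geodesic distance, and the manifold topology is the subspace topology.
\<close>

record 'v space_form =
  pts :: "'v set"
  form :: "'v \<Rightarrow> 'v \<Rightarrow> real"
  gdist :: "'v \<Rightarrow> 'v \<Rightarrow> real"

definition euclidean_form :: "'a::euclidean_space space_form" where
  "euclidean_form = \<lparr>pts = UNIV, form = (\<bullet>), gdist = dist\<rparr>"

text \<open>Curvature \<open>k\<^sup>2\<close>: the round sphere of radius \<open>1/k\<close>.\<close>

definition spherical_form :: "real \<Rightarrow> ('a::euclidean_space \<times> real) space_form" where
  "spherical_form k =
     \<lparr>pts = {x. x \<bullet> x = 1 / k\<^sup>2},
      form = (\<bullet>),
      gdist = (\<lambda>x y. arccos (k\<^sup>2 * (x \<bullet> y)) / k)\<rparr>"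

text \<open>Curvature \<open>-k\<^sup>2\<close>: the upper sheet of a hyperboloid in Minkowski space.\<close>

definition minkowski :: "'a::euclidean_space \<times> real \<Rightarrow> 'a \<times> real \<Rightarrow> real" where
  "minkowski x y = fst x \<bullet> fst y - snd x * snd y"

definition hyperbolic_form :: "real \<Rightarrow> ('a::euclidean_space \<times> real) space_form" where
  "hyperbolic_form k =
     \<lparr>pts = {x. minkowski x x = - (1 / k\<^sup>2) \<and> snd x > 0},
      form = minkowski,
      gdist = (\<lambda>x y. arcosh (- k\<^sup>2 * minkowski x y) / k)\<rparr>"

abbreviation mfd_top :: "('v::euclidean_space) space_form \<Rightarrow> 'v topology" where
  "mfd_top X \<equiv> top_of_set (pts X)"

definition geo_sphere :: "'v space_form \<Rightarrow> 'v \<Rightarrow> real \<Rightarrow> 'v set" where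
  "geo_sphere X z r = {x \<in> pts X. gdist X z x = r}"

definition geo_cball :: "'v space_form \<Rightarrow> 'v \<Rightarrow> real \<Rightarrow> 'v set" where
  "geo_cball X z r = {x \<in> pts X. gdist X z x \<le> r}"


section \<open>Normal curvature\<close>

definition tangent_vectors :: "('v::euclidean_space) set \<Rightarrow> 'v \<Rightarrow> 'v set" where
  "tangent_vectors S p =
     {v. \<exists>\<gamma>. \<gamma> 0 = p \<and> (\<forall>t::real. \<gamma> t \<in> S) \<and> (\<gamma> has_vector_derivative v) (at 0)}"

text \<open>The unit normal at \<open>p\<close> of a hypersurface \<open>S\<close>, pointing into the closed region \<open>D\<close> that
  \<open>S\<close> bounds.\<close>

definition inner_unit_normal ::
    "('v::euclidean_space) space_form \<Rightarrow> 'v set \<Rightarrow> 'v set \<Rightarrow> 'v \<Rightarrow> 'v \<Rightarrow> bool" where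
  "inner_unit_normal X S D p N \<longleftrightarrow>
     N \<in> tangent_vectors (pts X) p \<and> form X N N = 1 \<and>
     (\<forall>v \<in> tangent_vectors S p. form X N v = 0) \<and>
     (\<exists>\<gamma>. \<gamma> 0 = p \<and> (\<forall>t\<ge>0::real. \<gamma> t \<in> D) \<and>
          (\<gamma> has_vector_derivative N) (at 0 within {0..}))"

text \<open>
  \<open>\<kappa>\<close> is the normal curvature of \<open>S\<close> at \<open>p\<close> in the unit direction \<open>v\<close>, with respect to the inner
  normal.  The Levi-Civita derivative on \<open>pts X\<close> is the tangential part of the derivative in the
  ambient vector space, and the normal is tangent to \<open>pts X\<close>, so the ambient acceleration
  \<open>a\<close> may be used.
\<close>

definition has_normal_curvature ::
    "('v::euclidean_space) space_form \<Rightarrow> 'v set \<Rightarrow> 'v set \<Rightarrow> 'v \<Rightarrow> 'v \<Rightarrow> real \<Rightarrow> bool" where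
  "has_normal_curvature X S D p v \<kappa> \<longleftrightarrow>
     form X v v = 1 \<and>
     (\<exists>N \<gamma> \<gamma>' a. inner_unit_normal X S D p N \<and>
        \<gamma> 0 = p \<and> \<gamma>' 0 = v \<and> (\<forall>t::real. \<gamma> t \<in> S) \<and>
        (\<forall>t. (\<gamma> has_vector_derivative \<gamma>' t) (at t)) \<and>
        (\<gamma>' has_vector_derivative a) (at 0) \<and>
        \<kappa> = form X a N)"

text \<open>
  The ball is required to be proper: in the round sphere a ball of radius \<open>\<pi>/k\<close> is the whole
  space and its distance sphere is a single point, whose normal curvatures would satisfy
  every condition vacuously.
\<close>

definition sphere_of_curvature ::
    "('v::euclidean_space) space_form \<Rightarrow> real \<Rightarrow> 'v \<Rightarrow> real \<Rightarrow> bool" where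
  "sphere_of_curvature X \<mu> z r \<longleftrightarrow>
     z \<in> pts X \<and> 0 < r \<and> geo_cball X z r \<noteq> pts X \<and>
     (\<forall>p \<in> geo_sphere X z r. \<forall>v \<kappa>.
        has_normal_curvature X (geo_sphere X z r) (geo_cball X z r) p v \<kappa> \<longrightarrow> \<kappa> = \<mu>)"


section \<open>Convex hypersurfaces\<close>

text \<open>The union of the minimising geodesics from \<open>x\<close> to \<open>y\<close>.\<close>

definition geo_segment :: "'v space_form \<Rightarrow> 'v \<Rightarrow> 'v \<Rightarrow> 'v set" where
  "geo_segment X x y = {z \<in> pts X. gdist X x z + gdist X z y = gdist X x y}"

definition convex_body :: "('v::euclidean_space) space_form \<Rightarrow> 'v set \<Rightarrow> bool" where
  "convex_body X K \<longleftrightarrow>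
     K \<subseteq> pts X \<and> compact K \<and> mfd_top X interior_of K \<noteq> {} \<and>
     (\<forall>x\<in>K. \<forall>y\<in>K. geo_segment X x y \<subseteq> K)"

text \<open>
  Hypersurfaces are connected and need not be regular.  Near each of its points a locally
  convex one is a piece of the boundary of a convex body, hence an embedded topological
  submanifold of codimension one.
\<close>

definition locally_convex_hypersurface :: "('v::euclidean_space) space_form \<Rightarrow> 'v set \<Rightarrow> bool" where
  "locally_convex_hypersurface X S \<longleftrightarrow>
     S \<subseteq> pts X \<and> connected S \<and>
     (\<forall>P\<in>S. \<exists>U K. openin (mfd_top X) U \<and> P \<in> U \<and> convex_body X K \<and>
        S \<inter> U = (mfd_top X frontier_of K) \<inter> U)"

definition lambda_convex :: "('v::euclidean_space) space_form \<Rightarrow> real \<Rightarrow> 'v set \<Rightarrow> bool" where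
  "lambda_convex X \<mu> S \<longleftrightarrow>
     locally_convex_hypersurface X S \<and>
     (\<forall>P\<in>S. \<exists>z r. sphere_of_curvature X \<mu> z r \<and> P \<in> geo_sphere X z r \<and>
        (\<exists>U. openin (mfd_top X) U \<and> P \<in> U \<and> S \<inter> U \<subseteq> geo_cball X z r))"

text \<open>A compact set that is the closure of a nonempty connected open set.  Its boundary is
  compact, so completeness of the boundary need not be demanded separately.\<close>

definition compact_domain :: "('v::euclidean_space) space_form \<Rightarrow> 'v set \<Rightarrow> bool" where
  "compact_domain X \<Omega> \<longleftrightarrow>
     \<Omega> \<subseteq> pts X \<and> compact \<Omega> \<and>
     mfd_top X interior_of \<Omega> \<noteq> {} \<and> connected (mfd_top X interior_of \<Omega>) \<and>
     mfd_top X closure_of (mfd_top X interior_of \<Omega>) = \<Omega>"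


section \<open>Spherical layers\<close>

text \<open>Degenerate layers are allowed: \<open>r\<^sub>1 = 0\<close> (a ball) or \<open>r\<^sub>1 = r\<^sub>2\<close> (a sphere).\<close>

definition spherical_layer :: "('v::euclidean_space) space_form \<Rightarrow> 'v set \<Rightarrow> real \<Rightarrow> bool" where
  "spherical_layer X L d \<longleftrightarrow>
     (\<exists>z r\<^sub>1 r\<^sub>2. z \<in> pts X \<and> 0 \<le> r\<^sub>1 \<and> r\<^sub>1 \<le> r\<^sub>2 \<and> geo_sphere X z r\<^sub>2 \<noteq> {} \<and>
        L = {x \<in> pts X. r\<^sub>1 \<le> gdist X z x \<and> gdist X z x \<le> r\<^sub>2} \<and> d = r\<^sub>2 - r\<^sub>1)"


section \<open>Inverse cotangents\<close>

definition arccot :: "real \<Rightarrow> real" where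
  "arccot x = pi / 2 - arctan x"

text \<open>Meaningful for \<open>1 < \<bar>x\<bar>\<close>.\<close>

definition arcoth :: "real \<Rightarrow> real" where
  "arcoth x = artanh (1 / x)"

end

theory Submission
  imports Defs
begin

text \<open>
  Let \<open>h x y\<close> be half the square of \<open>x - y\<close> in the ambient symmetric form.  In all three geometries
  geodesic balls are the sets \<open>h z x \<le> const\<close>, and the circle through \<open>A\<close>, \<open>y\<close>, \<open>P\<close> consists of
  affine combinations of \<open>A\<close>, \<open>y\<close>, \<open>P\<close> with explicit coefficients, along which \<open>h\<close> is a quotient of
  quadratic polynomials.  So a circle that touches a ball from inside, even locally, lies in it.

  Replace the domain, if necessary, by the component \<open>I\<close> of its interior or exterior that lies on the
  convex side of the hypersurface.  Let \<open>B(c, r)\<close> be a largest ball inscribed in \<open>I\<close>, touching the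
  boundary at \<open>P\<close>, and let \<open>A\<close> be the point at distance \<open>2\<rho> > 2R\<close> from \<open>P\<close> on the ray towards \<open>c\<close>.
  Circles through \<open>A\<close> and \<open>P\<close> do not fit into a ball of radius \<open>R\<close>, so an arc of such a circle that
  stays in the closure of \<open>I\<close> cannot touch the boundary at an interior point.  A continuity argument
  along these arcs shows that \<open>I\<close> cannot leave the ball with diameter \<open>AP\<close>; letting \<open>\<rho>\<close> tend to \<open>R\<close>,
  \<open>I\<close> lies in the ball of radius \<open>R\<close> touching \<open>B(c, r)\<close> at \<open>P\<close>.  By maximality, for every direction
  at \<open>c\<close> there is a touching point \<open>P\<close> at an angle of at most \<open>\<pi>/2\<close>, and the law of cosines bounds the
  distance \<open>s\<close> of the boundary points from \<open>c\<close>: for example \<open>cos s * cos (R - r) \<ge> cos R\<close> on the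
  unit sphere.
\<close>

section \<open>Circles as affine combinations\<close>

text \<open>The constants: let s be the largest distance of a boundary point from the centre of the
  inscribed ball and t = R - r. The width s - r is s + t - R, and the law of cosines bounds s and t
  symmetrically (s^2 + t^2 \<le> R^2 in the flat case), so s = t is extremal, and its value of s + t
  gives all three bounds. Why \<rho> > R: no ball of radius R contains two points at distance
  2\<rho>, and an arc touching the boundary from inside at an interior point would put both
  \<open>A\<close> and \<open>P\<close> into the supporting ball there. At the end \<open>P\<close>
  this fails, since every arc meets the boundary there; what remains is a first-order comparison of
  arcs that leave \<open>P\<close> in opposite directions. The other obstacle is that the
  hypersurface has no normals: curvature enters only as local inclusion in balls, and it is the
  hypersurface, not a region, that is included. Before circles can be used, the supporting balls
  must be shown to contain one of the two sides, and the same side at every point.\<close>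

lemma closedin_sequentialI:
  fixes S T :: "'a::metric_space set"
  assumes "S \<subseteq> T" and "\<And>x l. (\<And>n. x n \<in> S) \<Longrightarrow> x \<longlonglongrightarrow> l \<Longrightarrow> l \<in> T \<Longrightarrow> l \<in> S"
  shows "closedin (top_of_set T) S"
proof -
  have "S = T \<inter> closure S"
  proof
    show "T \<inter> closure S \<subseteq> S"
    proof
      fix l assume l: "l \<in> T \<inter> closure S"
      then obtain x where "\<forall>n. x n \<in> S" "x \<longlonglongrightarrow> l" by (auto simp: closure_sequential)
      then show "l \<in> S" using assms(2)[of x l] l by simp
    qed
  qed (use assms(1) closure_subset in blast)
  then show ?thesis by (metis closed_closure closedin_closed_Int)
qed

section \<open>Symmetric forms and the rational parametrisation of circles\<close>

locale symmetric_form =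
  fixes b :: "'v::euclidean_space \<Rightarrow> 'v \<Rightarrow> real"
  assumes bil: "bilinear b" and sym: "b x y = b y x"
begin

definition h :: "'v \<Rightarrow> 'v \<Rightarrow> real" where
  "h x y = b (x - y) (x - y) / 2"

lemmas b_linear = bilinear_ladd[OF bil] bilinear_radd[OF bil] bilinear_lmul[OF bil]
  bilinear_rmul[OF bil] bilinear_lsub[OF bil] bilinear_rsub[OF bil]
  bilinear_lneg[OF bil] bilinear_rneg[OF bil] bilinear_lzero[OF bil] bilinear_rzero[OF bil]

lemma bounded_b: "bounded_bilinear b"
  using bil by (simp add: bilinear_conv_bounded_bilinear)

lemmas b_continuous [continuous_intros] = bounded_bilinear.continuous_on[OF bounded_b]
lemmas b_tendsto [tendsto_intros] = bounded_bilinear.tendsto[OF bounded_b]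

lemma h_continuous [continuous_intros]:
  "continuous_on S f \<Longrightarrow> continuous_on S g \<Longrightarrow> continuous_on S (\<lambda>x. h (f x) (g x))"
  unfolding h_def by (intro continuous_intros) auto

lemma h_tendsto [tendsto_intros]:
  "(f \<longlongrightarrow> a) F \<Longrightarrow> (g \<longlongrightarrow> c) F \<Longrightarrow> ((\<lambda>x. h (f x) (g x)) \<longlongrightarrow> h a c) F"
  unfolding h_def by (intro tendsto_intros) auto

lemma h_commute: "h x y = h y x"
  unfolding h_def by (metis b_linear(7,8) minus_diff_eq minus_minus)

lemma h_self [simp]: "h x x = 0"
  by (simp add: h_def b_linear)

text \<open>For general weights there is a further term, minus the sum of pairwise products of
  weights times \<open>h\<close>, as for moments of inertia about a centroid. The second hypothesis
  makes it vanish; it is the equation of the circle through \<open>A\<close>, \<open>y\<close>,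
  \<open>P\<close> in barycentric coordinates.\<close>

lemma h_affine_combination:
  assumes "\<alpha> + \<beta> + \<delta> = 1" and "\<alpha> * \<beta> * h A y + \<alpha> * \<delta> * h A P + \<beta> * \<delta> * h y P = 0"
  shows "h (\<alpha> *\<^sub>R A + \<beta> *\<^sub>R y + \<delta> *\<^sub>R P) z = \<alpha> * h A z + \<beta> * h y z + \<delta> * h P z"
proof -
  define u v w where "u = A - z" and "v = y - z" and "w = P - z"
  have "z = \<alpha> *\<^sub>R z + \<beta> *\<^sub>R z + \<delta> *\<^sub>R z"
    using assms(1) by (metis scaleR_add_left scaleR_one)
  then have e: "\<alpha> *\<^sub>R A + \<beta> *\<^sub>R y + \<delta> *\<^sub>R P - z = \<alpha> *\<^sub>R u + \<beta> *\<^sub>R v + \<delta> *\<^sub>R w"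
    unfolding u_def v_def w_def by (simp add: algebra_simps)
  have uv: "h A y = (b u u + b v v - 2 * b u v) / 2" "h A P = (b u u + b w w - 2 * b u w) / 2"
      "h y P = (b v v + b w w - 2 * b v w) / 2"
    using sym[of u v] sym[of u w] sym[of v w] unfolding h_def u_def v_def w_def
    by (auto simp: b_linear algebra_simps sym)
  have "h (\<alpha> *\<^sub>R A + \<beta> *\<^sub>R y + \<delta> *\<^sub>R P) z = b (\<alpha> *\<^sub>R u + \<beta> *\<^sub>R v + \<delta> *\<^sub>R w) (\<alpha> *\<^sub>R u + \<beta> *\<^sub>R v + \<delta> *\<^sub>R w) / 2"
    unfolding h_def e ..
  also have "\<dots> = (\<alpha>\<^sup>2 * b u u + \<beta>\<^sup>2 * b v v + \<delta>\<^sup>2 * b w w + 2 * \<alpha> * \<beta> * b u v + 2 * \<alpha> * \<delta> * b u w + 2 * \<beta> * \<delta> * b v w) / 2"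
    using sym[of u v] sym[of u w] sym[of v w]
    by (simp add: b_linear algebra_simps power2_eq_square)
  also have "\<dots> = (\<alpha> * b u u + \<beta> * b v v + \<delta> * b w w) / 2
      - (\<alpha> * \<beta> * h A y + \<alpha> * \<delta> * h A P + \<beta> * \<delta> * h y P)"
  proof -
    have d: "\<delta> = 1 - \<alpha> - \<beta>" using assms(1) by simp
    show ?thesis unfolding uv d by (simp add: field_simps power2_eq_square)
  qed
  also have "\<dots> = \<alpha> * h A z + \<beta> * h y z + \<delta> * h P z"
    unfolding assms(2) by (simp add: h_def u_def v_def w_def add_divide_distrib)
  finally show ?thesis .
qed

text \<open>By Thales the sign locates \<open>y\<close> relative to the sphere with diameter
  \<open>AP\<close>: negative inside, zero on it, positive outside.\<close>

definition angle :: "'v \<Rightarrow> 'v \<Rightarrow> 'v \<Rightarrow> real" where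
  "angle A P y = b (y - A) (y - P)"

lemma angle_eq: "angle A P y = h A y + h P y - h A P"
  unfolding angle_def h_def by (simp add: b_linear sym field_simps)

text \<open>This is \<open>b v v / 2\<close> for the vector v = (y - A) - \<mu> (y - P).\<close>

definition arc_weight :: "'v \<Rightarrow> 'v \<Rightarrow> 'v \<Rightarrow> real \<Rightarrow> real" where
  "arc_weight A P y \<mu> = h A y + \<mu>\<^sup>2 * h P y - \<mu> * angle A P y"

text \<open>The parameter 0 gives \<open>P\<close>, 1 gives \<open>y\<close>, and \<open>A\<close>
  is the limit at infinity, so [0, 1] describes the arc from \<open>P\<close> to \<open>y\<close>
  that avoids \<open>A\<close>. In the Euclidean case \<mu> is the affine parameter on the line into
  which an inversion about \<open>A\<close> maps the circle.\<close>

definition arc :: "'v \<Rightarrow> 'v \<Rightarrow> 'v \<Rightarrow> real \<Rightarrow> 'v" where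
  "arc A P y \<mu> =
     (1 / arc_weight A P y \<mu>) *\<^sub>R
       ((h A y * (1 - \<mu>)) *\<^sub>R P + (\<mu> * h A P) *\<^sub>R y - (\<mu> * (1 - \<mu>) * h P y) *\<^sub>R A)"

lemma arc_weight_sum:
  "arc_weight A P y \<mu> = h A y * (1 - \<mu>) + \<mu> * h A P - \<mu> * (1 - \<mu>) * h P y"
  unfolding arc_weight_def angle_eq by (simp add: algebra_simps power2_eq_square)

lemma arc_affine_combination:
  assumes "arc_weight A P y \<mu> \<noteq> 0"
  obtains \<alpha> \<beta> \<delta> where "\<alpha> + \<beta> + \<delta> = 1" "\<alpha> * \<beta> * h A y + \<alpha> * \<delta> * h A P + \<beta> * \<delta> * h y P = 0"
    "arc A P y \<mu> = \<alpha> *\<^sub>R A + \<beta> *\<^sub>R y + \<delta> *\<^sub>R P"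
    "arc_weight A P y \<mu> * \<alpha> = - (\<mu> * (1 - \<mu>) * h P y)" "arc_weight A P y \<mu> * \<beta> = \<mu> * h A P"
    "arc_weight A P y \<mu> * \<delta> = h A y * (1 - \<mu>)"
proof -
  let ?w = "arc_weight A P y \<mu>"
  define \<alpha> \<beta> \<delta> where "\<alpha> = - (\<mu> * (1 - \<mu>) * h P y) / ?w" and "\<beta> = \<mu> * h A P / ?w"
    and "\<delta> = h A y * (1 - \<mu>) / ?w"
  have w: "?w * \<alpha> = - (\<mu> * (1 - \<mu>) * h P y)" "?w * \<beta> = \<mu> * h A P" "?w * \<delta> = h A y * (1 - \<mu>)"
    using assms by (auto simp: \<alpha>_def \<beta>_def \<delta>_def)
  have "?w * (\<alpha> + \<beta> + \<delta>) = ?w * 1"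
    unfolding distrib_left w by (simp add: arc_weight_sum)
  then have 1: "\<alpha> + \<beta> + \<delta> = 1" using assms by simp
  have "?w * ?w * (\<alpha> * \<beta> * h A y + \<alpha> * \<delta> * h A P + \<beta> * \<delta> * h y P)
      = (?w * \<alpha>) * (?w * \<beta>) * h A y + (?w * \<alpha>) * (?w * \<delta>) * h A P + (?w * \<beta>) * (?w * \<delta>) * h y P"
    by (simp add: algebra_simps)
  also have "\<dots> = 0" unfolding w by (simp add: h_commute[of y P] algebra_simps)
  finally have 2: "\<alpha> * \<beta> * h A y + \<alpha> * \<delta> * h A P + \<beta> * \<delta> * h y P = 0" using assms by simp
  have 3: "arc A P y \<mu> = \<alpha> *\<^sub>R A + \<beta> *\<^sub>R y + \<delta> *\<^sub>R P"
    unfolding arc_def \<alpha>_def \<beta>_def \<delta>_def by (simp add: scaleR_right_distrib scaleR_diff_right)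
  show thesis using that[OF 1 2 3 w] .
qed

lemma h_arc:
  assumes "arc_weight A P y \<mu> \<noteq> 0"
  shows "arc_weight A P y \<mu> * h (arc A P y \<mu>) z =
    h A y * (1 - \<mu>) * h P z + \<mu> * h A P * h y z - \<mu> * (1 - \<mu>) * h P y * h A z"
proof -
  obtain \<alpha> \<beta> \<delta> where *: "\<alpha> + \<beta> + \<delta> = 1" "\<alpha> * \<beta> * h A y + \<alpha> * \<delta> * h A P + \<beta> * \<delta> * h y P = 0"
    "arc A P y \<mu> = \<alpha> *\<^sub>R A + \<beta> *\<^sub>R y + \<delta> *\<^sub>R P"
    "arc_weight A P y \<mu> * \<alpha> = - (\<mu> * (1 - \<mu>) * h P y)" "arc_weight A P y \<mu> * \<beta> = \<mu> * h A P"
    "arc_weight A P y \<mu> * \<delta> = h A y * (1 - \<mu>)"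
    using arc_affine_combination[OF assms] by metis
  have "arc_weight A P y \<mu> * h (arc A P y \<mu>) z =
      (arc_weight A P y \<mu> * \<alpha>) * h A z + (arc_weight A P y \<mu> * \<beta>) * h y z + (arc_weight A P y \<mu> * \<delta>) * h P z"
    unfolding *(3) h_affine_combination[OF *(1,2)] by (simp add: algebra_simps)
  then show ?thesis unfolding *(4-6) by (simp add: algebra_simps)
qed

lemma h_arc_end:
  assumes "arc_weight A P y \<mu> \<noteq> 0"
  shows "arc_weight A P y \<mu> * h (arc A P y \<mu>) P = \<mu>\<^sup>2 * h A P * h P y"
    and "arc_weight A P y \<mu> * h (arc A P y \<mu>) A = h A y * h A P"
  unfolding h_arc[OF assms]
  by (simp_all add: h_commute[of y P] h_commute[of P A] h_commute[of y A] algebra_simps power2_eq_square)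

lemma angle_arc:
  assumes "arc_weight A P y \<mu> \<noteq> 0"
  shows "arc_weight A P y \<mu> * angle A P (arc A P y \<mu>) = \<mu> * h A P * angle A P y"
proof -
  have "arc_weight A P y \<mu> * angle A P (arc A P y \<mu>) =
     h A y * h A P + \<mu>\<^sup>2 * h A P * h P y - arc_weight A P y \<mu> * h A P"
    using h_arc_end[OF assms] unfolding angle_eq
    by (simp add: algebra_simps h_commute[of A "arc A P y \<mu>"] h_commute[of P "arc A P y \<mu>"])
  then show ?thesis unfolding arc_weight_def by (simp add: algebra_simps)
qed

text \<open>Up to a positive factor, the derivative at \<open>P\<close> of \<open>h\<close> to
  \<open>z\<close> along the arc towards \<open>y\<close>: a negative value means that the arc
  enters the ball about \<open>z\<close> through \<open>P\<close>.\<close>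

definition slope :: "'v \<Rightarrow> 'v \<Rightarrow> 'v \<Rightarrow> 'v \<Rightarrow> real" where
  "slope A P z y = h A P * (h y z - h P z) - h P y * (h A z - h P z)"

lemma h_arc_slope:
  assumes "arc_weight A P y \<mu> \<noteq> 0"
  shows "arc_weight A P y \<mu> * (h (arc A P y \<mu>) z - h P z) =
    \<mu> * (slope A P z y + \<mu> * (h P y * (h A z - h P z)))"
proof -
  have "arc_weight A P y \<mu> * (h (arc A P y \<mu>) z - h P z) =
     h A y * (1 - \<mu>) * h P z + \<mu> * h A P * h y z - \<mu> * (1 - \<mu>) * h P y * h A z
     - (h A y * (1 - \<mu>) + \<mu> * h A P - \<mu> * (1 - \<mu>) * h P y) * h P z"
    unfolding right_diff_distrib[of "arc_weight A P y \<mu>"] h_arc[OF assms] arc_weight_sum[symmetric] ..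
  then show ?thesis unfolding slope_def by (simp add: algebra_simps)
qed

text \<open>The points \<open>A\<close>, \<open>x\<close>, \<open>P\<close>,
  \<open>A + P - x\<close> form a rectangle, so the arcs to \<open>x\<close> and to its antipode
  leave \<open>P\<close> in opposite directions along one circle. Fact 3 in the proof is the British
  flag identity for this rectangle.\<close>

lemma slope_antisymmetric:
  assumes "angle A P x = 0"
  shows "slope A P z x + slope A P z (A + P - x) = 0"
proof -
  have 1: "h P (A + P - x) = h A x" unfolding h_def
    by (metis (no_types, opaque_lifting) add_diff_eq diff_diff_eq2 h_commute h_def add_diff_cancel_right' add.commute diff_add_cancel)
  have 2: "h A x + h P x = h A P" using assms by (simp add: angle_eq)
  have 3: "h x z + h (A + P - x) z = h A z + h P z"
    using assms unfolding angle_def h_def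
    by (simp add: b_linear sym field_simps)
  have "slope A P z x + slope A P z (A + P - x) =
     h A P * ((h x z + h (A + P - x) z) - 2 * h P z) - (h P x + h P (A + P - x)) * (h A z - h P z)"
    unfolding slope_def by (simp add: algebra_simps)
  also have "\<dots> = 0" unfolding 1 3 using 2 by (simp add: algebra_simps)
  finally show ?thesis .
qed

lemma angle_reflect:
  assumes "angle A P x = 0"
  shows "angle A P (A + P - x) = 0"
  using assms unfolding angle_def by (simp add: b_linear sym algebra_simps)

text \<open>A sphere has many diameters: any point on it, together with its antipode, yields the
  same function. This allows arcs in the pencil of another antipodal pair.\<close>

lemma angle_conjugate_pair:
  assumes "angle A P x = 0"
  shows "angle (A + P - x) x y = angle A P y"
  using assms unfolding angle_def by (simp add: b_linear sym algebra_simps)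

lemma arc_weight_tendsto [tendsto_intros]:
  assumes "(f \<longlongrightarrow> y) F" "(g \<longlongrightarrow> \<mu>) F"
  shows "((\<lambda>n. arc_weight A P (f n) (g n)) \<longlongrightarrow> arc_weight A P y \<mu>) F"
  unfolding arc_weight_def angle_def by (intro tendsto_intros assms)

lemma arc_tendsto:
  assumes "(f \<longlongrightarrow> y) F" "(g \<longlongrightarrow> \<mu>) F" "arc_weight A P y \<mu> \<noteq> 0"
  shows "((\<lambda>n. arc A P (f n) (g n)) \<longlongrightarrow> arc A P y \<mu>) F"
  unfolding arc_def by (intro tendsto_intros assms)

lemma arc_0: "h A y \<noteq> 0 \<Longrightarrow> arc A P y 0 = P"
  by (simp add: arc_def arc_weight_def)

lemma arc_1: "h A P \<noteq> 0 \<Longrightarrow> arc A P y 1 = y"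
  by (simp add: arc_def arc_weight_sum)

end

text \<open>A quadratic with a local maximum of value zero at \<open>t\<close> is c (s - t)^2 with c
  \<le> 0. The conclusions concern the value at 0 and the leading coefficient because, on an arc,
  these belong to the end points \<open>P\<close> and \<open>A\<close>.\<close>

lemma quadratic_local_max_global:
  fixes a b c t :: real
  assumes "\<forall>\<^sub>F s in at t. a + b * s + c * s\<^sup>2 \<le> 0" and "a + b * t + c * t\<^sup>2 = 0"
  shows "a \<le> 0" "c \<le> 0"
proof -
  \<comment> \<open>The derivative at \<open>t\<close>; the local maximum forces it to
    vanish.\<close>
  define d where "d = b + 2 * c * t"
  have exp: "a + b * s + c * s\<^sup>2 = (s - t) * (d + c * (s - t))" for s
    using assms(2) unfolding d_def by (simp add: algebra_simps power2_eq_square)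
  obtain e where e: "e > 0" "\<And>s. s \<noteq> t \<Longrightarrow> dist s t < e \<Longrightarrow> (s - t) * (d + c * (s - t)) \<le> 0"
    using assms(1) unfolding exp eventually_at by auto
  have both: "d + c * u \<le> 0" "d - c * u \<ge> 0" if "0 < u" "u < e" for u
    using e(2)[of "t + u"] e(2)[of "t - u"] that
    by (auto simp: dist_real_def mult_le_0_iff zero_le_mult_iff)
  have lim: "((\<lambda>u. d + c * u) \<longlongrightarrow> d + c * 0) (at_right 0)" "((\<lambda>u. d - c * u) \<longlongrightarrow> d - c * 0) (at_right 0)"
    by (intro tendsto_intros)+
  have ev: "\<forall>\<^sub>F u in at_right 0. 0 < u \<and> u < e"
    using e(1) by (simp add: eventually_at_right_less eventually_conj_iff eventually_at_right_field)  (use e(1) in blast)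
  have "d \<le> 0" using tendsto_upperbound[OF lim(1), of 0] ev both(1)
    by (simp add: eventually_mono)
  moreover have "d \<ge> 0" using tendsto_lowerbound[OF lim(2), of 0] ev both(2)
    by (simp add: eventually_mono)
  ultimately have d: "d = 0" by simp
  show c: "c \<le> 0" using both(1)[of "e/2"] e(1) d by (simp add: mult_le_0_iff)
  have "a = c * t\<^sup>2" using exp[of 0] d by (simp add: power2_eq_square)
  then show "a \<le> 0" using c by (simp add: mult_le_0_iff)
qed

text \<open>The constants stand for the values of \<open>h\<close> at the distances R and 2R. In
  \<open>conic_mem\<close> the premise about \<open>h\<close> selects, on a two-sheeted hyperboloid,
  the sheet that contains \<open>P\<close>.\<close>

locale circle_geometry = symmetric_form b
  for b :: "'v::euclidean_space \<Rightarrow> 'v \<Rightarrow> real" +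
  fixes M :: "'v set" and c1 c2 :: real
  assumes closed_M: "closed M"
    and h_pos: "x \<in> M \<Longrightarrow> y \<in> M \<Longrightarrow> x \<noteq> y \<Longrightarrow> 0 < h x y"
    and conic_mem: "A \<in> M \<Longrightarrow> y \<in> M \<Longrightarrow> P \<in> M \<Longrightarrow> \<alpha> + \<beta> + \<delta> = 1 \<Longrightarrow>
        \<alpha> * \<beta> * h A y + \<alpha> * \<delta> * h A P + \<beta> * \<delta> * h y P = 0 \<Longrightarrow>
        0 \<le> h (\<alpha> *\<^sub>R A + \<beta> *\<^sub>R y + \<delta> *\<^sub>R P) P \<Longrightarrow> \<alpha> *\<^sub>R A + \<beta> *\<^sub>R y + \<delta> *\<^sub>R P \<in> M"
    and diameter: "x \<in> M \<Longrightarrow> y \<in> M \<Longrightarrow> z \<in> M \<Longrightarrow> h x z \<le> c1 \<Longrightarrow> h y z \<le> c1 \<Longrightarrow> h x y \<le> c2"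
begin

lemma h_nonneg: "x \<in> M \<Longrightarrow> y \<in> M \<Longrightarrow> 0 \<le> h x y"
  using h_pos[of x y] by (cases "x = y") auto

lemma arc_weight_pos:
  assumes "A \<in> M" "P \<in> M" "y \<in> M" "y \<noteq> A" "angle A P y \<le> 0" "0 \<le> \<mu>"
  shows "0 < arc_weight A P y \<mu>"
proof -
  have "\<mu> * angle A P y \<le> 0" "\<mu>\<^sup>2 * h P y \<ge> 0" "h A y > 0"
    using assms h_pos[of A y] h_nonneg[of P y] by (auto simp: mult_le_0_iff)
  then show ?thesis unfolding arc_weight_def by linarith
qed

lemma arc_mem:
  assumes "A \<in> M" "P \<in> M" "y \<in> M" "y \<noteq> A" "angle A P y \<le> 0" "0 \<le> \<mu>"
  shows "arc A P y \<mu> \<in> M"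
proof -
  have w: "0 < arc_weight A P y \<mu>" using arc_weight_pos[OF assms] .
  have "0 \<le> arc_weight A P y \<mu> * h (arc A P y \<mu>) P"
    using h_arc_end(1)[of A P y \<mu>] w h_nonneg[OF assms(1,2)] h_nonneg[OF assms(2,3)] by simp
  then have "0 \<le> h (arc A P y \<mu>) P" using w by (simp add: zero_le_mult_iff)
  moreover obtain \<alpha> \<beta> \<delta> where "\<alpha> + \<beta> + \<delta> = 1" "\<alpha> * \<beta> * h A y + \<alpha> * \<delta> * h A P + \<beta> * \<delta> * h y P = 0"
    "arc A P y \<mu> = \<alpha> *\<^sub>R A + \<beta> *\<^sub>R y + \<delta> *\<^sub>R P"
    using arc_affine_combination[of A P y \<mu>] w by (metis less_irrefl)
  ultimately show ?thesis using conic_mem[OF assms(1,3,2), of \<alpha> \<beta> \<delta>] by simp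
qed

text \<open>Along an arc \<open>angle\<close> is a positive multiple of its value at
  \<open>y\<close>: circles through \<open>A\<close> and \<open>P\<close> do not cross the sphere
  with diameter \<open>AP\<close>.\<close>

lemma angle_arc_sign:
  assumes "A \<in> M" "P \<in> M" "y \<in> M" "y \<noteq> A" "A \<noteq> P" "0 < \<mu>"
  shows "angle A P y < 0 \<Longrightarrow> angle A P (arc A P y \<mu>) < 0"
    and "angle A P y = 0 \<Longrightarrow> angle A P (arc A P y \<mu>) = 0"
proof -
  have hAP: "0 < h A P" using assms h_pos by blast
  show "angle A P (arc A P y \<mu>) < 0" if n: "angle A P y < 0"
  proof -
    have w: "0 < arc_weight A P y \<mu>" using arc_weight_pos[of A P y \<mu>] assms n by simp
    have "arc_weight A P y \<mu> * angle A P (arc A P y \<mu>) < 0"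
      using angle_arc[of A P y \<mu>] w hAP n assms(6) by (simp add: mult_pos_neg)
    then show ?thesis using w by (simp add: mult_less_0_iff)
  qed
  show "angle A P (arc A P y \<mu>) = 0" if n: "angle A P y = 0"
  proof -
    have w: "0 < arc_weight A P y \<mu>" using arc_weight_pos[of A P y \<mu>] assms n by simp
    then show ?thesis using angle_arc[of A P y \<mu>] n by simp
  qed
qed

text \<open>The antipode is the affine combination with weights 1, -1, 1, and for these weights the
  circle equation says exactly that \<open>x\<close> lies on the sphere with diameter
  \<open>AP\<close>.\<close>

lemma reflect_mem:
  assumes "A \<in> M" "P \<in> M" "x \<in> M" "angle A P x = 0"
  shows "A + P - x \<in> M"
proof -
  have e: "1 *\<^sub>R A + (- 1) *\<^sub>R x + 1 *\<^sub>R P = A + P - x" by simp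
  have "h (A + P - x) P = h A x" by (simp add: h_def)
  then have "0 \<le> h (1 *\<^sub>R A + (- 1) *\<^sub>R x + 1 *\<^sub>R P) P" using h_nonneg[OF assms(1,3)] unfolding e by simp
  moreover have "1 * (- 1) * h A x + 1 * 1 * h A P + (- 1) * 1 * h x P = 0"
    using assms(4) by (simp add: angle_eq h_commute[of x P])
  ultimately have "1 *\<^sub>R A + (- 1) *\<^sub>R x + 1 *\<^sub>R P \<in> M"
    by (intro conic_mem[OF assms(1,3,2)]) simp_all
  then show ?thesis unfolding e .
qed

lemma arc_tendsto_end:
  assumes "A \<in> M" "P \<in> M" "y \<in> M" "y \<noteq> A"
  shows "((\<lambda>\<mu>. arc A P y \<mu>) \<longlongrightarrow> P) (at_right 0)"
proof -
  have hA: "h A y \<noteq> 0" using assms h_pos[of A y] by auto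
  have "((\<lambda>\<mu>. arc A P y \<mu>) \<longlongrightarrow> arc A P y 0) (at_right 0)"
    by (rule arc_tendsto) (use hA in \<open>auto simp: arc_weight_def intro: tendsto_intros\<close>)
  then show ?thesis using arc_0[OF hA] by simp
qed

text \<open>The witness is the arc from \<open>x\<close> to \<open>y\<close> in the pencil through
  \<open>x\<close> and its antipode: it stays inside the sphere and tends to
  \<open>x\<close>.\<close>

lemma in_closure_negative_angle:
  assumes "A \<in> M" "P \<in> M" "x \<in> M" "angle A P x = 0" "x \<noteq> A" "x \<noteq> P"
    and y: "y \<in> M" "angle A P y < 0"
  shows "\<exists>f. (\<forall>\<^sub>F \<mu> in at_right (0::real). f \<mu> \<in> M \<and> angle A P (f \<mu>) < 0) \<and> (f \<longlongrightarrow> x) (at_right 0)"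
proof -
  let ?A = "A + P - x"
  have m: "?A \<in> M" using reflect_mem assms by simp
  have a: "angle ?A x w = angle A P w" for w using angle_conjugate_pair[OF assms(4)] .
  have ne: "y \<noteq> ?A" using angle_reflect[OF assms(4)] y(2) by auto
  have neA: "?A \<noteq> x"
  proof
    assume e: "?A = x"
    have "angle A P A = angle ?A x A" using a by simp
    then have "angle x x A = 0" using e by (simp add: angle_eq h_commute)
    then have "h x A = 0" by (simp add: angle_eq)
    then show False using h_pos[of x A] assms by auto
  qed
  have "\<forall>\<^sub>F \<mu> in at_right (0::real). 0 < \<mu>" by (simp add: eventually_at_right_less)
  then have "\<forall>\<^sub>F \<mu> in at_right (0::real). arc ?A x y \<mu> \<in> M \<and> angle A P (arc ?A x y \<mu>) < 0"
  proof eventually_elim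
    case (elim \<mu>)
    then show ?case
      using arc_mem[OF m assms(3) y(1) ne, of \<mu>] angle_arc_sign(1)[OF m assms(3) y(1) ne neA, of \<mu>] y(2)
      unfolding a by simp
  qed
  then show ?thesis using arc_tendsto_end[OF m assms(3) y(1) ne] by blast
qed

text \<open>Applied both to the hypersurface itself and to open regions bounded by it.\<close>

definition supported :: "'v set \<Rightarrow> 'v \<Rightarrow> 'v \<Rightarrow> bool" where
  "supported I Q z \<longleftrightarrow> z \<in> M \<and> h Q z = c1 \<and> (\<exists>U. open U \<and> Q \<in> U \<and> (\<forall>x\<in>I \<inter> U. h x z \<le> c1))"

lemma supported_closure:
  assumes "supported I Q z"
  obtains U where "open U" "Q \<in> U" "\<And>x. x \<in> closure I \<inter> U \<Longrightarrow> h x z \<le> c1"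
proof -
  obtain U where U: "open U" "Q \<in> U" "\<forall>x\<in>I \<inter> U. h x z \<le> c1"
    using assms unfolding supported_def by blast
  have "closed {x. h x z \<le> c1}"
    by (rule closed_Collect_le) (auto intro!: continuous_intros)
  then have "closure (I \<inter> U) \<subseteq> {x. h x z \<le> c1}"
    using U(3) by (intro closure_minimal) auto
  then have "x \<in> closure I \<inter> U \<Longrightarrow> h x z \<le> c1" for x
    using open_Int_closure_subset[OF U(1), of I] by (auto simp: Int_commute)
  then show thesis using that U by blast
qed

end

section \<open>Trapping a region in a ball\<close>

text \<open>The assumption \<open>centre\<close> puts the sphere about \<open>c\<close> through
  \<open>P\<close> into the pencil spanned by the point \<open>P\<close> and the sphere with
  diameter \<open>AP\<close>: the two touch at \<open>P\<close>, from the same side because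
  \<open>q\<close> is positive. The point \<open>y0\<close> inside the sphere yields a start for the
  continuity argument, and \<open>x0\<close> on it a way to move off \<open>A\<close>.\<close>

locale trap = circle_geometry b M c1 c2
  for b :: "'v::euclidean_space \<Rightarrow> 'v \<Rightarrow> real" and M c1 c2 +
  fixes I :: "'v set" and c P A y0 x0 :: 'v and q s :: real
  assumes I_open: "openin (top_of_set M) I" and I_connected: "connected I"
    and I_supported: "Q \<in> closure I - I \<Longrightarrow> \<exists>z. supported I Q z"
    and c_mem: "c \<in> M" and P_mem: "P \<in> closure I - I"
    and ball: "x \<in> M \<Longrightarrow> h x c < h P c \<Longrightarrow> x \<in> I"
    and A_mem: "A \<in> M" and A_far: "c2 < h A P" and q_pos: "0 < q"
    and centre: "y \<in> M \<Longrightarrow> h y c - h P c = s * h P y + q * angle A P y"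
    and y0: "y0 \<in> M" "angle A P y0 < 0"
    and x0: "x0 \<in> M" "angle A P x0 = 0" "x0 \<noteq> A" "x0 \<noteq> P"
begin

lemma I_sub: "I \<subseteq> M" using I_open by (simp add: openin_subset openin_imp_subset)
lemma closure_I_sub: "closure I \<subseteq> M" using I_sub closed_M by (simp add: closure_minimal)
lemma P_M: "P \<in> M" using P_mem closure_I_sub by blast

lemma A_neq_P: "A \<noteq> P"
proof
  assume e: "A = P"
  obtain z where z: "supported I P z" using I_supported P_mem by blast
  have "h P P \<le> c2" using diameter[of P P z] z P_M by (simp add: supported_def)
  then show False using A_far e by simp
qed

lemma hAP_pos: "0 < h A P" using h_pos A_mem P_M A_neq_P by blast

lemma far_not_both:
  assumes "z \<in> M" "h P z \<le> c1" shows "c1 < h A z"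
proof (rule ccontr)
  assume "\<not> c1 < h A z"
  then have "h A P \<le> c2" using diameter[of A P z] assms A_mem P_M by simp
  then show False using A_far by simp
qed

lemma limit_not_in_I:
  assumes "\<And>n. f n \<in> M" "\<And>n. f n \<notin> I" "f \<longlonglongrightarrow> l"
  shows "l \<notin> I"
proof
  assume "l \<in> I"
  obtain T where T: "open T" "I = M \<inter> T" using I_open by (auto simp: openin_open)
  have "\<forall>\<^sub>F n in sequentially. f n \<in> T"
    using topological_tendstoD[OF assms(3) T(1)] \<open>l \<in> I\<close> T(2) by blast
  then obtain n where "f n \<in> T" using eventually_happens'[OF sequentially_bot] by blast
  then show False using assms(1,2) T(2) by blast
qed

abbreviation "\<gamma> \<equiv> arc A P"

text \<open>By \<open>centre\<close> the slope with respect to \<open>c\<close> is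
  \<open>h A P * (q * angle A P y)\<close>, so the last hypothesis says that the arc point lies
  inside the inscribed ball.\<close>

lemma near_end:
  assumes "y \<in> M" "y \<noteq> A" "angle A P y \<le> 0" "0 < \<mu>"
    and "q * angle A P y + \<mu> * (s * h P y) < 0"
  shows "\<gamma> y \<mu> \<in> I"
proof -
  have w: "0 < arc_weight A P y \<mu>" using arc_weight_pos[OF A_mem P_M] assms by simp
  have cA: "h A c - h P c = s * h A P" using centre[OF A_mem] by (simp add: angle_eq h_commute)
  have cy: "h y c - h P c = s * h P y + q * angle A P y" using centre[OF assms(1)] .
  have sl: "slope A P c y = h A P * (q * angle A P y)"
    unfolding slope_def cA cy by (simp add: algebra_simps)
  have "arc_weight A P y \<mu> * (h (\<gamma> y \<mu>) c - h P c) = \<mu> * h A P * (q * angle A P y + \<mu> * (s * h P y))"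
    using h_arc_slope[of A P y \<mu> c] w unfolding sl cA by (simp add: algebra_simps)
  also have "\<dots> < 0" using assms hAP_pos by (simp add: mult_pos_neg)
  finally have "h (\<gamma> y \<mu>) c < h P c" using w by (simp add: mult_less_0_iff)
  then show ?thesis using ball arc_mem[OF A_mem P_M] assms by simp
qed

lemma eventually_near_end:
  assumes "y \<in> M" "angle A P y < 0"
  shows "\<forall>\<^sub>F \<mu> in at_right 0. \<gamma> y \<mu> \<in> I"
proof -
  have yA: "y \<noteq> A" using assms by (auto simp: angle_eq h_commute)
  have "((\<lambda>\<mu>. q * angle A P y + \<mu> * (s * h P y)) \<longlongrightarrow> q * angle A P y + 0 * (s * h P y)) (at_right 0)"
    by (intro tendsto_intros)
  then have "\<forall>\<^sub>F \<mu> in at_right 0. q * angle A P y + \<mu> * (s * h P y) < 0"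
    by (rule order_tendstoD(2)) (use assms q_pos in \<open>simp add: mult_pos_neg\<close>)
  moreover have "\<forall>\<^sub>F \<mu> in at_right (0::real). 0 < \<mu>" by (simp add: eventually_at_right_less)
  ultimately show ?thesis
  proof eventually_elim
    case (elim \<mu>)
    then show ?case using near_end[OF assms(1) yA less_imp_le[OF assms(2)]] by blast
  qed
qed

text \<open>Support at \<open>P\<close> makes linear plus quadratic term nonpositive at some small
  parameter. The quadratic coefficient is positive because \<open>A\<close> lies outside the
  supporting ball; hence the strict inequality.\<close>

lemma slope_bound_of_arc:
  assumes z: "supported I P z" and y: "y \<in> M" "y \<noteq> A" "y \<noteq> P" "angle A P y \<le> 0"
    and ev: "\<forall>\<^sub>F \<mu> in at_right 0. \<gamma> y \<mu> \<in> closure I"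
  shows "slope A P z y < 0"
proof -
  obtain U where U: "open U" "P \<in> U" "\<And>x. x \<in> closure I \<inter> U \<Longrightarrow> h x z \<le> c1"
    using supported_closure[OF z] by blast
  have zM: "z \<in> M" "h P z = c1" using z by (auto simp: supported_def)
  have "\<forall>\<^sub>F \<mu> in at_right 0. \<gamma> y \<mu> \<in> U"
    using topological_tendstoD[OF arc_tendsto_end[OF A_mem P_M y(1,2)] U(1,2)] .
  moreover have "\<forall>\<^sub>F \<mu> in at_right (0::real). 0 < \<mu>" by (simp add: eventually_at_right_less)
  ultimately have "\<forall>\<^sub>F \<mu> in at_right 0. 0 < \<mu> \<and> \<gamma> y \<mu> \<in> closure I \<inter> U"
    using ev by eventually_elim auto
  then obtain \<mu> where m: "0 < \<mu>" "\<gamma> y \<mu> \<in> closure I \<inter> U"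
    using eventually_happens' trivial_limit_at_right_real by blast
  have w: "0 < arc_weight A P y \<mu>" using arc_weight_pos[OF A_mem P_M] y m by simp
  have "arc_weight A P y \<mu> * (h (\<gamma> y \<mu>) z - h P z) \<le> 0"
    using U(3)[OF m(2)] zM w by (simp add: mult_le_0_iff)
  then have "\<mu> * (slope A P z y + \<mu> * (h P y * (h A z - h P z))) \<le> 0"
    using h_arc_slope[of A P y \<mu> z] w by simp
  then have "slope A P z y + \<mu> * (h P y * (h A z - h P z)) \<le> 0"
    using m by (simp add: mult_le_0_iff)
  moreover have "0 < \<mu> * (h P y * (h A z - h P z))"
    using m far_not_both[OF zM(1)] zM h_pos[OF P_M y(1)] y(3) by simp
  ultimately show ?thesis by linarith
qed

lemma slope_nonpos_inside:
  assumes "supported I P z" "y \<in> M" "angle A P y < 0"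
  shows "slope A P z y < 0"
proof -
  have "y \<noteq> A" "y \<noteq> P" using assms by (auto simp: angle_eq h_commute)
  moreover have "\<forall>\<^sub>F \<mu> in at_right 0. \<gamma> y \<mu> \<in> closure I"
    using eventually_near_end[OF assms(2,3)] closure_subset by (auto elim!: eventually_mono)
  ultimately show ?thesis using slope_bound_of_arc assms by simp
qed

text \<open>For \<open>x\<close> on the sphere no arc is known to start in the closure of
  \<open>I\<close>, so the bound is a limit of those for points inside, whose arcs start in the
  inscribed ball. The price is that strictness is lost.\<close>

lemma slope_nonpos_boundary:
  assumes z: "supported I P z" and x: "x \<in> M" "angle A P x = 0" "x \<noteq> A" "x \<noteq> P"
  shows "slope A P z x \<le> 0"
proof -
  obtain f where f: "\<forall>\<^sub>F \<mu> in at_right (0::real). f \<mu> \<in> M \<and> angle A P (f \<mu>) < 0" "(f \<longlongrightarrow> x) (at_right 0)"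
    using in_closure_negative_angle[OF A_mem P_M x y0] by blast
  have "((\<lambda>\<mu>. slope A P z (f \<mu>)) \<longlongrightarrow> slope A P z x) (at_right 0)"
    unfolding slope_def by (intro tendsto_intros f(2))
  moreover have "\<forall>\<^sub>F \<mu> in at_right 0. slope A P z (f \<mu>) \<le> 0"
    using f(1) by eventually_elim (use slope_nonpos_inside[OF z] in \<open>auto intro: less_imp_le\<close>)
  ultimately show ?thesis by (rule tendsto_upperbound) simp
qed

text \<open>This settles the end \<open>P\<close>: the slope of \<open>x\<close> would be negative
  and that of its antipode is nonpositive, but their sum is zero.\<close>

lemma no_boundary_arc:
  assumes x: "x \<in> M" "angle A P x = 0" "x \<noteq> A" "x \<noteq> P"
  shows "\<not> (\<forall>\<^sub>F \<mu> in at_right 0. \<gamma> x \<mu> \<in> closure I)"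
proof
  assume ev: "\<forall>\<^sub>F \<mu> in at_right 0. \<gamma> x \<mu> \<in> closure I"
  obtain z where z: "supported I P z" using I_supported P_mem by blast
  have "slope A P z x < 0" using slope_bound_of_arc[OF z] x ev by simp
  moreover have "slope A P z (A + P - x) \<le> 0"
    using slope_nonpos_boundary[OF z reflect_mem[OF A_mem P_M x(1,2)] angle_reflect[OF x(2)]] x(3,4)
    by (auto simp: algebra_simps)
  ultimately show False using slope_antisymmetric[OF x(2), of z] by linarith
qed

text \<open>Relative to the ball supporting \<open>I\<close> at the touching point, the numerator of
  \<open>h\<close> minus \<open>c1\<close> along the arc is a quadratic with a local maximum zero.
  Its constant and leading coefficients are then nonpositive, which puts \<open>P\<close> and
  \<open>A\<close> into that ball.\<close>

lemma no_touching:
  assumes y: "y \<in> I" "angle A P y < 0" and cl: "\<And>\<mu>. 0 < \<mu> \<Longrightarrow> \<mu> \<le> 1 \<Longrightarrow> \<gamma> y \<mu> \<in> closure I"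
    and m: "0 < \<mu>" "\<mu> \<le> 1"
  shows "\<gamma> y \<mu> \<in> I"
proof (rule ccontr)
  assume n: "\<gamma> y \<mu> \<notin> I"
  have yM: "y \<in> M" using y I_sub by blast
  have yA: "y \<noteq> A" "y \<noteq> P" using y by (auto simp: angle_eq h_commute)
  \<comment> \<open>The touching point is not an end of the arc, so the arc stays in the closure of
    \<open>I\<close> on both of its sides.\<close>
  have "\<mu> \<noteq> 1" using n y arc_1[of A P y] hAP_pos by auto
  then have m1: "0 < \<mu>" "\<mu> < 1" using m by auto
  obtain z where z: "supported I (\<gamma> y \<mu>) z" using I_supported cl n m by blast
  obtain U where U: "open U" "\<gamma> y \<mu> \<in> U" "\<And>x. x \<in> closure I \<inter> U \<Longrightarrow> h x z \<le> c1"
    using supported_closure[OF z] by blast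
  have zM: "z \<in> M" "h (\<gamma> y \<mu>) z = c1" using z by (auto simp: supported_def)
  have w: "0 < arc_weight A P y t" if "0 \<le> t" for t using arc_weight_pos[OF A_mem P_M yM yA(1)] y that by simp
  define f0 f1 f2 where "f0 = h A y * (h P z - c1)"
    and "f1 = h A P * h y z - h A y * h P z - h P y * h A z - c1 * (h A P - h A y - h P y)"
    and "f2 = h P y * (h A z - c1)"
  have f: "arc_weight A P y t * (h (\<gamma> y t) z - c1) = f0 + f1 * t + f2 * t\<^sup>2" if "0 \<le> t" for t
  proof -
    have "arc_weight A P y t * (h (\<gamma> y t) z - c1) =
        arc_weight A P y t * h (\<gamma> y t) z - c1 * arc_weight A P y t" by (simp add: algebra_simps)
    also have "\<dots> = f0 + f1 * t + f2 * t\<^sup>2"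
      using h_arc[of A P y t z] w[OF that] unfolding f0_def f1_def f2_def
      by (simp add: arc_weight_sum algebra_simps power2_eq_square)
    finally show ?thesis .
  qed
  have "(\<gamma> y \<longlongrightarrow> \<gamma> y \<mu>) (at \<mu>)"
    using arc_tendsto[OF tendsto_const[of y] tendsto_ident_at, of A P \<mu> UNIV] w[of \<mu>] m1 by simp
  then have "\<forall>\<^sub>F t in at \<mu>. \<gamma> y t \<in> U" using U(1,2) by (rule topological_tendstoD)
  moreover have "\<forall>\<^sub>F t in at \<mu>. 0 < t" "\<forall>\<^sub>F t in at \<mu>. t < 1"
    using order_tendstoD[OF tendsto_ident_at[of \<mu> UNIV]] m1 by auto
  ultimately have "\<forall>\<^sub>F t in at \<mu>. f0 + f1 * t + f2 * t\<^sup>2 \<le> 0"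
  proof eventually_elim
    case (elim t)
    then have "h (\<gamma> y t) z \<le> c1" using U(3) cl by simp
    then show ?case using f[of t] w[of t] elim by (metis diff_le_0_iff_le less_imp_le mult_nonneg_nonpos)
  qed
  moreover have "f0 + f1 * \<mu> + f2 * \<mu>\<^sup>2 = 0" using f[of \<mu>] zM m by simp
  ultimately have "f0 \<le> 0" "f2 \<le> 0" using quadratic_local_max_global by blast+
  then have "h P z \<le> c1" "h A z \<le> c1"
    using h_pos[OF A_mem yM] h_pos[OF P_M yM] yA unfolding f0_def f2_def
    by (auto simp: mult_le_0_iff)
  then show False using far_not_both[OF zM(1)] by simp
qed

text \<open>The set of the continuity argument; connectedness of \<open>I\<close> will give
  \<open>G = I\<close>.\<close>

definition G :: "'v set" where
  "G = {y \<in> I. angle A P y < 0 \<and> (\<forall>\<mu>. 0 < \<mu> \<and> \<mu> \<le> 1 \<longrightarrow> \<gamma> y \<mu> \<in> I)}"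

lemma G_limit:
  assumes "\<And>n. f n \<in> G" "f \<longlonglongrightarrow> y" "y \<in> I" "y \<noteq> A"
  shows "angle A P y \<le> 0" "\<And>\<mu>. 0 < \<mu> \<Longrightarrow> \<mu> \<le> 1 \<Longrightarrow> \<gamma> y \<mu> \<in> closure I"
proof -
  have "(\<lambda>n. angle A P (f n)) \<longlonglongrightarrow> angle A P y"
    unfolding angle_eq by (intro tendsto_intros assms(2))
  then show a: "angle A P y \<le> 0"
    by (rule tendsto_upperbound) (use assms(1) in \<open>auto simp: G_def intro!: always_eventually less_imp_le\<close>)
  fix \<mu> :: real assume m: "0 < \<mu>" "\<mu> \<le> 1"
  have "arc_weight A P y \<mu> \<noteq> 0"
    using arc_weight_pos[OF A_mem P_M _ assms(4) a, of \<mu>] assms(3) I_sub m by fastforce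
  then have "(\<lambda>n. \<gamma> (f n) \<mu>) \<longlonglongrightarrow> \<gamma> y \<mu>"
    by (intro arc_tendsto assms(2) tendsto_const)
  moreover have "\<gamma> (f n) \<mu> \<in> I" for n using assms(1)[of n] m by (simp add: G_def)
  ultimately show "\<gamma> y \<mu> \<in> closure I"
    unfolding closure_sequential by (intro exI[of _ "\<lambda>n. \<gamma> (f n) \<mu>"]) blast
qed

lemma G_closed:
  assumes "\<And>n. f n \<in> G" "f \<longlonglongrightarrow> y" "y \<in> I" "angle A P y < 0"
  shows "y \<in> G"
proof -
  have "y \<noteq> A" using assms(4) by (auto simp: angle_eq h_commute)
  then show ?thesis
    using no_touching[OF assms(3,4) G_limit(2)[OF assms(1,2,3)]] assms(3,4) unfolding G_def by auto
qed

text \<open>Openness in sequential form. Bad parameters on arcs of points near \<open>y\<close>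
  would accumulate in [0, 1]: at a positive limit the arc of \<open>y\<close> itself is bad, and at
  the limit 0 \<open>near_end\<close> is contradicted, since its condition is open in point and
  parameter.\<close>

lemma G_open:
  assumes "\<And>n. f n \<in> I - G" "f \<longlonglongrightarrow> y"
  shows "y \<notin> G"
proof
  assume yG: "y \<in> G"
  then have y: "y \<in> I" "angle A P y < 0" by (auto simp: G_def)
  have yM: "y \<in> M" using y I_sub by blast
  have yA: "y \<noteq> A" using y by (auto simp: angle_eq h_commute)
  have lim: "(\<lambda>n. angle A P (f n)) \<longlonglongrightarrow> angle A P y"
    unfolding angle_eq by (intro tendsto_intros assms(2))
  then have "\<forall>\<^sub>F n in sequentially. angle A P (f n) < 0" using y(2) by (rule order_tendstoD)
  then obtain n0 where n0: "\<And>n. n \<ge> n0 \<Longrightarrow> angle A P (f n) < 0" by (auto simp: eventually_sequentially)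
  define g where "g n = f (n + n0)" for n
  have g: "g n \<in> M" "angle A P (g n) < 0" "g n \<in> I - G" "g n \<noteq> A" for n
    using n0[of "n + n0"] assms(1)[of "n + n0"] I_sub unfolding g_def by (auto simp: angle_eq h_commute)
  have glim: "g \<longlonglongrightarrow> y" unfolding g_def using LIMSEQ_ignore_initial_segment[OF assms(2)] .
  have "\<forall>n. \<exists>\<mu>. 0 < \<mu> \<and> \<mu> \<le> 1 \<and> \<gamma> (g n) \<mu> \<notin> I" using g unfolding G_def by auto
  then obtain m where m: "\<And>n. 0 < m n" "\<And>n. m n \<le> 1" "\<And>n. \<gamma> (g n) (m n) \<notin> I" by metis
  have "\<forall>n. m n \<in> {0..1}" using m(1,2) by (auto intro: less_imp_le)
  then obtain \<mu> r where r: "\<mu> \<in> {0..1}" "strict_mono r" "(m \<circ> r) \<longlonglongrightarrow> \<mu>"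
    using seq_compactE[OF compact_imp_seq_compact[OF compact_Icc[of "0::real" 1]], of m] by blast
  have gr: "(g \<circ> r) \<longlonglongrightarrow> y" using LIMSEQ_subseq_LIMSEQ[OF glim r(2)] .
  show False
  proof (cases "\<mu> = 0")
    case False
    have w: "arc_weight A P y \<mu> \<noteq> 0"
      using arc_weight_pos[OF A_mem P_M yM yA, of \<mu>] y r(1) by fastforce
    have "(\<lambda>n. \<gamma> ((g \<circ> r) n) ((m \<circ> r) n)) \<longlonglongrightarrow> \<gamma> y \<mu>" by (intro arc_tendsto gr r(3) w)
    moreover have "\<gamma> ((g \<circ> r) n) ((m \<circ> r) n) \<in> M" for n
      using arc_mem[OF A_mem P_M g(1,4), of "r n" "m (r n)"] g(2)[of "r n"] m(1)[of "r n"] by simp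
    ultimately have "\<gamma> y \<mu> \<notin> I"
      using limit_not_in_I[of "\<lambda>n. \<gamma> ((g \<circ> r) n) ((m \<circ> r) n)"] m(3) by simp
    then show False using yG r(1) False by (auto simp: G_def)
  next
    case True
    have "(\<lambda>n. q * angle A P ((g \<circ> r) n) + (m \<circ> r) n * (s * h P ((g \<circ> r) n))) \<longlonglongrightarrow>
        q * angle A P y + \<mu> * (s * h P y)"
      unfolding angle_eq by (intro tendsto_intros gr r(3))
    then have "\<forall>\<^sub>F n in sequentially. q * angle A P ((g \<circ> r) n) + (m \<circ> r) n * (s * h P ((g \<circ> r) n)) < 0"
      by (rule order_tendstoD(2)) (use True y q_pos in \<open>simp add: mult_pos_neg\<close>)
    then obtain n where "q * angle A P ((g \<circ> r) n) + (m \<circ> r) n * (s * h P ((g \<circ> r) n)) < 0"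
      using eventually_happens'[OF sequentially_bot] by blast
    then have "\<gamma> (g (r n)) (m (r n)) \<in> I"
      using near_end[OF g(1,4) less_imp_le[OF g(2)] m(1), of "r n" "r n"] by simp
    then show False using m(3) by blast
  qed
qed

text \<open>The point \<open>y0\<close> may lie outside \<open>I\<close>; its arc is followed
  towards \<open>P\<close> until it is inside the inscribed ball.\<close>

lemma G_nonempty: "G \<noteq> {}"
proof -
  have yA: "y0 \<noteq> A" using y0 by (auto simp: angle_eq h_commute)
  have "\<forall>\<^sub>F \<mu> in at_right (0::real). 0 < \<mu>" by (simp add: eventually_at_right_less)
  moreover have "((\<lambda>\<mu>. q * angle A P y0 + \<mu> * (s * h P y0)) \<longlongrightarrow> q * angle A P y0 + 0 * (s * h P y0)) (at_right 0)"
    by (intro tendsto_intros)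
  then have "\<forall>\<^sub>F \<mu> in at_right 0. q * angle A P y0 + \<mu> * (s * h P y0) < 0"
    by (rule order_tendstoD(2)) (use y0 q_pos in \<open>simp add: mult_pos_neg\<close>)
  ultimately have "\<forall>\<^sub>F \<mu> in at_right 0. 0 < \<mu> \<and> q * angle A P y0 + \<mu> * (s * h P y0) < 0"
    by eventually_elim simp
  then obtain \<mu> where m: "0 < \<mu>" "q * angle A P y0 + \<mu> * (s * h P y0) < 0"
    using eventually_happens' trivial_limit_at_right_real by blast
  define y where "y = \<gamma> y0 \<mu>"
  have w: "0 < arc_weight A P y0 \<mu>" using arc_weight_pos[OF A_mem P_M y0(1) yA] y0 m by simp
  have yM: "y \<in> M" unfolding y_def using arc_mem[OF A_mem P_M y0(1) yA] y0 m by simp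
  have ya: "angle A P y < 0" unfolding y_def
    using angle_arc_sign(1)[OF A_mem P_M y0(1) yA A_neq_P m(1) y0(2)] .
  have neA: "y \<noteq> A" using ya by (auto simp: angle_eq h_commute)
  text \<open>On the arc of an arc the defect is again affine in the parameter, and it is negative at both
    ends.\<close>
  have one: "q * angle A P y + s * h P y < 0"
  proof -
    have "arc_weight A P y0 \<mu> * (q * angle A P y + s * h P y) =
        q * (arc_weight A P y0 \<mu> * angle A P y) + s * (arc_weight A P y0 \<mu> * h y P)"
      by (simp add: algebra_simps h_commute)
    also have "\<dots> = \<mu> * h A P * (q * angle A P y0 + \<mu> * (s * h P y0))"
      using angle_arc[of A P y0 \<mu>] h_arc_end(1)[of A P y0 \<mu>] w unfolding y_def
      by (simp add: algebra_simps power2_eq_square)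
    also have "\<dots> < 0" using m hAP_pos by (simp add: mult_pos_neg)
    finally show ?thesis using w by (simp add: mult_less_0_iff)
  qed
  have "q * angle A P y + t * (s * h P y) < 0" if "0 < t" "t \<le> 1" for t
  proof -
    have "q * angle A P y + t * (s * h P y) = (1 - t) * (q * angle A P y) + t * (q * angle A P y + s * h P y)"
      by (simp add: algebra_simps)
    also have "\<dots> < 0"
      using that one ya q_pos by (intro add_nonpos_neg) (auto simp: mult_le_0_iff mult_less_0_iff)
    finally show ?thesis .
  qed
  then have arcs: "\<gamma> y t \<in> I" if "0 < t" "t \<le> 1" for t
    using near_end[OF yM neA less_imp_le[OF ya] that(1)] that by blast
  have "arc A P y 1 = y" using hAP_pos by (intro arc_1) simp
  then have "y \<in> I" using arcs[of 1] by simp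
  then have "y \<in> G" using ya arcs unfolding G_def by blast
  then show ?thesis by blast
qed

lemma G_sub: "G \<subseteq> I" by (auto simp: G_def)

text \<open>The pencil of circles through \<open>A\<close> and \<open>P\<close> degenerates at \<open>A\<close>, so a limit point \<open>A\<close> of \<open>G\<close> is
  first pushed along the sphere \<open>angle A P = 0\<close>, by a circle orthogonal to it.\<close>

lemma move_limit_off_A:
  assumes f: "\<And>n. f n \<in> G" "f \<longlonglongrightarrow> A" and A: "A \<in> I"
  shows "\<exists>x g. x \<in> I \<and> x \<noteq> A \<and> angle A P x = 0 \<and> (\<forall>n. g n \<in> G) \<and> g \<longlonglongrightarrow> x"
proof -
  \<comment> \<open>\<open>B\<close> and \<open>x0\<close> are antipodal on the sphere with diameter
    \<open>AP\<close>. Arcs of their pencil remain on the sphere if they end on it, and inside if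
    they end inside.\<close>
  define B where "B = A + P - x0"
  have B: "B \<in> M" unfolding B_def using reflect_mem[OF A_mem P_M x0(1,2)] .
  have BA: "B \<noteq> A" using x0 unfolding B_def by auto
  have ang: "angle B x0 y = angle A P y" for y unfolding B_def using angle_conjugate_pair[OF x0(2)] .
  have aA: "angle A P A = 0" by (simp add: angle_eq h_commute)
  have Bx0: "B \<noteq> x0"
  proof
    assume "B = x0"
    then have "h x0 A = 0" using ang[of A] aA by (simp add: angle_eq)
    then show False using h_pos[OF x0(1) A_mem] x0 by auto
  qed
  let ?p = "arc B x0"
  have wA: "0 < arc_weight B x0 A t" if "0 \<le> t" for t
    using arc_weight_pos[OF B x0(1) A_mem BA[symmetric]] ang aA that by simp
  have pA1: "?p A 1 = A" using h_pos[OF B x0(1) Bx0] by (intro arc_1) simp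
  obtain T where T: "open T" "I = M \<inter> T" using I_open by (auto simp: openin_open)
  have "(?p A \<longlongrightarrow> ?p A 1) (at 1)"
    using arc_tendsto[OF tendsto_const[of A] tendsto_ident_at, of B x0 1 UNIV] wA[of 1] by simp
  then have "\<forall>\<^sub>F t in at 1. ?p A t \<in> T" using T A pA1 by (intro topological_tendstoD) auto
  then obtain e where e: "e > 0" "\<And>t. t \<noteq> 1 \<Longrightarrow> dist t 1 < e \<Longrightarrow> ?p A t \<in> T"
    unfolding eventually_at by auto
  \<comment> \<open>Near enough to 1 for the path from \<open>A\<close> to stay in \<open>I\<close>,
    and positive, so that the arcs of the sequence stay strictly inside the sphere.\<close>
  define t1 where "t1 = max (1/2) (1 - e/2)"
  have t1: "0 < t1" "t1 < 1" using e by (auto simp: t1_def)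
  have pT: "?p A t \<in> I" if "t \<in> {t1..1}" for t
  proof -
    have "?p A t \<in> T"
    proof (cases "t = 1")
      case True then show ?thesis using pA1 A T by simp
    next
      case False
      have "dist t 1 < e" using that e(1) by (auto simp: dist_real_def t1_def)
      then show ?thesis using e(2) False by simp
    qed
    moreover have "?p A t \<in> M"
      using arc_mem[OF B x0(1) A_mem BA[symmetric]] ang aA that t1 by simp
    ultimately show ?thesis using T by simp
  qed
  define x where "x = ?p A t1"
  have xI: "x \<in> I" unfolding x_def using pT t1 by simp
  have xa: "angle A P x = 0"
    using angle_arc_sign(2)[OF B x0(1) A_mem BA[symmetric] Bx0 t1(1)] ang aA unfolding x_def by simp
  \<comment> \<open>Pythagoras in the right triangle \<open>B\<close>, \<open>A\<close>,
    \<open>x0\<close>: a return of the arc to \<open>A\<close> would force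
    \<open>t1 = 1\<close>.\<close>
  have xA: "x \<noteq> A"
  proof
    assume e: "x = A"
    have "arc_weight B x0 A t1 * h A x0 = t1\<^sup>2 * h B x0 * h x0 A"
      using h_arc_end(1)[of B x0 A t1] wA[of t1] t1 e unfolding x_def by simp
    then have "arc_weight B x0 A t1 = t1\<^sup>2 * h B x0"
      using h_pos[OF A_mem x0(1)] x0 by (simp add: h_commute)
    moreover have "h B x0 = h B A + h x0 A" using ang[of A] aA by (simp add: angle_eq)
    ultimately have "h B A * (1 - t1\<^sup>2) = 0"
      unfolding arc_weight_def ang aA by (simp add: algebra_simps)
    moreover have "t1\<^sup>2 < 1" using t1 by (simp add: power_less_one_iff abs_square_less_1)
    ultimately show False using h_pos[OF B A_mem BA] by simp
  qed
  have fa: "f n \<in> M" "angle A P (f n) < 0" for n using f(1)[of n] I_sub by (auto simp: G_def)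
  have fB: "f n \<noteq> B" for n using fa(2)[of n] ang[of B] by (auto simp: angle_eq h_commute)
  have path_M: "?p (f n) t \<in> M" "angle A P (?p (f n) t) < 0" "0 < arc_weight B x0 (f n) t" if "t \<in> {t1..1}" for n t
    using arc_mem[OF B x0(1) fa(1) fB, of n t] angle_arc_sign(1)[OF B x0(1) fa(1) fB Bx0, of t n]
      arc_weight_pos[OF B x0(1) fa(1) fB, of n t] fa(2)[of n] that t1 unfolding ang by auto
  have ev: "\<forall>\<^sub>F n in sequentially. \<forall>t\<in>{t1..1}. ?p (f n) t \<in> I"
  proof (rule ccontr)
    assume "\<not> ?thesis"
    then obtain r :: "nat \<Rightarrow> nat" where r: "strict_mono r" "\<forall>n. \<exists>t\<in>{t1..1}. ?p (f (r n)) t \<notin> I"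
      using not_eventually_sequentiallyD[of "\<lambda>n. \<forall>t\<in>{t1..1}. ?p (f n) t \<in> I"] by blast
    then obtain m where m: "\<And>n. m n \<in> {t1..1}" "\<And>n. ?p (f (r n)) (m n) \<notin> I" using r(2) by metis
    obtain l k where l: "l \<in> {t1..1}" "strict_mono k" "(m \<circ> k) \<longlonglongrightarrow> l"
      using seq_compactE[OF compact_imp_seq_compact[OF compact_Icc[of t1 1]], of m] m(1) by blast
    have fl: "(f \<circ> r \<circ> k) \<longlonglongrightarrow> A"
      using LIMSEQ_subseq_LIMSEQ[OF LIMSEQ_subseq_LIMSEQ[OF f(2) r(1)] l(2)] .
    have "arc_weight B x0 A l \<noteq> 0" using wA[of l] l t1 by auto
    with fl l(3) have "(\<lambda>n. ?p ((f \<circ> r \<circ> k) n) ((m \<circ> k) n)) \<longlonglongrightarrow> ?p A l"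
      by (rule arc_tendsto)
    then have "?p A l \<notin> I"
      using limit_not_in_I[of "\<lambda>n. ?p ((f \<circ> r \<circ> k) n) ((m \<circ> k) n)"] m path_M(1) by simp
    then show False using pT l by blast
  qed
  \<comment> \<open>\<open>G\<close> is relatively open and closed along the path, which at
    parameter 1 is at \<open>f n\<close>, a point of \<open>G\<close>.\<close>
  have inG: "?p (f n) t1 \<in> G" if n: "\<forall>t\<in>{t1..1}. ?p (f n) t \<in> I" for n
  proof -
    let ?S = "?p (f n) ` {t1..1}"
    have "continuous_on {t1..1} (?p (f n))"
      unfolding continuous_on_def using path_M(3)[of _ n]
      by (auto intro!: arc_tendsto tendsto_ident_at) fastforce+
    then have con: "connected ?S" by (intro connected_continuous_image) auto
    have SI: "?S \<subseteq> I" using n by auto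
    have Sa: "angle A P y < 0" if "y \<in> ?S" for y using that path_M(2) by auto
    have "closedin (top_of_set ?S) (?S \<inter> G)"
    proof (rule closedin_sequentialI)
      fix u l assume u: "\<And>n. u n \<in> ?S \<inter> G" "u \<longlonglongrightarrow> l" "l \<in> ?S"
      then show "l \<in> ?S \<inter> G" using G_closed[of u l] SI Sa[of l] by blast
    qed auto
    moreover have "closedin (top_of_set ?S) (?S - G)"
    proof (rule closedin_sequentialI)
      fix u l assume "\<And>n. u n \<in> ?S - G" "u \<longlonglongrightarrow> l" "l \<in> ?S"
      then show "l \<in> ?S - G" using G_open[of u l] SI by blast
    qed auto
    then have "openin (top_of_set ?S) (?S \<inter> G)"
      by (simp add: openin_closedin_eq Diff_Int)
    moreover have "f n \<in> ?S \<inter> G"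
    proof -
      have "?p (f n) 1 = f n" using h_pos[OF B x0(1) Bx0] by (intro arc_1) simp
      then show ?thesis using f(1) t1 by (metis IntI atLeastAtMost_iff image_eqI less_imp_le order_refl)
    qed
    ultimately have "?S \<inter> G = ?S" using con unfolding connected_clopen by blast
    then show ?thesis using t1 by auto
  qed
  obtain n0 where n0: "\<And>n. n \<ge> n0 \<Longrightarrow> \<forall>t\<in>{t1..1}. ?p (f n) t \<in> I"
    using ev by (auto simp: eventually_sequentially)
  define g where "g n = ?p (f (n + n0)) t1" for n
  have "g n \<in> G" for n unfolding g_def using inG n0[of "n + n0"] by simp
  moreover have "(\<lambda>n. f (n + n0)) \<longlonglongrightarrow> A" using LIMSEQ_ignore_initial_segment[OF f(2)] .
  then have "g \<longlonglongrightarrow> x" unfolding g_def x_def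
    using wA[of t1] t1 by (intro arc_tendsto tendsto_const) auto
  ultimately show ?thesis using xI xA xa by blast
qed

text \<open>\<open>G\<close> can fail to be closed in \<open>I\<close> only at a point on the sphere
  with diameter \<open>AP\<close>. The arc of such a limit point lies in the closure of
  \<open>I\<close>, which \<open>no_boundary_arc\<close> forbids.\<close>

theorem trapped:
  assumes "x \<in> I"
  shows "angle A P x < 0"
proof -
  have "G = I"
  proof (rule ccontr)
    assume "G \<noteq> I"
    have "closedin (top_of_set I) (I - G)"
    proof (rule closedin_sequentialI)
      fix u l assume "\<And>n. u n \<in> I - G" "u \<longlonglongrightarrow> l" "l \<in> I"
      then show "l \<in> I - G" using G_open[of u l] by blast
    qed auto
    then have "openin (top_of_set I) G" using G_sub by (simp add: openin_closedin_eq double_diff)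
    then have "\<not> closedin (top_of_set I) G"
      using I_connected G_nonempty \<open>G \<noteq> I\<close> unfolding connected_clopen by blast
    then have "\<exists>f x. (\<forall>n. f n \<in> G) \<and> f \<longlonglongrightarrow> x \<and> x \<in> I \<and> x \<notin> G"
      using closedin_sequentialI[OF G_sub] by blast
    then obtain f x where f: "\<And>n. f n \<in> G" "f \<longlonglongrightarrow> x" "x \<in> I" "x \<notin> G" by blast
    have "\<exists>x f. (\<forall>n. f n \<in> G) \<and> f \<longlonglongrightarrow> x \<and> x \<in> I \<and> x \<noteq> A \<and> angle A P x = 0"
    proof (cases "x = A")
      case True
      then show ?thesis using move_limit_off_A[of f] f by blast
    next
      case False
      have "angle A P x \<le> 0" using G_limit(1)[OF f(1-3) False] .
      moreover have "\<not> angle A P x < 0" using G_closed[OF f(1-3)] f(4) by blast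
      ultimately show ?thesis using f False by (intro exI[of _ x] exI[of _ f]) auto
    qed
    then obtain x f where x: "\<And>n. f n \<in> G" "f \<longlonglongrightarrow> x" "x \<in> I" "x \<noteq> A" "angle A P x = 0" by blast
    have "\<forall>\<^sub>F \<mu> in at_right (0::real). 0 < \<mu> \<and> \<mu> < 1"
      using eventually_at_right_real[of 0 "1::real"] by simp
    then have "\<forall>\<^sub>F \<mu> in at_right 0. \<gamma> x \<mu> \<in> closure I"
      by eventually_elim (use G_limit(2)[OF x(1-4)] in auto)
    then show False using no_boundary_arc[of x] x P_mem I_sub by blast
  qed
  then show ?thesis using assms by (auto simp: G_def)
qed

end

section \<open>Sides of a locally convex hypersurface\<close>

lemma line_tendsto: "((\<lambda>t. x + t *\<^sub>R e) \<longlongrightarrow> (x :: 'a::real_normed_vector)) (at 0)"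
proof -
  have "((\<lambda>t. x + t *\<^sub>R e) \<longlongrightarrow> x + 0 *\<^sub>R e) (at 0)" by (intro tendsto_intros)
  then show ?thesis by simp
qed

text \<open>\<open>N\<close> is the central projection of a cone \<open>W\<close> onto \<open>M\<close> (the identity in Euclidean space).  It
  carries segments to geodesics, so geodesic convexity becomes convexity of preimages under \<open>N\<close>.\<close>

locale model_space = circle_geometry b M c1 c2
  for b :: "'v::euclidean_space \<Rightarrow> 'v \<Rightarrow> real" and M c1 c2 +
  fixes W :: "'v set" and N :: "'v \<Rightarrow> 'v"
  assumes c1_pos: "0 < c1"
    and star: "c \<in> M \<Longrightarrow> x \<in> M \<Longrightarrow> p \<in> M \<Longrightarrow> h c x < h c p \<Longrightarrow>
      \<exists>T\<subseteq>M. connected T \<and> c \<in> T \<and> x \<in> T \<and> (\<forall>y\<in>T. h c y \<le> h c x)"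
    and W_open: "open W" and M_sub_W: "M \<subseteq> W"
    and N_continuous: "continuous_on W N" and N_mem: "v \<in> W \<Longrightarrow> N v \<in> M"
    and N_id: "x \<in> M \<Longrightarrow> N x = x"
    and N_section: "v \<in> W \<Longrightarrow> \<exists>s. continuous_on M s \<and> s (N v) = v \<and> (\<forall>y\<in>M. s y \<in> W \<and> N (s y) = y)"
    and ball_convex: "z \<in> M \<Longrightarrow> u \<in> W \<Longrightarrow> v \<in> W \<Longrightarrow> h (N u) z \<le> c1 \<Longrightarrow> h (N v) z \<le> c1 \<Longrightarrow>
      0 \<le> t \<Longrightarrow> t \<le> 1 \<Longrightarrow> (1 - t) *\<^sub>R u + t *\<^sub>R v \<in> W \<Longrightarrow> h (N ((1 - t) *\<^sub>R u + t *\<^sub>R v)) z \<le> c1"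
    and tangent_outside: "Q \<in> M \<Longrightarrow> z \<in> M \<Longrightarrow> h Q z = c1 \<Longrightarrow>
      \<exists>e. \<forall>\<^sub>F t in at 0. Q + t *\<^sub>R e \<in> W \<and> c1 < h (N (Q + t *\<^sub>R e)) z"
begin

text \<open>Convexity of the preimage under \<open>N\<close>, tested only where the segment stays in
  \<open>W\<close>, because \<open>W\<close> need not be convex: for the round sphere it is the
  space without the origin.\<close>

definition gconvex :: "'v set \<Rightarrow> bool" where
  "gconvex K \<longleftrightarrow> K \<subseteq> M \<and> (\<forall>u\<in>W. \<forall>v\<in>W. \<forall>t. 0 \<le> t \<and> t \<le> 1 \<and> N u \<in> K \<and> N v \<in> K \<and>
     (1 - t) *\<^sub>R u + t *\<^sub>R v \<in> W \<longrightarrow> N ((1 - t) *\<^sub>R u + t *\<^sub>R v) \<in> K)"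

abbreviation inner :: "'v set \<Rightarrow> 'v set" where
  "inner K \<equiv> top_of_set M interior_of K"

lemma inner_iff: "x \<in> inner K \<longleftrightarrow> x \<in> M \<and> (\<exists>G. open G \<and> x \<in> G \<and> M \<inter> G \<subseteq> K)"
  unfolding interior_of_def openin_open by auto

lemma inner_open: "\<exists>G. open G \<and> inner K = M \<inter> G"
  using openin_interior_of[of "top_of_set M" K] unfolding openin_open by blast

lemma inner_sub: "inner K \<subseteq> K" by (rule interior_of_subset)

lemma open_preimage: "open G \<Longrightarrow> open {v \<in> W. N v \<in> G}"
  using continuous_open_preimage[OF N_continuous W_open] by (simp add: vimage_def Collect_conj_eq Int_commute)

section \<open>Convex charts near a point\<close>

context
  fixes K B Q and \<epsilon> :: real
  assumes K: "gconvex K" and B: "B = ball Q \<epsilon>" "B \<subseteq> W"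
begin

private definition "K' = {v \<in> B. N v \<in> K}"

private lemma convex_K': "convex K'"
proof (rule convexI)
  fix u v :: 'v and s t :: real
  assume *: "u \<in> K'" "v \<in> K'" "0 \<le> s" "0 \<le> t" "s + t = 1"
  have s: "s = 1 - t" using * by simp
  have m: "u \<in> B" "v \<in> B" "N u \<in> K" "N v \<in> K" "t \<le> 1" using * unfolding K'_def by auto
  then have "s *\<^sub>R u + t *\<^sub>R v \<in> B" unfolding B(1) using * by (intro convexD[OF convex_ball])
  moreover from this have "N (s *\<^sub>R u + t *\<^sub>R v) \<in> K"
    using K[unfolded gconvex_def, THEN conjunct2, rule_format, of u v t] m B(2) *(4) unfolding s by auto
  ultimately show "s *\<^sub>R u + t *\<^sub>R v \<in> K'" unfolding K'_def by simp
qed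

text \<open>One inclusion is continuity of \<open>N\<close>. For the other, a section of
  \<open>N\<close> through \<open>v\<close> pulls the interior of the preimage back to a relative
  neighbourhood of \<open>N v\<close>.\<close>

private lemma interior_K': "interior K' = {v \<in> B. N v \<in> inner K}"
proof
  show "interior K' \<subseteq> {v \<in> B. N v \<in> inner K}"
  proof
    fix v assume v: "v \<in> interior K'"
    then have vB: "v \<in> B" using interior_subset unfolding K'_def by blast
    then have vW: "v \<in> W" using B by blast
    obtain s where s: "continuous_on M s" "s (N v) = v" "\<forall>y\<in>M. s y \<in> W \<and> N (s y) = y"
      using N_section[OF vW] by blast
    have "openin (top_of_set M) (M \<inter> s -` interior K')"
      using s(1) by (simp add: continuous_openin_preimage_gen)
    then have "M \<inter> s -` interior K' \<subseteq> inner K"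
    proof (rule interior_of_maximal[rotated])
      show "M \<inter> s -` interior K' \<subseteq> K"
      proof
        fix y assume "y \<in> M \<inter> s -` interior K'"
        then have "y \<in> M" "s y \<in> K'" using interior_subset by auto
        then show "y \<in> K" using s(3) unfolding K'_def by force
      qed
    qed
    then show "v \<in> {v \<in> B. N v \<in> inner K}" using vB N_mem[OF vW] s(2) v by auto
  qed
  obtain G where G: "open G" "inner K = M \<inter> G" using inner_open by blast
  have "open ({v \<in> W. N v \<in> G} \<inter> B)" using open_preimage[OF G(1)] B by (simp add: open_Int)
  moreover have "{v \<in> W. N v \<in> G} \<inter> B = {v \<in> B. N v \<in> inner K}"
    using B(2) N_mem G(2) by auto
  ultimately show "{v \<in> B. N v \<in> inner K} \<subseteq> interior K'"
    using inner_sub by (intro interior_maximal) (auto simp: K'_def)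
qed

lemmas chart_convex = convex_K'[unfolded K'_def]
lemmas chart_interior = interior_K'[unfolded K'_def]

end

lemma W_ball:
  assumes "Q \<in> W" "open U" "N Q \<in> U"
  obtains \<epsilon> where "\<epsilon> > 0" "ball Q \<epsilon> \<subseteq> W" "N ` ball Q \<epsilon> \<subseteq> U"
proof -
  have "Q \<in> {v \<in> W. N v \<in> U}" using assms by simp
  then obtain \<epsilon> where "\<epsilon> > 0" "ball Q \<epsilon> \<subseteq> {v \<in> W. N v \<in> U}"
    using open_preimage[OF assms(2)] open_contains_ball by blast
  then show thesis using that[of \<epsilon>] by auto
qed

text \<open>In the chart \<open>Q\<close> is the midpoint of two interior points of a convex
  set.\<close>

lemma inner_if_two_sided:
  assumes K: "gconvex K" and Q: "Q \<in> M"
    and ev: "\<forall>\<^sub>F t in at 0. Q + t *\<^sub>R e \<in> W \<and> N (Q + t *\<^sub>R e) \<in> inner K"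
  shows "Q \<in> inner K"
proof -
  obtain \<epsilon> where e: "\<epsilon> > 0" "ball Q \<epsilon> \<subseteq> W" using W_ball[of Q UNIV] Q M_sub_W by auto
  obtain d where d: "d > 0" "\<And>t. t \<noteq> 0 \<Longrightarrow> dist t 0 < d \<Longrightarrow> N (Q + t *\<^sub>R e) \<in> inner K"
    using ev unfolding eventually_at by auto
  \<comment> \<open>Small enough for both \<open>Q + t *\<^sub>R e\<close> and its mirror image to
    stay in the chart ball; the summand 1 guards against \<open>e = 0\<close>.\<close>
  define t where "t = min (d/2) (\<epsilon> / (2 * (norm e + 1)))"
  have t: "0 < t" "t < d" using d e by (auto simp: t_def add_nonneg_pos)
  have "t * norm e \<le> \<epsilon> / (2 * (norm e + 1)) * norm e"
    by (intro mult_right_mono) (auto simp: t_def)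
  also have "\<dots> < \<epsilon>" using e(1)
    by (simp add: divide_simps add_nonneg_pos)
  finally have te: "t * norm e < \<epsilon>" .
  let ?X = "interior {v \<in> ball Q \<epsilon>. N v \<in> K}"
  have int: "?X = {v \<in> ball Q \<epsilon>. N v \<in> inner K}" using chart_interior[OF K refl e(2)] .
  have "Q + t *\<^sub>R e \<in> ?X" "Q + (-t) *\<^sub>R e \<in> ?X"
    using d(2)[of t] d(2)[of "-t"] t te unfolding int by (auto simp: dist_norm)
  then have "(1/2) *\<^sub>R (Q + t *\<^sub>R e) + (1/2) *\<^sub>R (Q + (-t) *\<^sub>R e) \<in> ?X"
    using convex_interior[OF chart_convex[OF K refl e(2)]] by (intro convexD) auto
  moreover have "(1/2) *\<^sub>R (Q + t *\<^sub>R e) + (1/2) *\<^sub>R (Q + (-t) *\<^sub>R e) = Q"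
    by (simp add: algebra_simps flip: scaleR_add_left)
  ultimately show ?thesis using N_id[OF Q] unfolding int by simp
qed

text \<open>Both sides of the boundary of a convex body are connected near \<open>Q\<close>. Inside,
  one takes the interior of the convex chart set. Outside, points are pushed along rays away from an
  interior point \<open>k0\<close>, which never enter the convex set, into one small ball beyond
  \<open>Q\<close>.\<close>

lemma local_picture:
  assumes K: "gconvex K" "closed K" "inner K \<noteq> {}" and Q: "Q \<in> K" "Q \<notin> inner K"
    and U: "open U" "Q \<in> U"
  obtains J C U' where "connected J" "connected C" "J \<subseteq> inner K \<inter> U" "C \<subseteq> (M - K) \<inter> U"
    "open U'" "Q \<in> U'" "U' \<subseteq> U" "inner K \<inter> U' \<subseteq> J" "K \<inter> U' \<subseteq> closure J" "M \<inter> U' - K \<subseteq> C"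
proof -
  have QM: "Q \<in> M" using K Q by (auto simp: gconvex_def)
  then have QW: "Q \<in> W" using M_sub_W by blast
  obtain \<epsilon> where e: "\<epsilon> > 0" "ball Q \<epsilon> \<subseteq> W" "N ` ball Q \<epsilon> \<subseteq> U"
    using W_ball[OF QW U(1)] U(2) N_id[OF QM] by auto
  define B where "B = ball Q \<epsilon>"
  have QB: "Q \<in> B" using e by (simp add: B_def)
  have BW: "B \<subseteq> W" using e B_def by simp
  define K' where "K' = {v \<in> B. N v \<in> K}"
  have cK: "convex K'" unfolding K'_def using chart_convex[OF K(1) B_def BW] .
  have iK: "interior K' = {v \<in> B. N v \<in> inner K}" unfolding K'_def using chart_interior[OF K(1) B_def BW] .
  have Nc: "continuous_on X N" if "X \<subseteq> B" for X
    using that BW N_continuous continuous_on_subset by blast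
  have Qn: "Q \<notin> interior K'" using iK Q N_id[OF QM] by simp
  \<comment> \<open>Interior points of \<open>K\<close> may be far from \<open>Q\<close>;
    contracting a neighbourhood of one towards \<open>Q\<close> brings an open set of points of
    \<open>K\<close> into the chart.\<close>
  have "interior K' \<noteq> {}"
  proof -
    obtain k where k: "k \<in> inner K" using K(3) by blast
    obtain G where G: "open G" "inner K = M \<inter> G" using inner_open by blast
    define G' where "G' = {v \<in> W. N v \<in> G}"
    have G': "open G'" "k \<in> G'"
      using open_preimage[OF G(1)] k G M_sub_W N_id by (auto simp: G'_def)
    have "((\<lambda>t. (1 - t) *\<^sub>R k + t *\<^sub>R Q) \<longlongrightarrow> (1 - 1) *\<^sub>R k + 1 *\<^sub>R Q) (at_left 1)"
      by (intro tendsto_intros)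
    then have "\<forall>\<^sub>F t in at_left 1. (1 - t) *\<^sub>R k + t *\<^sub>R Q \<in> B"
      using QB B_def by (intro topological_tendstoD) auto
    moreover have "\<forall>\<^sub>F t in at_left (1::real). t \<in> {0<..<1}" by (rule eventually_at_left_real) simp
    ultimately have "\<forall>\<^sub>F t in at_left 1. t \<in> {0<..<1} \<and> (1 - t) *\<^sub>R k + t *\<^sub>R Q \<in> B"
      by eventually_elim simp
    then obtain t where "t \<in> {0<..<1} \<and> (1 - t) *\<^sub>R k + t *\<^sub>R Q \<in> B"
      using eventually_happens'[OF trivial_limit_at_left_real] by blast
    then have t: "0 < t" "t < 1" "(1 - t) *\<^sub>R k + t *\<^sub>R Q \<in> B" by auto
    let ?X = "(\<lambda>u. t *\<^sub>R Q + u) ` ((\<lambda>u. (1 - t) *\<^sub>R u) ` G')"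
    have "open ?X" using G'(1) t by (intro open_translation open_scaling) auto
    then have "open (?X \<inter> B)" by (simp add: B_def open_Int)
    moreover have "?X \<inter> B \<subseteq> K'"
    proof
      fix v assume v: "v \<in> ?X \<inter> B"
      then obtain u where u: "u \<in> G'" "v = (1 - t) *\<^sub>R u + t *\<^sub>R Q" by (auto simp: add.commute)
      have "N u \<in> K" using u(1) N_mem G(2) inner_sub unfolding G'_def by blast
      then have "N v \<in> K" using K(1) u Q(1) QW N_id[OF QM] v BW t unfolding gconvex_def G'_def by auto
      then show "v \<in> K'" using v by (simp add: K'_def)
    qed
    ultimately have "?X \<inter> B \<subseteq> interior K'" by (rule interior_maximal[rotated])
    moreover have "(1 - t) *\<^sub>R k + t *\<^sub>R Q \<in> ?X \<inter> B" using t G'(2) by (auto simp: add.commute)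
    ultimately show ?thesis by blast
  qed
  then obtain k0 where k0: "k0 \<in> interior K'" by blast
  then have k0K: "k0 \<in> K'" using interior_subset by blast
  then have k0B: "k0 \<in> B" by (simp add: K'_def)
  define J where "J = N ` interior K'"
  have iKB: "interior K' \<subseteq> B" using iK by auto
  have J: "connected J" unfolding J_def
    using convex_interior[OF cK] Nc[OF iKB] by (intro connected_continuous_image convex_connected)
  have J1: "J \<subseteq> inner K \<inter> U" using iK e(3) unfolding J_def B_def by blast
  have J2: "inner K \<inter> B \<subseteq> J"
  proof
    fix x assume x: "x \<in> inner K \<inter> B"
    then have "x \<in> M" "x \<in> interior K'" using inner_iff N_id unfolding iK by auto
    then show "x \<in> J" unfolding J_def using N_id by force
  qed
  have J3: "K \<inter> B \<subseteq> closure J"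
  proof
    fix x assume x: "x \<in> K \<inter> B"
    then have xM: "x \<in> M" using K by (auto simp: gconvex_def)
    then have "x \<in> K'" using x N_id by (simp add: K'_def)
    then have "x \<in> closure (interior K')"
      using convex_closure_interior[OF cK] k0 closure_subset by blast
    then obtain f where f: "\<And>n. f n \<in> interior K'" "f \<longlonglongrightarrow> x" by (auto simp: closure_sequential)
    have "(\<lambda>n. N (f n)) \<longlonglongrightarrow> N x"
      by (rule continuous_on_tendsto_compose[OF Nc[OF order_refl] f(2)])
        (use x f(1) iKB in \<open>auto intro!: always_eventually\<close>)
    then show "x \<in> closure J" unfolding closure_sequential
      using f(1) N_id[OF xM] by (intro exI[of _ "\<lambda>n. N (f n)"]) (auto simp: J_def)
  qed
  have cl: "open (B - K')"
  proof -
    have "B - K' = {v \<in> W. N v \<in> - K} \<inter> B" using BW by (auto simp: K'_def)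
    then show ?thesis using open_preimage[of "- K"] K(2) by (simp add: B_def open_Int open_Compl)
  qed
  have "((\<lambda>T. Q + T *\<^sub>R (Q - k0)) \<longlongrightarrow> Q + 0 *\<^sub>R (Q - k0)) (at_right 0)"
    by (intro tendsto_intros)
  then have "\<forall>\<^sub>F T in at_right 0. Q + T *\<^sub>R (Q - k0) \<in> B"
    using QB B_def by (intro topological_tendstoD) auto
  moreover have "\<forall>\<^sub>F T in at_right (0::real). 0 < T" by (simp add: eventually_at_right_less)
  ultimately have "\<forall>\<^sub>F T in at_right 0. 0 < T \<and> Q + T *\<^sub>R (Q - k0) \<in> B" by eventually_elim simp
  then obtain T where T: "0 < T" "Q + T *\<^sub>R (Q - k0) \<in> B"
    using eventually_happens' trivial_limit_at_right_real by blast
  \<comment> \<open>\<open>Q\<close> lies strictly between \<open>k0\<close> and \<open>p\<close>,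
    so \<open>p\<close> in \<open>K'\<close> would make \<open>Q\<close> an interior point.\<close>
  define p where "p = Q + T *\<^sub>R (Q - k0)"
  have "p \<notin> K'"
  proof
    assume "p \<in> K'"
    then have "p - (T / (1 + T)) *\<^sub>R (p - k0) \<in> interior K'"
      using T by (intro mem_interior_convex_shrink[OF cK k0]) auto
    moreover have "p - (T / (1 + T)) *\<^sub>R (p - k0) = Q"
    proof -
      have "p - k0 = (1 + T) *\<^sub>R (Q - k0)" by (simp add: p_def algebra_simps)
      then have "(T / (1 + T)) *\<^sub>R (p - k0) = T *\<^sub>R (Q - k0)" using T by simp
      then show ?thesis by (simp add: p_def)
    qed
    ultimately show False using Qn by simp
  qed
  then obtain \<eta> where eta: "\<eta> > 0" "ball p \<eta> \<subseteq> B - K'"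
    using cl T(2) open_contains_ball unfolding p_def by blast
  \<comment> \<open>The map x + T (x - k0) multiplies distances by 1 + T, so rays from this ball end
    in the ball about \<open>p\<close>.\<close>
  define \<delta> where "\<delta> = min \<epsilon> (\<eta> / (1 + T))"
  have d: "\<delta> > 0" "ball Q \<delta> \<subseteq> B" using e eta T by (auto simp: \<delta>_def B_def)
  let ?g = "\<lambda>x. closed_segment x (x + T *\<^sub>R (x - k0))"
  have endp: "x + T *\<^sub>R (x - k0) \<in> ball p \<eta>" if "x \<in> ball Q \<delta>" for x
  proof -
    have "p - (x + T *\<^sub>R (x - k0)) = (1 + T) *\<^sub>R (Q - x)" by (simp add: p_def algebra_simps)
    then have "dist p (x + T *\<^sub>R (x - k0)) = (1 + T) * dist Q x"
      using T by (simp add: dist_norm)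
    also have "\<dots> < (1 + T) * (\<eta> / (1 + T))"
      using that T by (intro mult_strict_left_mono) (auto simp: \<delta>_def)
    also have "\<dots> = \<eta>" using T by simp
    finally show ?thesis by simp
  qed
  define C' where "C' = ball p \<eta> \<union> (\<Union>x\<in>ball Q \<delta> - K'. ball p \<eta> \<union> ?g x)"
  have conC: "connected C'"
  proof -
    have "C' = \<Union> (insert (ball p \<eta>) ((\<lambda>x. ball p \<eta> \<union> ?g x) ` (ball Q \<delta> - K')))" by (auto simp: C'_def)
    moreover have "connected \<dots>"
    proof (rule connected_Union)
      have "p \<in> \<Inter> (insert (ball p \<eta>) ((\<lambda>x. ball p \<eta> \<union> ?g x) ` (ball Q \<delta> - K')))" using eta by auto
      then show "\<Inter> (insert (ball p \<eta>) ((\<lambda>x. ball p \<eta> \<union> ?g x) ` (ball Q \<delta> - K'))) \<noteq> {}" by blast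
      fix X assume "X \<in> insert (ball p \<eta>) ((\<lambda>x. ball p \<eta> \<union> ?g x) ` (ball Q \<delta> - K'))"
      moreover have "connected (ball p \<eta> \<union> ?g x)" if "x \<in> ball Q \<delta>" for x
        using endp[OF that] ends_in_segment(2)[of x "x + T *\<^sub>R (x - k0)"]
        by (intro connected_Un) auto
      ultimately show "connected X" by auto
    qed
    ultimately show ?thesis by simp
  qed
  have CB: "C' \<subseteq> B - K'"
  proof -
    have "?g x \<subseteq> B - K'" if x: "x \<in> ball Q \<delta> - K'" for x
    proof
      fix w assume w: "w \<in> ?g x"
      have "x + T *\<^sub>R (x - k0) \<in> B" using endp x eta by blast
      then have "?g x \<subseteq> B" unfolding B_def using x d
        by (intro closed_segment_subset) (auto simp: B_def)
      then have wB: "w \<in> B" using w by blast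
      \<comment> \<open>If \<open>w\<close> were in \<open>K'\<close>, the start \<open>x\<close> of
        the ray would be a convex combination of \<open>w\<close> and \<open>k0\<close>.\<close>
      have "w \<notin> K'"
      proof
        assume wK: "w \<in> K'"
        obtain r where r: "0 \<le> r" "r \<le> 1" "w = (1 - r) *\<^sub>R x + r *\<^sub>R (x + T *\<^sub>R (x - k0))"
          using w by (auto simp: in_segment)
        define R where "R = r * T"
        have R: "R \<ge> 0" using r T by (simp add: R_def)
        have "w = (1 + R) *\<^sub>R x - R *\<^sub>R k0" unfolding r(3) R_def by (simp add: algebra_simps)
        then have "w + R *\<^sub>R k0 = (1 + R) *\<^sub>R x" by simp
        then have "(1 / (1 + R)) *\<^sub>R (w + R *\<^sub>R k0) = x" using R by simp
        then have "(1 / (1 + R)) *\<^sub>R w + (R / (1 + R)) *\<^sub>R k0 = x"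
          by (simp add: scaleR_right_distrib)
        moreover have "(1 / (1 + R)) *\<^sub>R w + (R / (1 + R)) *\<^sub>R k0 \<in> K'"
          using R wK k0K by (intro convexD[OF cK]) (auto simp: field_simps)
        ultimately show False using x by simp
      qed
      then show "w \<in> B - K'" using wB by simp
    qed
    then show ?thesis using eta(2) unfolding C'_def by blast
  qed
  define C where "C = N ` C'"
  have C: "connected C" unfolding C_def
    using CB by (intro connected_continuous_image conC Nc) blast
  have C1: "C \<subseteq> (M - K) \<inter> U"
    using CB BW N_mem e(3) unfolding C_def K'_def B_def by blast
  have C2: "M \<inter> ball Q \<delta> - K \<subseteq> C"
  proof
    fix x assume x: "x \<in> M \<inter> ball Q \<delta> - K"
    then have "x \<in> ball Q \<delta> - K'" using N_id by (auto simp: K'_def)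
    then have "x \<in> C'" unfolding C'_def by auto
    then show "x \<in> C" unfolding C_def using x N_id by force
  qed
  show thesis
  proof (rule that[OF J C J1 C1, of "ball Q \<delta> \<inter> U"])
    show "inner K \<inter> (ball Q \<delta> \<inter> U) \<subseteq> J" "K \<inter> (ball Q \<delta> \<inter> U) \<subseteq> closure J"
      using J2 J3 d(2) by blast+
  qed (use U d C2 in auto)
qed

lemma gconvex_ball: "z \<in> M \<Longrightarrow> gconvex {x \<in> M. h x z \<le> c1}"
  unfolding gconvex_def using ball_convex N_mem by auto

lemma closed_ball: "closed {x \<in> M. h x z \<le> c1}"
proof -
  have "closed {x. h x z \<le> c1}" by (rule closed_Collect_le) (auto intro!: continuous_intros)
  then have "closed (M \<inter> {x. h x z \<le> c1})" using closed_M by blast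
  then show ?thesis by (simp add: Int_def)
qed

lemma centre_inner_ball: "z \<in> M \<Longrightarrow> z \<in> inner {x \<in> M. h x z \<le> c1}"
proof -
  assume "z \<in> M"
  moreover have "open {x. h x z < c1}" by (rule open_Collect_less) (auto intro!: continuous_intros)
  ultimately show ?thesis unfolding inner_iff using c1_pos
    by (intro conjI exI[of _ "{x. h x z < c1}"]) auto
qed

lemma sphere_not_inner:
  assumes "Q \<in> M" "z \<in> M" "h Q z = c1"
  shows "Q \<notin> inner {x \<in> M. h x z \<le> c1}"
proof
  assume "Q \<in> inner {x \<in> M. h x z \<le> c1}"
  then obtain G where G: "open G" "Q \<in> G" "M \<inter> G \<subseteq> {x \<in> M. h x z \<le> c1}"
    unfolding inner_iff by blast
  obtain e where e: "\<forall>\<^sub>F t in at 0. Q + t *\<^sub>R e \<in> W \<and> c1 < h (N (Q + t *\<^sub>R e)) z"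
    using tangent_outside[OF assms] by blast
  moreover have "\<forall>\<^sub>F t in at 0. Q + t *\<^sub>R e \<in> {v \<in> W. N v \<in> G}"
  proof (rule topological_tendstoD)
    show "((\<lambda>t. Q + t *\<^sub>R e) \<longlongrightarrow> Q) (at 0)"
      by (rule line_tendsto)
  qed (use open_preimage[OF G(1)] G(2) assms(1) M_sub_W N_id in auto)
  ultimately have "\<forall>\<^sub>F t in at (0::real). False"
    by eventually_elim (use G(3) N_mem in force)
  then show False by simp
qed

lemma eventually_tangent_near:
  assumes "Q \<in> M" "open G" "Q \<in> G"
  shows "\<forall>\<^sub>F t in at 0. Q + t *\<^sub>R e \<in> W \<and> N (Q + t *\<^sub>R e) \<in> M \<inter> G"
proof -
  have "\<forall>\<^sub>F t in at 0. Q + t *\<^sub>R e \<in> {v \<in> W. N v \<in> G}"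
  proof (rule topological_tendstoD)
    show "((\<lambda>t. Q + t *\<^sub>R e) \<longlongrightarrow> Q) (at 0)"
      by (rule line_tendsto)
  qed (use open_preimage[OF assms(2)] assms M_sub_W N_id in auto)
  then show ?thesis by eventually_elim (use N_mem in auto)
qed

lemma connected_avoiding_frontier:
  assumes "connected C" "C \<subseteq> M" "closed K" "C \<inter> (K - inner K) = {}"
  shows "C \<subseteq> inner K \<or> C \<inter> K = {}"
proof -
  obtain G where G: "open G" "inner K = M \<inter> G" using inner_open by blast
  have "open (- K)" using assms(3) by auto
  moreover have "G \<inter> C = {} \<or> - K \<inter> C = {}"
  proof (rule ccontr)
    assume "\<not> ?thesis"
    moreover have "C \<subseteq> G \<union> - K" "G \<inter> (- K) \<inter> C = {}" using assms(2,4) G(2) inner_sub by blast+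
    ultimately show False using connectedD[OF assms(1) G(1) \<open>open (- K)\<close>] by blast
  qed
  ultimately show ?thesis using G(2) assms(2,4) by blast
qed

text \<open>Passes from the hypersurface to the solid. Near \<open>Q\<close> the exterior
  \<open>C\<close> of the ball is connected and misses the frontier of \<open>K\<close>, so it lies
  inside \<open>K\<close> or outside. The first would put both directions of a line tangent to the
  ball into the interior of \<open>K\<close>, making \<open>Q\<close> interior.\<close>

lemma supported_by_frontier:
  assumes K: "gconvex K" "closed K" and Q: "Q \<in> K" "Q \<notin> inner K"
    and z: "z \<in> M" "h Q z = c1" and U: "open U" "Q \<in> U" "\<And>x. x \<in> (K - inner K) \<inter> U \<Longrightarrow> h x z \<le> c1"
  obtains U' where "open U'" "Q \<in> U'" "\<And>x. x \<in> K \<inter> U' \<Longrightarrow> h x z \<le> c1"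
proof -
  let ?B = "{x \<in> M. h x z \<le> c1}"
  have QM: "Q \<in> M" using K Q by (auto simp: gconvex_def)
  obtain J C U' where lp: "connected C" "C \<subseteq> (M - ?B) \<inter> U" "open U'" "Q \<in> U'" "M \<inter> U' - ?B \<subseteq> C"
    using local_picture[OF gconvex_ball[OF z(1)] closed_ball _ _ sphere_not_inner[OF QM z] U(1,2)]
      centre_inner_ball[OF z(1)] QM z(2) by (metis (no_types, lifting) emptyE mem_Collect_eq order_refl)
  have "C \<inter> (K - inner K) = {}" using lp(2) U(3) by blast
  moreover have "\<not> C \<subseteq> inner K"
  proof
    assume C: "C \<subseteq> inner K"
    obtain e where e: "\<forall>\<^sub>F t in at 0. Q + t *\<^sub>R e \<in> W \<and> c1 < h (N (Q + t *\<^sub>R e)) z"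
      using tangent_outside[OF QM z] by blast
    have "\<forall>\<^sub>F t in at 0. Q + t *\<^sub>R e \<in> W \<and> N (Q + t *\<^sub>R e) \<in> inner K"
      using e eventually_tangent_near[OF QM lp(3,4), of e]
      by eventually_elim (use lp(5) C in force)
    then show False using inner_if_two_sided[OF K(1) QM] Q(2) by blast
  qed
  ultimately have "C \<inter> K = {}" using connected_avoiding_frontier[OF lp(1) _ K(2)] lp(2) by blast
  then have "h x z \<le> c1" if "x \<in> K \<inter> U'" for x
    using that lp(5) K(1) unfolding gconvex_def by fastforce
  then show thesis using that lp(3,4) by blast
qed

text \<open>Near \<open>Q\<close> the ball would contain neighbourhoods of points on both sides of
  \<open>Q\<close>, hence by its convexity a neighbourhood of \<open>Q\<close>, although
  \<open>Q\<close> lies on its bounding sphere.\<close>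

lemma no_two_sided_support:
  assumes Q: "Q \<in> M" and z: "supported E Q z"
    and ev: "\<forall>\<^sub>F t in at 0. Q + t *\<^sub>R e \<in> W \<and> N (Q + t *\<^sub>R e) \<in> G" and G: "open G" "M \<inter> G \<subseteq> E"
  shows False
proof -
  obtain U where U: "z \<in> M" "h Q z = c1" "open U" "Q \<in> U" "\<forall>x\<in>E \<inter> U. h x z \<le> c1"
    using z unfolding supported_def by blast
  have GU: "M \<inter> (G \<inter> U) \<subseteq> {x \<in> M. h x z \<le> c1}" using G U by blast
  have "\<forall>\<^sub>F t in at 0. Q + t *\<^sub>R e \<in> W \<and> N (Q + t *\<^sub>R e) \<in> inner {x \<in> M. h x z \<le> c1}"
    using ev eventually_tangent_near[OF Q U(3,4), of e]
  proof eventually_elim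
    case (elim t)
    then show ?case unfolding inner_iff using GU open_Int[OF G(1) U(3)] by blast
  qed
  then have "Q \<in> inner {x \<in> M. h x z \<le> c1}" using inner_if_two_sided[OF gconvex_ball[OF U(1)] Q] by blast
  then show False using sphere_not_inner[OF Q U(1,2)] by blast
qed

text \<open>\<open>E\<close> is the convex side near \<open>P\<close>. The connected set between
  \<open>E \<inter> U\<close> and \<open>E\<close> says that all of \<open>E\<close> near
  \<open>P\<close> belongs to one component, which adheres to every nearby point of
  \<open>S\<close>.\<close>

definition good :: "'v set \<Rightarrow> 'v set \<Rightarrow> 'v \<Rightarrow> bool" where
  "good S E P \<longleftrightarrow> (\<exists>U J. open U \<and> P \<in> U \<and> connected J \<and> J \<subseteq> E \<and> E \<inter> U \<subseteq> J \<and> S \<inter> U \<subseteq> closure J \<and>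
     (\<forall>Q\<in>S \<inter> U. \<exists>z. supported E Q z))"

end

text \<open>Near a boundary point the two sides of the hypersurface are treated symmetrically: on the
  sphere the given domain may lie on the concave side.\<close>

locale two_sides = model_space b M c1 c2 W N
  for b :: "'v::euclidean_space \<Rightarrow> 'v \<Rightarrow> real" and M c1 c2 W N +
  fixes S E1 E2 :: "'v set"
  assumes E1_open: "openin (top_of_set M) E1" and E2_open: "openin (top_of_set M) E2"
    and sides: "M = E1 \<union> E2 \<union> S" "E1 \<inter> E2 = {}" "E1 \<inter> S = {}" "E2 \<inter> S = {}"
    and S_closure: "S \<subseteq> closure E1" "S \<subseteq> closure E2"
    and S_connected: "connected S"
    and S_convex: "P \<in> S \<Longrightarrow> \<exists>U K. open U \<and> P \<in> U \<and> gconvex K \<and> closed K \<and> inner K \<noteq> {} \<and>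
      S \<inter> U = (K - inner K) \<inter> U"
    and S_support: "Q \<in> S \<Longrightarrow> \<exists>z. supported S Q z"
begin

lemma S_sub: "S \<subseteq> M" using sides by blast

text \<open>Matches the inner and outer parts of a convex body with the global sides. The given
  balls support \<open>S\<close>; \<open>supported_by_frontier\<close> makes them support
  \<open>E\<close>.\<close>

lemma local_side:
  assumes P: "P \<in> S" and E: "openin (top_of_set M) E" "openin (top_of_set M) E'" "M = E \<union> E' \<union> S"
      "E \<inter> E' = {}" "E \<inter> S = {}"
    and K: "gconvex K" "closed K" "S \<inter> U = (K - inner K) \<inter> U"
    and JC: "connected J" "J \<subseteq> inner K \<inter> U" "C \<subseteq> (M - K) \<inter> U" "open U'" "P \<in> U'" "U' \<subseteq> U" "inner K \<inter> U' \<subseteq> J"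
      "K \<inter> U' \<subseteq> closure J" "M \<inter> U' - K \<subseteq> C" and side: "J \<subseteq> E" "C \<subseteq> E'"
  shows "good S E P"
proof -
  have EU: "E \<inter> U' \<subseteq> J"
  proof
    fix x assume x: "x \<in> E \<inter> U'"
    then have "x \<in> M" "x \<notin> C" "x \<notin> S" using E side by blast+
    then have "x \<in> inner K" using x JC(6,9) K(3) by blast
    then show "x \<in> J" using x JC(7) by blast
  qed
  have "\<exists>z. supported E Q z" if Q: "Q \<in> S \<inter> U'" for Q
  proof -
    have QK: "Q \<in> K" "Q \<notin> inner K" using Q K(3) JC(6) by blast+
    obtain z V where z: "z \<in> M" "h Q z = c1" "open V" "Q \<in> V" "\<forall>x\<in>S \<inter> V. h x z \<le> c1"
      using S_support Q unfolding supported_def by blast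
    have "open (V \<inter> U')" "Q \<in> V \<inter> U'" using z JC Q by auto
    moreover have "h x z \<le> c1" if "x \<in> (K - inner K) \<inter> (V \<inter> U')" for x
      using that z(5) K(3) JC(6) by blast
    ultimately obtain V' where V': "open V'" "Q \<in> V'" "\<And>x. x \<in> K \<inter> V' \<Longrightarrow> h x z \<le> c1"
      using supported_by_frontier[OF K(1,2) QK z(1,2), of "V \<inter> U'"] by blast
    have "x \<in> K" if "x \<in> E \<inter> U'" for x using that EU JC(2) inner_sub by blast
    then have "\<forall>x\<in>E \<inter> (V' \<inter> U'). h x z \<le> c1" using V'(3) by blast
    then have "supported E Q z" unfolding supported_def
      using z(1,2) V' JC(4) Q by (intro conjI exI[of _ "V' \<inter> U'"]) auto
    then show ?thesis by blast
  qed
  moreover have "S \<inter> U' \<subseteq> closure J" using JC(6,8) K(3) by blast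
  ultimately show ?thesis unfolding good_def
    using JC EU side by (intro exI[of _ U'] exI[of _ J]) auto
qed

lemma connected_on_one_side:
  assumes "connected X" "X \<subseteq> M" "X \<inter> S = {}"
  shows "X \<subseteq> E1 \<or> X \<subseteq> E2"
proof -
  obtain G1 G2 where G: "open G1" "E1 = M \<inter> G1" "open G2" "E2 = M \<inter> G2"
    using E1_open E2_open unfolding openin_open by blast
  have "G1 \<inter> X = {} \<or> G2 \<inter> X = {}"
  proof (rule ccontr)
    assume "\<not> ?thesis"
    moreover have "X \<subseteq> G1 \<union> G2" "G1 \<inter> G2 \<inter> X = {}" using assms sides G by blast+
    ultimately show False using connectedD[OF assms(1) G(1,3)] by blast
  qed
  then show ?thesis using assms sides G by blast
qed

text \<open>The inner and outer parts are connected and miss \<open>S\<close>, so each lies in one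
  global side. They lie in different ones, because both sides accumulate at
  \<open>P\<close>.\<close>

lemma good_one_side:
  assumes P: "P \<in> S"
  shows "good S E1 P \<or> good S E2 P"
proof -
  obtain U K where U: "open U" "P \<in> U" and K: "gconvex K" "closed K" "inner K \<noteq> {}" "S \<inter> U = (K - inner K) \<inter> U"
    using S_convex[OF P] by blast
  have PK: "P \<in> K" "P \<notin> inner K" using P U K(4) by blast+
  obtain J C U' where JC: "connected J" "connected C" "J \<subseteq> inner K \<inter> U" "C \<subseteq> (M - K) \<inter> U"
    "open U'" "P \<in> U'" "U' \<subseteq> U" "inner K \<inter> U' \<subseteq> J" "K \<inter> U' \<subseteq> closure J" "M \<inter> U' - K \<subseteq> C"
    using local_picture[OF K(1-3) PK U] by blast
  have KM: "K \<subseteq> M" using K by (simp add: gconvex_def)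
  have avoid: "J \<subseteq> M" "J \<inter> S = {}" "C \<subseteq> M" "C \<inter> S = {}"
    using JC(3,4) K(4) inner_sub[of K] KM by blast+
  have sJ: "J \<subseteq> E1 \<or> J \<subseteq> E2" using connected_on_one_side[OF JC(1) avoid(1,2)] .
  have sC: "C \<subseteq> E1 \<or> C \<subseteq> E2" using connected_on_one_side[OF JC(2) avoid(3,4)] .
  have cover: "M \<inter> U' \<subseteq> J \<union> C \<union> S" using JC K(4) by blast
  have "U' \<inter> closure E1 \<noteq> {}" "U' \<inter> closure E2 \<noteq> {}" using S_closure P JC(6) by blast+
  then have meet: "U' \<inter> E1 \<noteq> {}" "U' \<inter> E2 \<noteq> {}"
    by (simp_all add: open_Int_closure_eq_empty[OF JC(5)])
  have "\<not> (J \<subseteq> E1 \<and> C \<subseteq> E1)" using cover meet(2) sides(1,2,4) by blast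
  moreover have "\<not> (J \<subseteq> E2 \<and> C \<subseteq> E2)" using cover meet(1) sides(1-3) by blast
  ultimately consider "J \<subseteq> E1" "C \<subseteq> E2" | "J \<subseteq> E2" "C \<subseteq> E1" using sJ sC by blast
  then show ?thesis
  proof cases
    case 1
    then show ?thesis
      using local_side[OF P E1_open E2_open sides(1-3) K(1,2,4) JC(1,3-10) 1] by simp
  next
    case 2
    have s: "M = E2 \<union> E1 \<union> S" "E2 \<inter> E1 = {}" using sides(1,2) by blast+
    show ?thesis
      using local_side[OF P E2_open E1_open s sides(4) K(1,2,4) JC(1,3-10) 2] by simp
  qed
qed

text \<open>If a ball supports \<open>E1\<close> at \<open>P\<close>, its exterior near
  \<open>P\<close> belongs to \<open>E2\<close> and contains both directions of a tangent line,
  projected to \<open>M\<close>; then \<open>E2\<close> has no supporting ball at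
  \<open>P\<close>.\<close>

lemma good_exclusive:
  assumes P: "P \<in> S" and g: "good S E1 P" "good S E2 P"
  shows False
proof -
  have PM: "P \<in> M" using P S_sub by blast
  obtain z1 z2 where z: "supported E1 P z1" "supported E2 P z2"
    using g P unfolding good_def by blast
  obtain U where U: "z1 \<in> M" "h P z1 = c1" "open U" "P \<in> U" "\<forall>x\<in>E1 \<inter> U. h x z1 \<le> c1"
    using z(1) unfolding supported_def by blast
  obtain e where e: "\<forall>\<^sub>F t in at 0. P + t *\<^sub>R e \<in> W \<and> c1 < h (N (P + t *\<^sub>R e)) z1"
    using tangent_outside[OF PM U(1,2)] by blast
  define G where "G = U \<inter> {x. c1 < h x z1}"
  have "open {x. c1 < h x z1}" by (rule open_Collect_less) (auto intro!: continuous_intros)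
  then have G: "open G" using U(3) by (simp add: G_def open_Int)
  have GE: "G \<inter> E1 = {}"
  proof (rule ccontr)
    assume "G \<inter> E1 \<noteq> {}"
    then obtain x where "x \<in> G" "x \<in> E1" by blast
    then show False using U(5)[rule_format, of x] by (simp add: G_def)
  qed
  then have "G \<inter> S = {}" using open_Int_closure_eq_empty[OF G] S_closure(1) by blast
  then have "M \<inter> G \<subseteq> E2" using GE sides by blast
  moreover have "\<forall>\<^sub>F t in at 0. P + t *\<^sub>R e \<in> W \<and> N (P + t *\<^sub>R e) \<in> G"
    using e eventually_tangent_near[OF PM U(3,4), of e]
    by eventually_elim (auto simp: G_def)
  ultimately show False using no_two_sided_support[OF PM z(2) _ G] by blast
qed

text \<open>The points where \<open>E1\<close>, respectively \<open>E2\<close>, is the convex side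
  form two relatively open sets that partition the connected \<open>S\<close>.\<close>

lemma good_global:
  shows "(\<forall>P\<in>S. good S E1 P) \<or> (\<forall>P\<in>S. good S E2 P)"
proof (rule ccontr)
  assume not: "\<not> ?thesis"
  have op: "openin (top_of_set S) {P \<in> S. good S E P}" for E
  proof (subst openin_subopen, intro ballI)
    fix P assume "P \<in> {P \<in> S. good S E P}"
    then obtain U J where U: "P \<in> S" "open U" "P \<in> U" "connected J" "J \<subseteq> E" "E \<inter> U \<subseteq> J"
      "S \<inter> U \<subseteq> closure J" "\<forall>Q\<in>S \<inter> U. \<exists>z. supported E Q z" unfolding good_def by blast
    then have "good S E Q" if "Q \<in> S \<inter> U" for Q
      using that unfolding good_def by (intro exI[of _ U] exI[of _ J]) simp
    then have "S \<inter> U \<subseteq> {P \<in> S. good S E P}" by blast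
    then show "\<exists>T. openin (top_of_set S) T \<and> P \<in> T \<and> T \<subseteq> {P \<in> S. good S E P}"
      using U(1-3) by (intro exI[of _ "S \<inter> U"]) auto
  qed
  have "{P \<in> S. good S E1 P} = S - {P \<in> S. good S E2 P}"
    using good_one_side good_exclusive by blast
  then have "closedin (top_of_set S) {P \<in> S. good S E1 P}"
    using openin_closedin_eq[of "top_of_set S" "{P \<in> S. good S E2 P}"] op[of E2] by simp
  then have "{P \<in> S. good S E1 P} = {} \<or> {P \<in> S. good S E1 P} = S"
    using op[of E1] S_connected unfolding connected_clopen by blast
  then show False using not good_one_side by blast
qed

text \<open>At a point of the compact side farthest from \<open>p\<close>, some line leaves in both
  directions into the other side, which is therefore not convex there. By \<open>good_global\<close>
  this one point decides.\<close>

lemma not_good_outside: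
  assumes D: "compact (E1 \<union> S)" "E1 \<noteq> {}" "S \<noteq> {}" and p: "p \<in> M"
    and far: "\<And>Q. Q \<in> M \<Longrightarrow> \<exists>e. \<forall>\<^sub>F t in at 0. Q + t *\<^sub>R e \<in> W \<and> h Q p < h (N (Q + t *\<^sub>R e)) p"
  shows "\<forall>P\<in>S. good S E1 P"
proof -
  have "continuous_on (E1 \<union> S) (\<lambda>x. h x p)" by (intro continuous_intros)
  then obtain P where P: "P \<in> E1 \<union> S" "\<And>x. x \<in> E1 \<union> S \<Longrightarrow> h x p \<le> h P p"
    using continuous_attains_sup[OF D(1)] D(2) by blast
  have PM: "P \<in> M" using P sides by blast
  obtain e where e: "\<forall>\<^sub>F t in at 0. P + t *\<^sub>R e \<in> W \<and> h P p < h (N (P + t *\<^sub>R e)) p"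
    using far[OF PM] by blast
  define G where "G = {x. h P p < h x p}"
  have G: "open G" unfolding G_def by (rule open_Collect_less) (auto intro!: continuous_intros)
  have "M \<inter> G \<subseteq> E2" using P(2) sides by (fastforce simp: G_def)
  then have no: "\<not> supported E2 P z" for z
    using no_two_sided_support[OF PM _ _ G, of E2 z e] e by (auto simp: G_def)
  have "P \<in> S"
  proof (rule ccontr)
    assume "P \<notin> S"
    then have "P \<in> E1" using P by blast
    obtain G1 where G1: "open G1" "E1 = M \<inter> G1" using E1_open unfolding openin_open by blast
    have P1: "P \<in> G1" using \<open>P \<in> E1\<close> G1(2) by blast
    have "\<forall>\<^sub>F t in at (0::real). False"
      using e eventually_tangent_near[OF PM G1(1), of e, OF P1]
    proof eventually_elim
      case (elim t)
      then show ?case using P(2)[of "N (P + t *\<^sub>R e)"] G1(2) by simp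
    qed
    then show False by simp
  qed
  then have "\<not> good S E2 P" using no unfolding good_def by blast
  then show ?thesis using good_global \<open>P \<in> S\<close> by blast
qed

end

context two_sides
begin

text \<open>\<open>I\<close> is a component of \<open>E\<close> adherent to one point of
  \<open>S\<close>. By \<open>good\<close>, the points of \<open>S\<close> adherent to it form a
  relatively open set, and connectedness of \<open>S\<close> does the rest.\<close>

lemma region:
  assumes E: "openin (top_of_set M) E" "E \<inter> S = {}" "M \<inter> closure E \<subseteq> E \<union> S" and g: "\<forall>P\<in>S. good S E P" and "S \<noteq> {}"
  obtains I where "openin (top_of_set M) I" "connected I" "I \<subseteq> E" "I \<noteq> {}" "closure I - I = S"
    "\<And>Q. Q \<in> S \<Longrightarrow> \<exists>z. supported I Q z"
proof -
  obtain P where P: "P \<in> S" using \<open>S \<noteq> {}\<close> by blast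
  obtain U J where J: "open U" "P \<in> U" "connected J" "J \<subseteq> E" "E \<inter> U \<subseteq> J" "S \<inter> U \<subseteq> closure J"
    using g[rule_format, OF P] unfolding good_def by blast
  have "P \<in> closure J" using J(2,6) P by blast
  then obtain j where j: "j \<in> J" by (metis closure_empty empty_iff equals0I)
  define I where "I = connected_component_set E j"
  have IE: "I \<subseteq> E" unfolding I_def by (rule connected_component_subset)
  have EM: "E \<subseteq> M" using E(1) openin_imp_subset by blast
  have Ic: "connected I" unfolding I_def by simp
  have absorb: "X \<subseteq> I" if X: "connected X" "X \<subseteq> E" "X \<inter> I \<noteq> {}" for X
  proof -
    obtain x where x: "x \<in> X" "x \<in> I" using X(3) by blast
    have "connected_component_set E x = I"
      using connected_component_eq[of x E j] x(2) unfolding I_def by simp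
    then show ?thesis using connected_component_maximal[OF x(1) X(1,2)] by simp
  qed
  have JI: "J \<subseteq> I" unfolding I_def using connected_component_maximal[OF j J(3,4)] .
  have nbhd: "\<exists>G X. open G \<and> x \<in> G \<and> M \<inter> G \<subseteq> X \<and> connected X \<and> X \<subseteq> E" if x: "x \<in> E" for x
  proof -
    have xM: "x \<in> M" using x EM by blast
    obtain G where G: "open G" "E = M \<inter> G" using E(1) by (auto simp: openin_open)
    obtain \<epsilon> where e: "\<epsilon> > 0" "ball x \<epsilon> \<subseteq> W" "N ` ball x \<epsilon> \<subseteq> G"
      using W_ball[of x G] xM M_sub_W N_id[OF xM] x G by auto
    have "connected (N ` ball x \<epsilon>)"
      using continuous_on_subset[OF N_continuous e(2)] by (intro connected_continuous_image) auto
    moreover have "N ` ball x \<epsilon> \<subseteq> E" using e N_mem G by blast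
    moreover have "M \<inter> ball x \<epsilon> \<subseteq> N ` ball x \<epsilon>" using N_id by force
    ultimately show ?thesis using e(1) by (intro exI[of _ "ball x \<epsilon>"] exI[of _ "N ` ball x \<epsilon>"]) auto
  qed
  have "openin (top_of_set M) I"
  proof (subst openin_subopen, intro ballI)
    fix x assume x: "x \<in> I"
    then have xE: "x \<in> E" using IE by (rule set_rev_mp)
    obtain G X where G: "open G" "x \<in> G" "M \<inter> G \<subseteq> X" "connected X" "X \<subseteq> E" using nbhd[OF xE] by metis
    have "x \<in> X" using subsetD[OF EM xE] G(2,3) by blast
    then have "X \<inter> I \<noteq> {}" using x by blast
    then have "X \<subseteq> I" by (rule absorb[OF G(4,5)])
    then show "\<exists>T. openin (top_of_set M) T \<and> x \<in> T \<and> T \<subseteq> I"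
    proof (intro exI conjI)
      show "openin (top_of_set M) (M \<inter> G)" using G(1) by (rule openin_open_Int)
      show "x \<in> M \<inter> G" using subsetD[OF EM xE] G(2) by simp
      show "M \<inter> G \<subseteq> I" using \<open>X \<subseteq> I\<close> G(3) by blast
    qed
  qed
  have outer: "closure I - I \<subseteq> S"
  proof
    fix x assume x: "x \<in> closure I - I"
    have "x \<in> M" using x IE EM closed_M closure_minimal by blast
    moreover have "x \<in> closure E" using x closure_mono[OF IE] by blast
    ultimately have "x \<in> E \<union> S" using E(3) by blast
    moreover have "x \<notin> E"
    proof
      assume "x \<in> E"
      then obtain G X where G: "open G" "x \<in> G" "M \<inter> G \<subseteq> X" "connected X" "X \<subseteq> E"
        using nbhd[of x] by metis
      have "G \<inter> closure I \<noteq> {}" using x G(2) by blast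
      then have "G \<inter> I \<noteq> {}" by (simp add: open_Int_closure_eq_empty[OF G(1)])
      then have "X \<inter> I \<noteq> {}" using G(3) subset_trans[OF IE EM] by blast
      then have "X \<subseteq> I" by (rule absorb[OF G(4,5)])
      then show False using x G(2,3) \<open>x \<in> M\<close> by blast
    qed
    ultimately show "x \<in> S" by blast
  qed
  have op: "openin (top_of_set S) (S \<inter> closure I)"
  proof (subst openin_subopen, intro ballI)
    fix Q assume Q: "Q \<in> S \<inter> closure I"
    then have "good S E Q" using g by simp
    then obtain V J' where J': "open V" "Q \<in> V" "connected J'" "J' \<subseteq> E" "E \<inter> V \<subseteq> J'" "S \<inter> V \<subseteq> closure J'"
      unfolding good_def by blast
    have "V \<inter> closure I \<noteq> {}" using Q J'(2) by blast
    then have "V \<inter> I \<noteq> {}" by (simp add: open_Int_closure_eq_empty[OF J'(1)])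
    then have "J' \<inter> I \<noteq> {}" using J'(5) IE by blast
    then have "J' \<subseteq> I" by (rule absorb[OF J'(3,4)])
    then have "S \<inter> V \<subseteq> S \<inter> closure I" using J'(6) closure_mono by blast
    then show "\<exists>T. openin (top_of_set S) T \<and> Q \<in> T \<and> T \<subseteq> S \<inter> closure I"
      using J' Q by (intro exI[of _ "S \<inter> V"]) auto
  qed
  moreover have "closedin (top_of_set S) (S \<inter> closure I)"
    by (rule closedin_closed_Int[OF closed_closure])
  moreover have "P \<in> S \<inter> closure I" using P J closure_mono[OF JI] by blast
  ultimately have "S \<inter> closure I = S" using S_connected unfolding connected_clopen by blast
  then have eq: "closure I - I = S" using outer IE E(2) by blast
  have "\<exists>z. supported I Q z" if Q: "Q \<in> S" for Q
  proof -
    have "good S E Q" using g Q by simp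
    then obtain z where "supported E Q z" unfolding good_def using Q by blast
    then show ?thesis unfolding supported_def using IE by blast
  qed
  note sup = this
  have ne: "I \<noteq> {}" using JI j by blast
  show thesis by (rule that[OF \<open>openin (top_of_set M) I\<close> Ic IE ne eq sup])
qed

end

section \<open>Inscribed balls\<close>

lemma has_vector_derivative_quotient:
  assumes "(g has_vector_derivative w) (at 0)"
  shows "((\<lambda>t. (g t - g 0) /\<^sub>R t) \<longlongrightarrow> w) (at 0)"
proof -
  have "((\<lambda>t. norm (g t - g 0 - t *\<^sub>R w) / norm t) \<longlongrightarrow> 0) (at 0)"
    using assms unfolding has_vector_derivative_def has_derivative_iff_norm by simp
  then have "((\<lambda>t. norm ((g t - g 0) /\<^sub>R t - w)) \<longlongrightarrow> 0) (at 0)"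
  proof (rule Lim_transform_eventually)
    have "\<forall>\<^sub>F t in at (0::real). t \<noteq> 0" by (simp add: eventually_at_filter)
    then show "\<forall>\<^sub>F t in at 0. norm (g t - g 0 - t *\<^sub>R w) / norm t = norm ((g t - g 0) /\<^sub>R t - w)"
    proof eventually_elim
      case (elim t)
      have "g t - g 0 - t *\<^sub>R w = t *\<^sub>R ((g t - g 0) /\<^sub>R t - w)"
        using elim by (simp add: scaleR_right_diff_distrib)
      then show ?case using elim by simp
    qed
  qed
  then show ?thesis using LIM_zero_cancel tendsto_norm_zero_iff by blast
qed

locale bounded_region = model_space b M c1 c2 W N
  for b :: "'v::euclidean_space \<Rightarrow> 'v \<Rightarrow> real" and M c1 c2 W N +
  fixes I :: "'v set"
  assumes open_I: "openin (top_of_set M) I" and connected_I: "connected I" and I_nonempty: "I \<noteq> {}"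
    and compact_I: "compact (closure I)" and boundary_nonempty: "closure I - I \<noteq> {}"
    and supported_I: "Q \<in> closure I - I \<Longrightarrow> \<exists>z. supported I Q z"
begin

abbreviation F :: "'v set" where "F \<equiv> closure I - I"

lemma I_M: "I \<subseteq> M" using open_I by (simp add: openin_imp_subset)
lemma cl_M: "closure I \<subseteq> M" using I_M closed_M by (simp add: closure_minimal)

lemma compact_F: "compact F"
proof -
  obtain T where T: "open T" "I = M \<inter> T" using open_I by (auto simp: openin_open)
  have "F = closure I - T" using cl_M unfolding T(2) by blast
  then show ?thesis using compact_diff[OF compact_I T(1)] by simp
qed

lemma nearest: "\<exists>p\<in>F. \<forall>q\<in>F. h x p \<le> h x q"
  by (rule continuous_attains_inf[OF compact_F boundary_nonempty]) (intro continuous_intros)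

text \<open>\<open>m\<close> is the value of \<open>h\<close> at the inradius. The second conjunct
  line is the first-order condition of maximality: no tangent direction at \<open>c\<close> leads
  strictly away from all touching points.\<close>

definition inscribed :: "'v \<Rightarrow> real \<Rightarrow> bool" where
  "inscribed c m \<longleftrightarrow> c \<in> I \<and> 0 < m \<and> (\<forall>p\<in>F. m \<le> h c p) \<and>
     (\<forall>w\<in>tangent_vectors M c. \<exists>P\<in>F. h c P = m \<and> 0 \<le> b w (P - c))"

text \<open>For the first-order condition the centre moves along a curve with velocity
  \<open>w\<close>. Boundary points nearest to the moved centres accumulate at a touching point, and
  maximality controls the difference quotients.\<close>

lemma inscribed_exists: "\<exists>c m. inscribed c m"
proof -
  obtain p0 where p0: "p0 \<in> F" using boundary_nonempty by blast
  obtain X where X: "\<And>x. x \<in> closure I \<Longrightarrow> h x p0 \<le> X"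
  proof -
    have "continuous_on (closure I) (\<lambda>x. h x p0)" by (intro continuous_intros)
    moreover have "closure I \<noteq> {}" using p0 by auto
    ultimately obtain x where "\<forall>y\<in>closure I. h y p0 \<le> h x p0"
      using continuous_attains_sup[OF compact_I, of "\<lambda>x. h x p0"] by blast
    then show thesis by (intro that[of "h x p0"]) simp
  qed
  \<comment> \<open>Pairs of a centre and an admissible value of \<open>h\<close>. Maximising the
    second coordinate on this compact set avoids proving that the distance to the boundary is
    continuous; \<open>X\<close> bounds the values.\<close>
  define H where "H = (closure I \<times> {0..X}) \<inter> (\<Inter>p\<in>F. {z. snd z \<le> h (fst z) p})"
  have "compact H" unfolding H_def
    by (intro compact_Int_closed compact_Times compact_I closed_INT ballI closed_Collect_le)
      (auto intro!: continuous_intros)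
  have in_H: "(x, h x p) \<in> H" if x: "x \<in> closure I" and p: "p \<in> F" "\<forall>q\<in>F. h x p \<le> h x q" for x p
  proof -
    have "h x p \<le> X" using p(2) p0 X[OF x] by force
    moreover have "0 \<le> h x p" using h_nonneg[of x p] x p(1) cl_M by blast
    ultimately show ?thesis using x p(2) unfolding H_def by simp
  qed
  obtain x1 where x1: "x1 \<in> I" using I_nonempty by blast
  then have x1c: "x1 \<in> closure I" using closure_subset by blast
  obtain p1 where p1: "p1 \<in> F" "\<forall>q\<in>F. h x1 p1 \<le> h x1 q" using nearest by blast
  have H1: "(x1, h x1 p1) \<in> H" using in_H[OF x1c p1] .
  have "continuous_on H snd" by (intro continuous_intros)
  then obtain a where a: "a \<in> H" "\<forall>z\<in>H. snd z \<le> snd a"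
    using continuous_attains_sup[OF \<open>compact H\<close>] H1 by blast
  define c m where "c = fst a" and "m = snd a"
  have c: "c \<in> closure I" "\<And>p. p \<in> F \<Longrightarrow> m \<le> h c p" using a(1) by (auto simp: H_def c_def m_def)
  have mx: "r \<le> m" if "(x, r) \<in> H" for x r using a(2) that unfolding m_def by force
  have "0 < h x1 p1" using x1 p1 I_M cl_M by (intro h_pos) auto
  then have m0: "0 < m" using mx[OF H1] by simp
  have cI: "c \<in> I"
  proof (rule ccontr)
    assume "c \<notin> I"
    then have "m \<le> h c c" using c by blast
    then show False using m0 by simp
  qed
  have "\<exists>P\<in>F. h c P = m \<and> 0 \<le> b w (P - c)" if w: "w \<in> tangent_vectors M c" for w
  proof -
    obtain g where g: "g 0 = c" "\<And>t::real. g t \<in> M" "(g has_vector_derivative w) (at 0)"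
      using w unfolding tangent_vectors_def by blast
    obtain T where T: "open T" "I = M \<inter> T" using open_I by (auto simp: openin_open)
    have quot: "((\<lambda>t. (g t - g 0) /\<^sub>R t) \<longlongrightarrow> w) (at 0)"
      using g(3) by (rule has_vector_derivative_quotient)
    have cont: "(g \<longlongrightarrow> c) (at 0)"
      using has_vector_derivative_continuous[OF g(3)] g(1) by (simp add: isCont_def)
    define t where "t n = inverse (real (Suc n))" for n
    have tpos: "0 < t n" for n by (simp add: t_def)
    have t0: "filterlim t (at 0) sequentially"
      unfolding filterlim_at t_def using LIMSEQ_inverse_real_of_nat by auto
    have lim: "(\<lambda>n. g (t n)) \<longlonglongrightarrow> c" "(\<lambda>n. (g (t n) - c) /\<^sub>R t n) \<longlonglongrightarrow> w"
      using filterlim_compose[OF cont t0] filterlim_compose[OF quot t0] g(1) by auto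
    have "\<forall>\<^sub>F n in sequentially. g (t n) \<in> T"
      using lim(1) T cI by (intro topological_tendstoD) auto
    then obtain n0 where n0: "\<And>n. n \<ge> n0 \<Longrightarrow> g (t n) \<in> I"
      using g(2) T(2) by (auto simp: eventually_sequentially)
    define u where "u n = t (n + n0)" for n
    have u: "g (u n) \<in> I" "0 < u n" for n using n0[of "n + n0"] tpos by (auto simp: u_def)
    have ulim: "(\<lambda>n. g (u n)) \<longlonglongrightarrow> c" "(\<lambda>n. (g (u n) - c) /\<^sub>R u n) \<longlonglongrightarrow> w"
      unfolding u_def using LIMSEQ_ignore_initial_segment[OF lim(1), of n0]
        LIMSEQ_ignore_initial_segment[OF lim(2), of n0] by auto
    have "\<forall>n. \<exists>p. p \<in> F \<and> (\<forall>q\<in>F. h (g (u n)) p \<le> h (g (u n)) q)" using nearest by blast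
    then obtain P where P: "\<And>n. P n \<in> F" "\<And>n. \<forall>q\<in>F. h (g (u n)) (P n) \<le> h (g (u n)) q" by metis
    obtain p r where pr: "p \<in> F" "strict_mono r" "(P \<circ> r) \<longlonglongrightarrow> p"
      using seq_compactE[OF compact_imp_seq_compact[OF compact_F], of P] P(1) by blast
    have le: "h (g (u n)) (P n) \<le> m" for n
      using mx[OF in_H[OF _ P]] u(1) closure_subset by blast
    have rl: "(\<lambda>n. g (u (r n))) \<longlonglongrightarrow> c" "(\<lambda>n. (g (u (r n)) - c) /\<^sub>R u (r n)) \<longlonglongrightarrow> w"
      "(\<lambda>n. P (r n)) \<longlonglongrightarrow> p"
      using LIMSEQ_subseq_LIMSEQ[OF ulim(1) pr(2)] LIMSEQ_subseq_LIMSEQ[OF ulim(2) pr(2)] pr(3)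
      by (auto simp: o_def)
    have "(\<lambda>n. h (g (u (r n))) (P (r n))) \<longlonglongrightarrow> h c p" by (intro tendsto_intros rl)
    then have "h c p \<le> m" by (rule LIMSEQ_le_const2) (use le in auto)
    then have hp: "h c p = m" using c(2)[OF pr(1)] by simp
    \<comment> \<open>A difference of squares: \<open>h\<close> to \<open>P n\<close> is at most
      \<open>m\<close> from the moved centre, by maximality, and at least \<open>m\<close> from
      \<open>c\<close>.\<close>
    have neg: "b ((g (u n) - c) /\<^sub>R u n) (g (u n) + c - 2 *\<^sub>R P n) \<le> 0" for n
    proof -
      have "b (g (u n) - c) (g (u n) + c - 2 *\<^sub>R P n) = 2 * (h (g (u n)) (P n) - h c (P n))"
        unfolding h_def by (simp add: b_linear sym field_simps)
      also have "\<dots> \<le> 0" using le[of n] c(2)[OF P(1)[of n]] by simp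
      finally show ?thesis using u(2)[of n] unfolding bilinear_lmul[OF bil] by (simp add: mult_le_0_iff)
    qed
    have "(\<lambda>n. b ((g (u (r n)) - c) /\<^sub>R u (r n)) (g (u (r n)) + c - 2 *\<^sub>R P (r n))) \<longlonglongrightarrow> b w (c + c - 2 *\<^sub>R p)"
      by (intro tendsto_intros rl)
    then have "b w (c + c - 2 *\<^sub>R p) \<le> 0" by (rule LIMSEQ_le_const2) (use neg in auto)
    then have "0 \<le> b w (p - c)" by (simp add: b_linear)
    then show ?thesis using hp pr(1) by blast
  qed
  then have "inscribed c m" unfolding inscribed_def using cI m0 c(2) by simp
  then show ?thesis by (intro exI)
qed

context
  fixes c m
  assumes ins: "inscribed c m"
begin

text \<open>By \<open>star\<close> the point is joined to \<open>c\<close> by a connected set no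
  farther from \<open>c\<close> than itself, which therefore misses the boundary.\<close>

lemma ball_in_I:
  assumes "x \<in> M" "h x c < m" shows "x \<in> I"
proof -
  obtain p where p: "p \<in> F" using boundary_nonempty by blast
  have c: "c \<in> I" "m \<le> h c p" using ins p by (auto simp: inscribed_def)
  obtain T where T: "T \<subseteq> M" "connected T" "c \<in> T" "x \<in> T" "\<forall>y\<in>T. h c y \<le> h c x"
  proof -
    have m: "c \<in> M" "p \<in> M" using c p I_M cl_M by auto
    have "h c x < h c p" using assms(2) c(2) by (simp add: h_commute)
    then show thesis using star[OF m(1) assms(1) m(2)] that by metis
  qed
  have TF: "T \<inter> F = {}"
  proof (rule ccontr)
    assume "T \<inter> F \<noteq> {}"
    then obtain y where "y \<in> T" "y \<in> F" by blast
    then have "h c y \<le> h c x" "m \<le> h c y" using T(5) ins by (auto simp: inscribed_def)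
    then show False using assms(2) by (simp add: h_commute)
  qed
  obtain G where G: "open G" "I = M \<inter> G" using open_I by (auto simp: openin_open)
  have "G \<inter> T = {} \<or> (- closure I) \<inter> T = {}"
  proof (rule ccontr)
    assume "\<not> ?thesis"
    moreover have "T \<subseteq> G \<union> - closure I"
    proof
      fix y assume "y \<in> T"
      then have "y \<in> I \<or> y \<notin> closure I" using TF by auto
      then show "y \<in> G \<union> - closure I" using G(2) by auto
    qed
    moreover have "G \<inter> T \<subseteq> closure I"
      using T(1) G(2) subset_trans[OF _ closure_subset[of I], of "G \<inter> T"] by auto
    then have "G \<inter> (- closure I) \<inter> T = {}" by auto
    ultimately show False using connectedD[OF T(2) G(1), of "- closure I"] by auto
  qed
  moreover have "c \<in> G \<inter> T" using c(1) T(3) G(2) by simp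
  ultimately have "x \<in> closure I" using T(4) by blast
  then show ?thesis using T(4) TF by blast
qed

text \<open>Excludes an inscribed ball of maximal radius on the round sphere, whose only boundary
  point would be the antipode of \<open>c\<close>. The support at \<open>P\<close> leaves points
  near \<open>P\<close> outside \<open>I\<close>, hence outside the inscribed ball.\<close>

lemma not_farthest:
  assumes "P \<in> F" "h c P = m" shows "\<exists>x\<in>M. x \<noteq> P \<and> h P c \<le> h x c"
proof -
  have PM: "P \<in> M" using assms cl_M by blast
  obtain z U where z: "z \<in> M" "h P z = c1" "open U" "P \<in> U" "\<forall>x\<in>I \<inter> U. h x z \<le> c1"
    using supported_I[OF assms(1)] unfolding supported_def by blast
  obtain e where "\<forall>\<^sub>F t in at 0. P + t *\<^sub>R e \<in> W \<and> c1 < h (N (P + t *\<^sub>R e)) z"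
    using tangent_outside[OF PM z(1,2)] by blast
  then have "\<forall>\<^sub>F t in at 0. c1 < h (N (P + t *\<^sub>R e)) z \<and> N (P + t *\<^sub>R e) \<in> M \<inter> U"
    using eventually_tangent_near[OF PM z(3,4), of e] by eventually_elim simp
  then obtain t where t: "c1 < h (N (P + t *\<^sub>R e)) z" "N (P + t *\<^sub>R e) \<in> M \<inter> U"
    using eventually_happens'[OF trivial_limit_at] by blast
  then have "N (P + t *\<^sub>R e) \<notin> I" using z(5)[rule_format, of "N (P + t *\<^sub>R e)"] by auto
  then have "\<not> h (N (P + t *\<^sub>R e)) c < m" using ball_in_I t(2) by blast
  then have "h P c \<le> h (N (P + t *\<^sub>R e)) c" using assms(2) h_commute[of P c] by simp
  moreover have "N (P + t *\<^sub>R e) \<noteq> P" using t(1) z(2) by auto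
  ultimately show ?thesis using t(2) by blast
qed

theorem contained:
  assumes P: "P \<in> F" "h c P = m" and A: "A \<in> M" "c2 < h A P" "0 < q"
    and centre: "\<And>y. y \<in> M \<Longrightarrow> h y c - h P c = s * h P y + q * angle A P y"
    and y0: "y0 \<in> M" "angle A P y0 < 0"
    and x0: "x0 \<in> M" "angle A P x0 = 0" "x0 \<noteq> A" "x0 \<noteq> P"
    and x: "x \<in> I"
  shows "angle A P x < 0"
proof -
  interpret trap b M c1 c2 I c P A y0 x0 q s
  proof
    show "x \<in> I" if "x \<in> M" "h x c < h P c" for x
      using ball_in_I that P(2) by (simp add: h_commute)
  qed (use assms open_I connected_I supported_I ins I_M in \<open>auto simp: inscribed_def\<close>)
  show ?thesis using trapped[OF x] .
qed

end

end

section \<open>Quadrics of constant curvature\<close>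

text \<open>\<open>cs\<close> and \<open>sn\<close> stand for \<open>cos (k t)\<close> and \<open>sin (k t) / k\<close> if \<open>\<kappa> = k\<^sup>2\<close>, and for \<open>cosh (k t)\<close> and
  \<open>sinh (k t) / k\<close> if \<open>\<kappa> = - k\<^sup>2\<close>; \<open>dom\<close> is the range of the distance.  Inequalities between values
  of \<open>cs\<close> are divided by \<open>\<kappa>\<close>, which makes them hold in the same form for both signs.\<close>

locale quadric = symmetric_form "form X"
  for X :: "'v::euclidean_space space_form" +
  fixes \<kappa> :: real and W :: "'v set" and cs sn :: "real \<Rightarrow> real" and dom :: "real set"
  assumes \<kappa>_nonzero: "\<kappa> \<noteq> 0"
    and W_open: "open W" and W_pos: "v \<in> W \<Longrightarrow> 0 < \<kappa> * form X v v"
    and W_scale: "v \<in> W \<Longrightarrow> 0 < t \<Longrightarrow> t *\<^sub>R v \<in> W"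
    and W_cone: "u \<in> W \<Longrightarrow> v \<in> W \<Longrightarrow> 0 \<le> t \<Longrightarrow> t \<le> 1 \<Longrightarrow>
      0 < \<kappa> * form X ((1 - t) *\<^sub>R u + t *\<^sub>R v) ((1 - t) *\<^sub>R u + t *\<^sub>R v) \<Longrightarrow> (1 - t) *\<^sub>R u + t *\<^sub>R v \<in> W"
    and pts_eq: "pts X = {x \<in> W. \<kappa> * form X x x = 1}" and closed_pts: "closed (pts X)"
    and sheet: "p \<in> pts X \<Longrightarrow> \<kappa> * form X v v = 1 \<Longrightarrow> form X v p \<le> 1 / \<kappa> \<Longrightarrow> v \<in> W"
    and cauchy_schwarz: "x \<in> pts X \<Longrightarrow> y \<in> pts X \<Longrightarrow> x \<noteq> y \<Longrightarrow> form X x y < 1 / \<kappa>"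
    and antipodal: "x \<in> pts X \<Longrightarrow> y \<in> pts X \<Longrightarrow> - 1 \<le> \<kappa> * form X x y"
      "x \<in> pts X \<Longrightarrow> y \<in> pts X \<Longrightarrow> \<kappa> * form X x y = - 1 \<Longrightarrow> y = - x"
    and tangent_pos: "x \<in> pts X \<Longrightarrow> form X x w = 0 \<Longrightarrow> w \<noteq> 0 \<Longrightarrow> 0 < form X w w"
    and normal_exists: "x \<in> pts X \<Longrightarrow> y \<in> pts X \<Longrightarrow> \<exists>e. form X e x = 0 \<and> form X e y = 0 \<and> form X e e = 1"
    and cs_0: "cs 0 = 1" and sn_0: "sn 0 = 0"
    and cs_diff: "cs (s - t) = cs s * cs t + \<kappa> * sn s * sn t"
    and sn_diff: "sn (s - t) = sn s * cs t - cs s * sn t"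
    and cs_deriv: "(cs has_real_derivative - \<kappa> * sn t) (at t)"
    and sn_deriv: "(sn has_real_derivative cs t) (at t)"
    and dom_0: "0 \<in> dom" and dom_nonneg: "t \<in> dom \<Longrightarrow> 0 \<le> t"
    and dom_down: "t \<in> dom \<Longrightarrow> 0 \<le> s \<Longrightarrow> s \<le> t \<Longrightarrow> s \<in> dom"
    and cs_mono: "s \<in> dom \<Longrightarrow> t \<in> dom \<Longrightarrow> s < t \<Longrightarrow> cs t / \<kappa> < cs s / \<kappa>"
    and sn_pos: "0 < s \<Longrightarrow> s < t \<Longrightarrow> t \<in> dom \<Longrightarrow> 0 < sn s"
    and dom_max: "t \<in> dom \<Longrightarrow> 0 < t \<Longrightarrow> \<forall>s\<in>dom. s \<le> t \<Longrightarrow> cs t = - 1"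
    and gdist: "x \<in> pts X \<Longrightarrow> y \<in> pts X \<Longrightarrow> gdist X x y \<in> dom \<and> cs (gdist X x y) = \<kappa> * form X x y"
begin

abbreviation M where "M \<equiv> pts X"
abbreviation b where "b \<equiv> form X"
abbreviation d where "d \<equiv> gdist X"

text \<open>Below the largest distance of the space; on the round sphere this excludes the antipodal
  distance, where \<open>sn\<close> vanishes.\<close>

definition proper :: "real \<Rightarrow> bool" where "proper t \<longleftrightarrow> 0 < t \<and> (\<exists>u\<in>dom. t < u)"

lemma proper_dom: "proper t \<Longrightarrow> t \<in> dom" unfolding proper_def using dom_down by force
lemma proper_less: "proper t \<Longrightarrow> 0 < s \<Longrightarrow> s \<le> t \<Longrightarrow> proper s" unfolding proper_def by force
lemma proper_sn: "proper t \<Longrightarrow> 0 < sn t" unfolding proper_def using sn_pos by blast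

lemma M_W: "x \<in> M \<Longrightarrow> x \<in> W" by (simp add: pts_eq)
lemma M_form: "x \<in> M \<Longrightarrow> b x x = 1 / \<kappa>" using \<kappa>_nonzero by (simp add: pts_eq field_simps)

lemma M_I: "p \<in> M \<Longrightarrow> \<kappa> * b v v = 1 \<Longrightarrow> b v p \<le> 1 / \<kappa> \<Longrightarrow> v \<in> M"
  using sheet pts_eq by blast

lemma cs_neg: "cs (- t) = cs t" using cs_diff[of 0 t] cs_0 sn_0 by simp
lemma sn_neg: "sn (- t) = - sn t" using sn_diff[of 0 t] cs_0 sn_0 by simp
lemma cs_add: "cs (s + t) = cs s * cs t - \<kappa> * sn s * sn t" using cs_diff[of s "- t"] by (simp add: cs_neg sn_neg)
lemma sn_add: "sn (s + t) = sn s * cs t + cs s * sn t" using sn_diff[of s "- t"] by (simp add: cs_neg sn_neg)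
lemma pythagoras: "(cs t)\<^sup>2 + \<kappa> * (sn t)\<^sup>2 = 1" using cs_diff[of t t] cs_0 by (simp add: power2_eq_square)
lemma cs_double: "cs (2 * t) = 2 * (cs t)\<^sup>2 - 1"
  using cs_add[of t t] pythagoras[of t] by (simp add: power2_eq_square)
lemma sn_double: "sn (2 * t) = 2 * sn t * cs t" using sn_add[of t t] by simp

lemma cs_pos: "proper (2 * t) \<Longrightarrow> 0 < cs t"
proof -
  assume p: "proper (2 * t)"
  then have "0 < t" by (simp add: proper_def)
  then have "0 < sn t" using proper_less[OF p, of t] proper_sn by simp
  then show ?thesis using proper_sn[OF p] by (simp add: sn_double zero_less_mult_iff)
qed

lemma cs_le_iff: "s \<in> dom \<Longrightarrow> t \<in> dom \<Longrightarrow> cs t / \<kappa> \<le> cs s / \<kappa> \<longleftrightarrow> s \<le> t"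
  using cs_mono[of s t] cs_mono[of t s] by (metis linorder_not_le order.order_iff_strict)

lemma cs_inj: "s \<in> dom \<Longrightarrow> t \<in> dom \<Longrightarrow> cs s = cs t \<Longrightarrow> s = t"
  using cs_mono[of s t] cs_mono[of t s] by (metis less_irrefl linorder_less_linear)

text \<open>For positive \<kappa> this is cos \<le> 1. For negative \<kappa> it is cosh \<ge> 1,
  where \<open>pythagoras\<close> alone leaves the sign open and the double angle formula is
  used.\<close>

lemma cs_le_1: "cs t / \<kappa> \<le> 1 / \<kappa>"
proof (cases "\<kappa> > 0")
  case True
  then have "(cs t)\<^sup>2 \<le> 1" using pythagoras[of t] by (metis add_le_same_cancel1 linorder_not_le mult_nonneg_nonneg not_less order_less_imp_le zero_le_power2 add.commute le_add_same_cancel1)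
  then have "cs t \<le> 1" by (simp add: abs_square_le_1)
  then show ?thesis using True by (simp add: divide_right_mono)
next
  case False
  have h: "cs t = 2 * (cs (t / 2))\<^sup>2 - 1" using cs_double[of "t/2"] by simp
  have "\<kappa> * (sn (t/2))\<^sup>2 \<le> 0" using False by (simp add: mult_le_0_iff)
  then have "1 \<le> cs t" using h pythagoras[of "t/2"] by simp
  then show ?thesis using False by (simp add: divide_right_mono_neg)
qed

lemma gdist_dom: "x \<in> M \<Longrightarrow> y \<in> M \<Longrightarrow> d x y \<in> dom" using gdist by blast
lemma gdist_cs: "x \<in> M \<Longrightarrow> y \<in> M \<Longrightarrow> cs (d x y) = \<kappa> * b x y" using gdist by blast
lemma gdist_nonneg: "x \<in> M \<Longrightarrow> y \<in> M \<Longrightarrow> 0 \<le> d x y" using gdist_dom dom_nonneg by blast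
lemma gdist_eqI: "x \<in> M \<Longrightarrow> y \<in> M \<Longrightarrow> t \<in> dom \<Longrightarrow> cs t = \<kappa> * b x y \<Longrightarrow> d x y = t"
  using cs_inj gdist by metis
lemma gdist_commute: "x \<in> M \<Longrightarrow> y \<in> M \<Longrightarrow> d x y = d y x"
  by (rule gdist_eqI) (auto simp: gdist_dom gdist_cs sym)
lemma form_gdist: "x \<in> M \<Longrightarrow> y \<in> M \<Longrightarrow> b x y = cs (d x y) / \<kappa>"
  using gdist_cs \<kappa>_nonzero by simp

lemma h_M: "x \<in> M \<Longrightarrow> y \<in> M \<Longrightarrow> h x y = 1 / \<kappa> - b x y"
  unfolding h_def using M_form[of x] M_form[of y] by (simp add: b_linear sym[of y x])

lemma h_gdist: "x \<in> M \<Longrightarrow> y \<in> M \<Longrightarrow> h x y = (1 - cs (d x y)) / \<kappa>"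
  by (simp add: h_M form_gdist diff_divide_distrib)

lemma h_le_iff: "x \<in> M \<Longrightarrow> y \<in> M \<Longrightarrow> t \<in> dom \<Longrightarrow> h x y \<le> (1 - cs t) / \<kappa> \<longleftrightarrow> d x y \<le> t"
  using cs_le_iff[of "d x y" t] gdist_dom by (simp add: h_gdist diff_divide_distrib)

lemma h_eq_iff: "x \<in> M \<Longrightarrow> y \<in> M \<Longrightarrow> t \<in> dom \<Longrightarrow> h x y = (1 - cs t) / \<kappa> \<longleftrightarrow> d x y = t"
  using cs_inj[of "d x y" t] gdist_dom \<kappa>_nonzero by (auto simp: h_gdist)

lemma gdist_self: "x \<in> M \<Longrightarrow> d x x = 0"
  by (rule gdist_eqI) (auto simp: dom_0 cs_0 M_form \<kappa>_nonzero)

lemma gdist_eq_0: "x \<in> M \<Longrightarrow> y \<in> M \<Longrightarrow> d x y = 0 \<Longrightarrow> x = y"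
  using cauchy_schwarz[of x y] form_gdist[of x y] cs_0 by fastforce

definition geodesic :: "'v \<Rightarrow> 'v \<Rightarrow> real \<Rightarrow> 'v" where
  "geodesic p T t = cs t *\<^sub>R p + sn t *\<^sub>R T"

definition unit_tangent :: "'v \<Rightarrow> 'v \<Rightarrow> bool" where
  "unit_tangent p T \<longleftrightarrow> p \<in> M \<and> b p T = 0 \<and> b T T = 1"

lemma form_geodesic:
  assumes "unit_tangent p T"
  shows "b (geodesic p T s) (geodesic p T t) = cs (s - t) / \<kappa>"
proof -
  have p: "b p p = 1 / \<kappa>" "b p T = 0" "b T p = 0" "b T T = 1"
    using assms M_form sym[of T p] by (auto simp: unit_tangent_def)
  show ?thesis unfolding geodesic_def cs_diff
    using \<kappa>_nonzero by (simp add: b_linear p add_divide_distrib mult.commute)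
qed

lemma geodesic_0: "geodesic p T 0 = p" by (simp add: geodesic_def cs_0 sn_0)

lemma geodesic_mem:
  assumes "unit_tangent p T" shows "geodesic p T t \<in> M"
proof (rule M_I)
  show "p \<in> M" using assms by (simp add: unit_tangent_def)
  show "\<kappa> * b (geodesic p T t) (geodesic p T t) = 1"
    using form_geodesic[OF assms, of t t] \<kappa>_nonzero cs_0 by simp
  show "b (geodesic p T t) p \<le> 1 / \<kappa>"
    using form_geodesic[OF assms, of t 0] cs_le_1[of t] by (simp add: geodesic_0)
qed

lemma gdist_geodesic:
  assumes "unit_tangent p T" "s - t \<in> dom"
  shows "d (geodesic p T s) (geodesic p T t) = s - t"
  using assms(2) form_geodesic[OF assms(1), of s t] \<kappa>_nonzero
  by (intro gdist_eqI geodesic_mem assms(1)) auto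

lemma geodesic_deriv:
  "(geodesic p T has_vector_derivative ((- \<kappa> * sn t) *\<^sub>R p + cs t *\<^sub>R T)) (at t)"
  unfolding geodesic_def
  using cs_deriv[of t] sn_deriv[of t]
  by (auto intro!: derivative_eq_intros simp: has_real_derivative_iff_has_vector_derivative)

lemma geodesic_to:
  assumes "x \<in> M" "y \<in> M" "proper (d x y)"
  obtains T where "unit_tangent x T" "y = geodesic x T (d x y)"
proof -
  let ?r = "d x y"
  have s: "0 < sn ?r" using proper_sn[OF assms(3)] .
  define T where "T = (1 / sn ?r) *\<^sub>R (y - cs ?r *\<^sub>R x)"
  have xy: "b x y = cs ?r / \<kappa>" "b y x = cs ?r / \<kappa>" using form_gdist assms sym by auto
  have "b x T = 0" unfolding T_def by (simp add: b_linear xy M_form[OF assms(1)])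
  moreover have "b T T = 1"
  proof -
    have "b T T = (1 / sn ?r)\<^sup>2 * (b y y - cs ?r * b y x - cs ?r * b x y + (cs ?r)\<^sup>2 * b x x)"
      unfolding T_def by (simp add: b_linear power2_eq_square algebra_simps)
    also have "b y y - cs ?r * b y x - cs ?r * b x y + (cs ?r)\<^sup>2 * b x x = (1 - (cs ?r)\<^sup>2) / \<kappa>"
      unfolding xy M_form[OF assms(1)] M_form[OF assms(2)]
      by (simp add: power2_eq_square diff_divide_distrib)
    also have "1 - (cs ?r)\<^sup>2 = \<kappa> * (sn ?r)\<^sup>2" using pythagoras[of ?r] by simp
    finally show ?thesis using \<kappa>_nonzero s by (simp add: field_simps)
  qed
  moreover have "y = geodesic x T ?r" unfolding geodesic_def T_def using s by simp
  ultimately show thesis using that assms(1) by (simp add: unit_tangent_def)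
qed

lemma geodesic_tangent:
  assumes "unit_tangent p T" shows "T \<in> tangent_vectors M p"
  unfolding tangent_vectors_def
  using geodesic_deriv[of p T 0] geodesic_mem[OF assms] geodesic_0[of p T] cs_0 sn_0 by auto

lemma tangent_vectors_M:
  assumes "p \<in> M" "b p w = 0" shows "w \<in> tangent_vectors M p"
proof (cases "w = 0")
  case True
  have "((\<lambda>t::real. p) has_vector_derivative 0) (at 0)" by (rule has_vector_derivative_const)
  then show ?thesis unfolding tangent_vectors_def using assms(1) True
    by (intro CollectI exI[of _ "\<lambda>t. p"]) simp
next
  case False
  have w: "0 < b w w" using tangent_pos[OF assms False] .
  let ?l = "sqrt (b w w)"
  have l: "?l > 0" "?l * ?l = b w w" using w by auto
  define T where "T = (1 / ?l) *\<^sub>R w"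
  have T: "unit_tangent p T" "w = ?l *\<^sub>R T"
    unfolding unit_tangent_def T_def using assms l by (auto simp: b_linear field_simps)
  have "((\<lambda>t. geodesic p T (?l * t)) has_vector_derivative (?l *\<^sub>R T)) (at 0)"
  proof -
    have "((\<lambda>t. ?l * t) has_vector_derivative ?l) (at 0)"
      by (auto intro!: derivative_eq_intros simp: has_real_derivative_iff_has_vector_derivative[symmetric])
    moreover have "(geodesic p T has_vector_derivative T) (at (?l * 0))"
      using geodesic_deriv[of p T 0] cs_0 sn_0 by simp
    ultimately show ?thesis using vector_diff_chain_at[of "\<lambda>t. ?l * t" ?l 0 "geodesic p T" T] by (simp add: o_def)
  qed
  then show ?thesis unfolding tangent_vectors_def
    using geodesic_mem[OF T(1)] geodesic_0[of p T] T(2)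
    by (intro CollectI exI[of _ "\<lambda>t. geodesic p T (?l * t)"]) simp
qed

text \<open>Makes central projections of segments minimising geodesics. In the main case the
  distance from \<open>x\<close> is read off from the coordinates of \<open>m\<close> with respect
  to \<open>x\<close> and the unit tangent; nonnegative weights give the signs of \<open>sn\<close>
  that place \<open>m\<close> between the ends. For antipodal ends \<open>m\<close> must be one of
  them.\<close>

lemma gdist_between:
  assumes "x \<in> M" "y \<in> M" "m \<in> M" "m = \<alpha> *\<^sub>R x + \<beta> *\<^sub>R y" "0 \<le> \<alpha>" "0 \<le> \<beta>"
  shows "d x m + d m y = d x y"
proof -
  let ?c = "d x y"
  have mm: "\<kappa> * b m m = 1" using assms(3) by (simp add: pts_eq)
  have "?c = 0 \<or> proper ?c \<or> (0 < ?c \<and> \<not> proper ?c)" using gdist_nonneg[OF assms(1,2)] by auto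
  then consider "?c = 0" | "proper ?c" | "0 < ?c" "\<not> proper ?c" by blast
  then show ?thesis
  proof cases
    case 1
    then have xy: "x = y" using gdist_eq_0 assms by blast
    have "m = (\<alpha> + \<beta>) *\<^sub>R x" using assms(4) xy by (simp add: scaleR_add_left)
    moreover from this have "(\<alpha> + \<beta>)\<^sup>2 = 1"
      using mm M_form[OF assms(1)] \<kappa>_nonzero by (simp add: b_linear power2_eq_square)
    then have "\<alpha> + \<beta> = 1" using assms(5,6) by (simp add: power2_eq_1_iff)
    ultimately show ?thesis using xy gdist_self[OF assms(1)] by simp
  next
    case 2
    obtain T where T: "unit_tangent x T" "y = geodesic x T ?c" using geodesic_to[OF assms(1,2) 2] .
    let ?a = "d x m"
    have m: "m = (\<alpha> + \<beta> * cs ?c) *\<^sub>R x + (\<beta> * sn ?c) *\<^sub>R T"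
    proof -
      have "\<beta> *\<^sub>R y = \<beta> *\<^sub>R (cs ?c *\<^sub>R x + sn ?c *\<^sub>R T)" using T(2) unfolding geodesic_def by simp
      then show ?thesis unfolding assms(4) by (simp add: algebra_simps)
    qed
    have xT: "b x x = 1 / \<kappa>" "b x T = 0" "b T x = 0" "b T T = 1"
      using T(1) M_form sym[of T x] by (auto simp: unit_tangent_def)
    have csa: "cs ?a = \<alpha> + \<beta> * cs ?c"
      using gdist_cs[OF assms(1,3)] \<kappa>_nonzero unfolding m by (simp add: b_linear xT)
    have "\<kappa> * b m m = (\<alpha> + \<beta> * cs ?c)\<^sup>2 + \<kappa> * (\<beta> * sn ?c)\<^sup>2"
      unfolding m using \<kappa>_nonzero by (simp add: b_linear xT power2_eq_square field_simps)
    then have "\<kappa> * (sn ?a)\<^sup>2 = \<kappa> * (\<beta> * sn ?c)\<^sup>2" using mm pythagoras[of ?a] unfolding csa by linarith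
    then have sq: "(sn ?a)\<^sup>2 = (\<beta> * sn ?c)\<^sup>2" using \<kappa>_nonzero by simp
    have sc: "0 < sn ?c" using proper_sn[OF 2] .
    have adom: "?a \<in> dom" "0 \<le> ?a" using gdist_dom gdist_nonneg assms by auto
    have sa0: "0 \<le> sn ?a"
    proof (rule ccontr)
      assume neg: "\<not> 0 \<le> sn ?a"
      then have "0 < ?a" using adom sn_0 by (cases "?a = 0") auto
      then have "\<not> proper ?a" using neg proper_sn by force
      then have "\<forall>s\<in>dom. s \<le> ?a" using \<open>0 < ?a\<close> by (auto simp: proper_def)
      then have "cs ?a = - 1" using dom_max adom \<open>0 < ?a\<close> by blast
      then have "sn ?a = 0" using pythagoras[of ?a] \<kappa>_nonzero by simp
      then show False using neg by simp
    qed
    have sna: "sn ?a = \<beta> * sn ?c" using sq sa0 assms(6) sc by (simp add: power2_eq_iff_nonneg)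
    have ma: "m = geodesic x T ?a" unfolding geodesic_def csa sna by (rule m)
    have sca: "0 \<le> sn (?c - ?a)" unfolding sn_diff csa sna using assms(5) sc by (simp add: algebra_simps)
    have "?a \<le> ?c"
    proof (rule ccontr)
      assume n: "\<not> ?a \<le> ?c"
      have "0 < ?c" using 2 by (simp add: proper_def)
      then have "proper (?a - ?c)" using n adom(1) unfolding proper_def by (intro conjI bexI[of _ ?a]) auto
      then have "0 < sn (?a - ?c)" by (rule proper_sn)
      then show False using sca sn_neg[of "?a - ?c"] by simp
    qed
    then have "?c - ?a \<in> dom" using dom_down[OF gdist_dom[OF assms(1,2)]] adom by simp
    then have "d y m = ?c - ?a"
      using gdist_geodesic[OF T(1), of ?c ?a] ma T(2) by metis
    then show ?thesis using gdist_commute[OF assms(2,3)] by simp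
  next
    case 3
    then have "cs ?c = - 1" using dom_max gdist_dom[OF assms(1,2)] by (force simp: proper_def)
    then have y: "y = - x" using antipodal(2)[OF assms(1,2)] gdist_cs assms by metis
    have m: "m = (\<alpha> - \<beta>) *\<^sub>R x" using assms(4) y by (simp add: algebra_simps)
    then have "(\<alpha> - \<beta>)\<^sup>2 = 1"
      using mm M_form[OF assms(1)] \<kappa>_nonzero by (simp add: b_linear power2_eq_square)
    then have "m = x \<or> m = y" using m y by (auto simp: power2_eq_1_iff)
    then show ?thesis using gdist_self assms by auto
  qed
qed

definition norm_W :: "'v \<Rightarrow> real" where "norm_W v = sqrt (\<kappa> * b v v)"
definition N :: "'v \<Rightarrow> 'v" where "N v = (1 / norm_W v) *\<^sub>R v"

lemma norm_W_pos: "v \<in> W \<Longrightarrow> 0 < norm_W v" using W_pos by (simp add: norm_W_def)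
lemma norm_W_sq: "v \<in> W \<Longrightarrow> (norm_W v)\<^sup>2 = \<kappa> * b v v" using W_pos[of v] by (simp add: norm_W_def)
lemma norm_W_M: "x \<in> M \<Longrightarrow> norm_W x = 1" by (simp add: norm_W_def pts_eq)

lemma N_mem: assumes "v \<in> W" shows "N v \<in> M"
proof -
  have p: "0 < norm_W v" using norm_W_pos[OF assms] .
  have "\<kappa> * b (N v) (N v) = (\<kappa> * b v v) / (norm_W v)\<^sup>2"
    unfolding N_def by (simp add: b_linear power2_eq_square)
  also have "\<dots> = 1" unfolding norm_W_sq[OF assms] using W_pos[OF assms] by (metis divide_self less_irrefl)
  finally show ?thesis using W_scale[OF assms, of "1 / norm_W v"] p unfolding pts_eq N_def by simp
qed

lemma N_id: "x \<in> M \<Longrightarrow> N x = x" by (simp add: N_def norm_W_M)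

lemma norm_W_scale:
  assumes "0 < t" shows "norm_W (t *\<^sub>R v) = t * norm_W v"
proof -
  have "\<kappa> * b (t *\<^sub>R v) (t *\<^sub>R v) = t\<^sup>2 * (\<kappa> * b v v)"
    by (simp add: b_linear power2_eq_square)
  then have "norm_W (t *\<^sub>R v) = sqrt (t\<^sup>2 * (\<kappa> * b v v))" by (simp only: norm_W_def)
  then show ?thesis using assms unfolding norm_W_def by (simp only: real_sqrt_mult real_sqrt_abs abs_of_pos)
qed

lemma N_scale: "0 < t \<Longrightarrow> N (t *\<^sub>R v) = N v"
  by (simp add: N_def norm_W_scale)

lemma norm_W_N: "v \<in> W \<Longrightarrow> v = norm_W v *\<^sub>R N v" using norm_W_pos[of v] by (simp add: N_def)

lemma N_continuous: "continuous_on W N"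
proof -
  have "continuous_on W norm_W" unfolding norm_W_def by (intro continuous_intros)
  then show ?thesis unfolding N_def using norm_W_pos
    by (intro continuous_intros) (auto simp: less_imp_neq[symmetric] dest: norm_W_pos)
qed

lemma N_section: "v \<in> W \<Longrightarrow> \<exists>s. continuous_on M s \<and> s (N v) = v \<and> (\<forall>y\<in>M. s y \<in> W \<and> N (s y) = y)"
proof (intro exI conjI ballI)
  assume v: "v \<in> W"
  show "continuous_on M (\<lambda>y. norm_W v *\<^sub>R y)" by (intro continuous_intros)
  show "norm_W v *\<^sub>R N v = v" using norm_W_N[OF v] by simp
  fix y assume y: "y \<in> M"
  show "norm_W v *\<^sub>R y \<in> W" using W_scale M_W[OF y] norm_W_pos[OF v] by blast
  show "N (norm_W v *\<^sub>R y) = y" using N_scale M_W[OF y] norm_W_pos[OF v] N_id[OF y] by simp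
qed

lemma N_segment:
  assumes "u \<in> W" "v \<in> W" "0 \<le> t" "t \<le> 1" "(1 - t) *\<^sub>R u + t *\<^sub>R v \<in> W"
  shows "N ((1 - t) *\<^sub>R u + t *\<^sub>R v) \<in> geo_segment X (N u) (N v)"
proof -
  let ?w = "(1 - t) *\<^sub>R u + t *\<^sub>R v"
  have "N ?w = ((1 - t) * norm_W u / norm_W ?w) *\<^sub>R N u + (t * norm_W v / norm_W ?w) *\<^sub>R N v"
  proof -
    have "?w = ((1 - t) * norm_W u) *\<^sub>R N u + (t * norm_W v) *\<^sub>R N v"
      using norm_W_N[OF assms(1)] norm_W_N[OF assms(2)] by (metis scaleR_scaleR)
    then have "N ?w = (1 / norm_W ?w) *\<^sub>R (((1 - t) * norm_W u) *\<^sub>R N u + (t * norm_W v) *\<^sub>R N v)"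
      unfolding N_def[of ?w] by simp
    then show ?thesis by (simp add: scaleR_right_distrib)
  qed
  moreover have "0 \<le> (1 - t) * norm_W u / norm_W ?w" "0 \<le> t * norm_W v / norm_W ?w"
    using assms norm_W_pos[of u] norm_W_pos[of v] norm_W_pos[of ?w] by simp_all
  ultimately show ?thesis unfolding geo_segment_def
    using gdist_between[OF N_mem[OF assms(1)] N_mem[OF assms(2)] N_mem[OF assms(5)]] N_mem[OF assms(5)] by simp
qed

end

lemma divide_le_square_iff:
  fixes a c k :: real
  assumes "k \<noteq> 0" "0 \<le> a" "0 \<le> c"
  shows "a / k \<le> c / k \<longleftrightarrow> a\<^sup>2 / k \<le> c\<^sup>2 / k"
  using assms by (cases "k > 0") (auto simp: divide_le_cancel)

context quadric
begin

text \<open>Cauchy-Schwarz for \<kappa> > 0, and its reversal for timelike vectors for \<kappa> <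
  0.\<close>

lemma form_le_norm_W:
  assumes "u \<in> W" "v \<in> W" shows "b u v \<le> norm_W u * norm_W v / \<kappa>"
proof -
  have "b (N u) (N v) \<le> 1 / \<kappa>"
    using cauchy_schwarz[OF N_mem[OF assms(1)] N_mem[OF assms(2)]] M_form[OF N_mem[OF assms(1)]]
    by (cases "N u = N v") auto
  then have "norm_W u * norm_W v * b (N u) (N v) \<le> norm_W u * norm_W v * (1 / \<kappa>)"
    using norm_W_pos assms by (intro mult_left_mono) (simp_all add: less_imp_le)
  moreover have "b u v = norm_W u * norm_W v * b (N u) (N v)"
    using norm_W_pos[OF assms(1)] norm_W_pos[OF assms(2)] by (simp add: N_def b_linear)
  ultimately show ?thesis by simp
qed

lemma form_sum:
  "b (s *\<^sub>R u + t *\<^sub>R v) (s *\<^sub>R u + t *\<^sub>R v) = s\<^sup>2 * b u u + 2 * s * t * b u v + t\<^sup>2 * b v v"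
  using sym[of u v] by (simp add: b_linear power2_eq_square algebra_simps)

lemma segment_in_W:
  assumes "x \<in> M" "y \<in> M" "- 1 < \<kappa> * b x y" "0 \<le> t" "t \<le> 1"
  shows "(1 - t) *\<^sub>R x + t *\<^sub>R y \<in> W"
proof (rule W_cone)
  have "\<kappa> * b ((1 - t) *\<^sub>R x + t *\<^sub>R y) ((1 - t) *\<^sub>R x + t *\<^sub>R y) = (1 - t)\<^sup>2 + 2 * (1 - t) * t * (\<kappa> * b x y) + t\<^sup>2"
    unfolding form_sum using M_form assms \<kappa>_nonzero by (simp add: algebra_simps)
  also have "\<dots> > 0"
  proof (cases "t = 0 \<or> t = 1")
    case False
    then have "2 * (1 - t) * t * (- 1) < 2 * (1 - t) * t * (\<kappa> * b x y)"
      using assms by (intro mult_strict_left_mono) auto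
    \<comment> \<open>In the antipodal case the form would be this square, which vanishes at the
      midpoint; the strict inequality just shown keeps it positive.\<close>
    moreover have "(1 - t)\<^sup>2 + 2 * (1 - t) * t * (- 1) + t\<^sup>2 = (1 - 2 * t)\<^sup>2" by (simp add: power2_eq_square algebra_simps)
    ultimately show ?thesis by (smt (verit) zero_le_power2)
  qed auto
  finally show "0 < \<kappa> * b ((1 - t) *\<^sub>R x + t *\<^sub>R y) ((1 - t) *\<^sub>R x + t *\<^sub>R y)" .
qed (use assms M_W in auto)

text \<open>The line runs in a direction orthogonal to \<open>Q\<close> and \<open>z\<close>, so
  only the norm changes, its square becoming 1 + \<kappa> t^2, and normalising moves the point away
  from \<open>z\<close> for either sign of t. On the sphere the hypothesis says that the distance is
  below a quarter of a great circle.\<close>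

lemma outside_tangent_ball:
  assumes Q: "Q \<in> M" "z \<in> M" and pos: "0 < \<kappa> * b Q z"
  shows "\<exists>e. \<forall>\<^sub>F t in at 0. Q + t *\<^sub>R e \<in> W \<and> h Q z < h (N (Q + t *\<^sub>R e)) z"
proof -
  obtain e where e: "b e Q = 0" "b e z = 0" "b e e = 1" using normal_exists[OF Q] by blast
  have "\<forall>\<^sub>F t in at 0. Q + t *\<^sub>R e \<in> W"
    using line_tendsto[of Q e] W_open M_W[OF Q(1)] by (rule topological_tendstoD)
  moreover have "\<forall>\<^sub>F t in at (0::real). t \<noteq> 0" by (simp add: eventually_at_filter)
  ultimately have "\<forall>\<^sub>F t in at 0. Q + t *\<^sub>R e \<in> W \<and> h Q z < h (N (Q + t *\<^sub>R e)) z"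
  proof eventually_elim
    case (elim t)
    let ?w = "Q + t *\<^sub>R e"
    have n: "(norm_W ?w)\<^sup>2 = 1 + \<kappa> * t\<^sup>2"
      unfolding norm_W_sq[OF elim(1)] using e M_form[OF Q(1)] sym[of Q e] \<kappa>_nonzero
      by (simp add: b_linear power2_eq_square distrib_left)
    have np: "0 < norm_W ?w" using norm_W_pos[OF elim(1)] .
    have "b (N ?w) z = b Q z / norm_W ?w" unfolding N_def using e by (simp add: b_linear)
    moreover have "b Q z / norm_W ?w < b Q z"
    proof (cases "\<kappa> > 0")
      case True
      then have "1\<^sup>2 < (norm_W ?w)\<^sup>2" using n elim by simp
      then have "1 < norm_W ?w" using np power_less_imp_less_base[of 1 2 "norm_W ?w"] by simp
      moreover have "0 < b Q z" using True pos by (simp add: zero_less_mult_iff)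
      ultimately show ?thesis by (simp add: divide_less_eq)
    next
      case False
      then have k: "\<kappa> < 0" using \<kappa>_nonzero by simp
      then have "(norm_W ?w)\<^sup>2 < 1\<^sup>2" using n elim by (simp add: mult_less_0_iff)
      then have "norm_W ?w < 1" using np power_less_imp_less_base[of "norm_W ?w" 2 1] by simp
      moreover have "b Q z < 0" using k pos by (simp add: zero_less_mult_iff)
      ultimately show ?thesis using np by (simp add: divide_less_eq)
    qed
    ultimately show ?case using elim h_M[OF Q] h_M[OF N_mem[OF elim(1)] Q(2)] by simp
  qed
  then show ?thesis by blast
qed

text \<open>The farther point \<open>p\<close> guarantees that \<open>x\<close> is not antipodal to
  \<open>c\<close>, so the segment avoids the origin and can be projected.\<close>

lemma star_shaped:
  assumes "c \<in> M" "x \<in> M" "p \<in> M" "h c x < h c p"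
  shows "\<exists>T\<subseteq>M. connected T \<and> c \<in> T \<and> x \<in> T \<and> (\<forall>y\<in>T. h c y \<le> h c x)"
proof -
  have cx: "- 1 < \<kappa> * b c x"
  proof (cases "\<kappa> > 0")
    case True
    have "\<kappa> * b c p < \<kappa> * b c x" using True assms h_M by simp
    then show ?thesis using antipodal(1)[OF assms(1,3)] by simp
  next
    case False
    then have k: "\<kappa> < 0" using \<kappa>_nonzero by simp
    have "b c x \<le> 1 / \<kappa>" using cauchy_schwarz[OF assms(1,2)] M_form[OF assms(1)] by (cases "c = x") auto
    then have "1 \<le> \<kappa> * b c x" using k by (simp add: field_simps)
    then show ?thesis by simp
  qed
  have seg: "closed_segment c x \<subseteq> W"
    using segment_in_W[OF assms(1,2) cx] by (auto simp: in_segment)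
  let ?T = "N ` closed_segment c x"
  have "connected ?T"
    using continuous_on_subset[OF N_continuous seg] by (intro connected_continuous_image) auto
  moreover have "?T \<subseteq> M" using seg N_mem by blast
  moreover have "c \<in> ?T" "x \<in> ?T" using N_id assms by force+
  moreover have "h c y \<le> h c x" if y: "y \<in> ?T" for y
  proof -
    obtain t where t: "0 \<le> t" "t \<le> 1" "y = N ((1 - t) *\<^sub>R c + t *\<^sub>R x)"
      using y unfolding closed_segment_def by blast
    have w: "(1 - t) *\<^sub>R c + t *\<^sub>R x \<in> W" using segment_in_W[OF assms(1,2) cx t(1,2)] .
    have "y \<in> geo_segment X c x"
      using N_segment[OF M_W[OF assms(1)] M_W[OF assms(2)] t(1,2) w] N_id assms t(3) by simp
    then have y: "y \<in> M" "d c y + d y x = d c x" by (auto simp: geo_segment_def)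
    then have "d c y \<le> d c x" using gdist_nonneg[OF y(1) assms(2)] by simp
    then show ?thesis using h_le_iff[OF assms(1) y(1) gdist_dom[OF assms(1,2)]] h_gdist[OF assms(1,2)] by simp
  qed
  ultimately show ?thesis by (intro exI[of _ ?T]) blast
qed

end

text \<open>On the sphere this puts R below a quarter of a great circle, which makes balls of radius
  R convex.\<close>

locale quadric_radius = quadric +
  fixes R :: real
  assumes R: "proper (2 * R)"
begin

definition "c1 = (1 - cs R) / \<kappa>"
definition "c2 = (1 - cs (2 * R)) / \<kappa>"

lemma R_pos: "0 < R" using R by (simp add: proper_def)
lemma R_proper: "proper R" using proper_less[OF R] R_pos by simp
lemma cs_R_pos: "0 < cs R" using cs_pos[OF R] .

lemma h_le_c1: "x \<in> M \<Longrightarrow> z \<in> M \<Longrightarrow> h x z \<le> c1 \<longleftrightarrow> cs R / \<kappa> \<le> b x z"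
  unfolding c1_def by (simp add: h_M diff_divide_distrib)

lemma c1_pos: "0 < c1"
  using cs_mono[OF dom_0 proper_dom[OF R_proper] R_pos] cs_0 unfolding c1_def by (simp add: diff_divide_distrib)

text \<open>The linear midpoint pairs with \<open>z\<close> to at least
  \<open>cs R / \<kappa>\<close>; Cauchy-Schwarz turns this into a bound on its norm, that is, on
  \<open>b x y\<close>.\<close>

lemma diameter_bound:
  assumes "x \<in> M" "y \<in> M" "z \<in> M" "h x z \<le> c1" "h y z \<le> c1"
  shows "h x y \<le> c2"
proof (cases "\<kappa> * b x y = - 1")
  case False
  then have a: "- 1 < \<kappa> * b x y" using antipodal(1)[OF assms(1,2)] by simp
  have w: "(1 - 1/2) *\<^sub>R x + (1/2) *\<^sub>R y \<in> W" using segment_in_W[OF assms(1,2) a, of "1/2"] by simp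
  let ?w = "(1 - 1/2) *\<^sub>R x + (1/2) *\<^sub>R y"
  have "cs R / \<kappa> \<le> b ?w z"
    using assms h_le_c1 by (simp add: b_linear)
  also have "\<dots> \<le> norm_W ?w / \<kappa>" using form_le_norm_W[OF w M_W[OF assms(3)]] norm_W_M[OF assms(3)] by simp
  finally have "(cs R)\<^sup>2 / \<kappa> \<le> (norm_W ?w)\<^sup>2 / \<kappa>"
    using divide_le_square_iff[OF \<kappa>_nonzero, of "cs R" "norm_W ?w"] cs_R_pos norm_W_pos[OF w] by simp
  also have "(norm_W ?w)\<^sup>2 / \<kappa> = b ?w ?w" unfolding norm_W_sq[OF w] using \<kappa>_nonzero by simp
  also have "\<dots> = (1 / \<kappa> + b x y) / 2" unfolding form_sum using M_form assms by (simp add: power2_eq_square)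
  finally have "(2 * (cs R)\<^sup>2 - 1) / \<kappa> \<le> b x y" by (simp add: diff_divide_distrib mult.commute)
  then show ?thesis unfolding c2_def cs_double h_M[OF assms(1,2)] by (simp add: diff_divide_distrib)
next
  case True
  then have y: "y = - x" using antipodal(2) assms by blast
  have "cs R / \<kappa> \<le> b x z" "cs R / \<kappa> \<le> - b x z" using h_le_c1 assms y by (auto simp: b_linear)
  then have "cs R / \<kappa> \<le> 0" by linarith
  moreover have "\<kappa> > 0 \<or> \<kappa> < 0" using \<kappa>_nonzero by linarith
  ultimately have "\<kappa> < 0" using cs_R_pos by (auto simp: divide_le_0_iff)
  moreover have "b x y < 1 / \<kappa> \<or> x = y" using cauchy_schwarz[OF assms(1,2)] by blast
  moreover have "b x y = - 1 / \<kappa>" using True \<kappa>_nonzero by (simp add: field_simps)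
  ultimately have "x = y" by (auto simp: field_simps)
  then show ?thesis using True M_form[OF assms(1)] \<kappa>_nonzero by simp
qed

text \<open>The ball is cut out by the cone \<open>norm_W w * (cs R / \<kappa>) \<le> b w z\<close>.
  Its convexity comes from subadditivity of \<open>norm_W w / \<kappa>\<close>, which is
  Cauchy-Schwarz again, and from \<open>cs R\<close> being positive.\<close>

lemma ball_cone:
  assumes z: "z \<in> M" and u: "u \<in> W" "h (N u) z \<le> c1" and v: "v \<in> W" "h (N v) z \<le> c1"
    and t: "0 \<le> t" "t \<le> 1" "(1 - t) *\<^sub>R u + t *\<^sub>R v \<in> W"
  shows "h (N ((1 - t) *\<^sub>R u + t *\<^sub>R v)) z \<le> c1"
proof -
  have cone: "h (N w) z \<le> c1 \<longleftrightarrow> norm_W w * (cs R / \<kappa>) \<le> b w z" if "w \<in> W" for w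
  proof -
    have "b w z = norm_W w * b (N w) z" using norm_W_pos[OF that] by (simp add: N_def b_linear)
    then show ?thesis using h_le_c1[OF N_mem[OF that] z] norm_W_pos[OF that]
      by (simp only: mult_le_cancel_left_pos)
  qed
  let ?w = "(1 - t) *\<^sub>R u + t *\<^sub>R v"
  let ?n = "(1 - t) * norm_W u + t * norm_W v"
  have n0: "0 \<le> ?n" using t norm_W_pos[OF u(1)] norm_W_pos[OF v(1)] by simp
  have "(norm_W ?w)\<^sup>2 / \<kappa> = b ?w ?w" unfolding norm_W_sq[OF t(3)] using \<kappa>_nonzero by simp
  also have "\<dots> = (1 - t)\<^sup>2 * b u u + 2 * (1 - t) * t * b u v + t\<^sup>2 * b v v" unfolding form_sum ..
  also have "\<dots> \<le> (1 - t)\<^sup>2 * b u u + 2 * (1 - t) * t * (norm_W u * norm_W v / \<kappa>) + t\<^sup>2 * b v v"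
    using form_le_norm_W[OF u(1) v(1)] t by (intro add_mono mult_left_mono) auto
  also have "\<dots> = ?n\<^sup>2 / \<kappa>"
  proof -
    have "b u u = (norm_W u)\<^sup>2 / \<kappa>" "b v v = (norm_W v)\<^sup>2 / \<kappa>"
      using norm_W_sq u v \<kappa>_nonzero by simp_all
    then show ?thesis
      using \<kappa>_nonzero by (simp only:) (simp add: power2_eq_square field_simps)
  qed
  finally have "norm_W ?w / \<kappa> \<le> ?n / \<kappa>"
    using divide_le_square_iff[OF \<kappa>_nonzero, of "norm_W ?w" ?n] norm_W_pos[OF t(3)] n0 by simp
  then have "norm_W ?w * (cs R / \<kappa>) \<le> ?n * (cs R / \<kappa>)"
    using mult_left_mono[of "norm_W ?w / \<kappa>" "?n / \<kappa>" "cs R"] cs_R_pos by (simp add: mult.commute)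
  also have "\<dots> = (1 - t) * (norm_W u * (cs R / \<kappa>)) + t * (norm_W v * (cs R / \<kappa>))" by (simp only: distrib_right mult.assoc)
  also have "\<dots> \<le> (1 - t) * b u z + t * b v z"
    using cone[OF u(1)] cone[OF v(1)] u v t by (intro add_mono mult_left_mono) auto
  also have "\<dots> = b ?w z" by (simp add: b_linear)
  finally show ?thesis using cone[OF t(3)] by simp
qed

sublocale model_space "form X" "pts X" c1 c2 W N
proof
  show "closed M" by (rule closed_pts)
  show "0 < h x y" if "x \<in> M" "y \<in> M" "x \<noteq> y" for x y
    using cauchy_schwarz[OF that] h_M that by simp
  show "\<alpha> *\<^sub>R A + \<beta> *\<^sub>R y + \<delta> *\<^sub>R P \<in> M"
    if m: "A \<in> M" "y \<in> M" "P \<in> M" and e: "\<alpha> + \<beta> + \<delta> = 1"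
      "\<alpha> * \<beta> * h A y + \<alpha> * \<delta> * h A P + \<beta> * \<delta> * h y P = 0" "0 \<le> h (\<alpha> *\<^sub>R A + \<beta> *\<^sub>R y + \<delta> *\<^sub>R P) P"
    for A y P \<alpha> \<beta> \<delta>
  proof -
    let ?v = "\<alpha> *\<^sub>R A + \<beta> *\<^sub>R y + \<delta> *\<^sub>R P"
    \<comment> \<open>All points of \<open>M\<close> have the same \<open>h\<close> to the origin,
      so \<open>h_affine_combination\<close> with \<open>z = 0\<close> puts the circle on the
      quadric; the premise on \<open>h\<close> then selects the sheet.\<close>
    have h0: "h x 0 = 1 / (2 * \<kappa>)" if "x \<in> M" for x unfolding h_def using M_form[OF that] by simp
    have "h ?v 0 = (\<alpha> + \<beta> + \<delta>) * (1 / (2 * \<kappa>))"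
      unfolding h_affine_combination[OF e(1,2)] h0[OF m(1)] h0[OF m(2)] h0[OF m(3)] by (simp add: algebra_simps add_divide_distrib)
    then have vv: "b ?v ?v = 1 / \<kappa>" unfolding h_def e(1) using \<kappa>_nonzero by simp
    have "h ?v P = 1 / \<kappa> - b ?v P"
      unfolding h_def using vv M_form[OF m(3)] sym[of P ?v]
      by (simp only: bilinear_lsub[OF bil] bilinear_rsub[OF bil]) simp
    then show ?thesis using M_I[OF m(3), of ?v] vv e(3) \<kappa>_nonzero by simp
  qed
  show "h x y \<le> c2" if "x \<in> M" "y \<in> M" "z \<in> M" "h x z \<le> c1" "h y z \<le> c1" for x y z
    using diameter_bound that by blast
  show "0 < c1" by (rule c1_pos)
  show "\<exists>T\<subseteq>M. connected T \<and> c \<in> T \<and> x \<in> T \<and> (\<forall>y\<in>T. h c y \<le> h c x)"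
    if "c \<in> M" "x \<in> M" "p \<in> M" "h c x < h c p" for c x p using star_shaped that by blast
  show "open W" by (rule W_open)
  show "M \<subseteq> W" using M_W by blast
  show "continuous_on W N" by (rule N_continuous)
  show "N v \<in> M" if "v \<in> W" for v using N_mem that .
  show "N x = x" if "x \<in> M" for x using N_id that .
  show "\<exists>s. continuous_on M s \<and> s (N v) = v \<and> (\<forall>y\<in>M. s y \<in> W \<and> N (s y) = y)" if "v \<in> W" for v
    using N_section that .
  show "h (N ((1 - t) *\<^sub>R u + t *\<^sub>R v)) z \<le> c1"
    if "z \<in> M" "u \<in> W" "v \<in> W" "h (N u) z \<le> c1" "h (N v) z \<le> c1" "0 \<le> t" "t \<le> 1" "(1 - t) *\<^sub>R u + t *\<^sub>R v \<in> W"
    for z u v t using ball_cone that by blast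
  show "\<exists>e. \<forall>\<^sub>F t in at 0. Q + t *\<^sub>R e \<in> W \<and> c1 < h (N (Q + t *\<^sub>R e)) z"
    if "Q \<in> M" "z \<in> M" "h Q z = c1" for Q z
  proof -
    have "b Q z = cs R / \<kappa>" using that h_M unfolding c1_def by (simp add: diff_divide_distrib)
    then have "0 < \<kappa> * b Q z" using cs_R_pos \<kappa>_nonzero by simp
    then show ?thesis using outside_tangent_ball[OF that(1,2)] that(3) by simp
  qed
qed

end

lemma has_vector_derivative_form_const:
  assumes "bounded_bilinear b" "(g has_vector_derivative v) (at (t::real))" "\<And>s. b (g s) z = (c::real)"
  shows "b v z = 0"
proof -
  have "((\<lambda>s. b (g s) z) has_vector_derivative b v z) (at t)"
    using bounded_linear.has_vector_derivative[OF bounded_bilinear.bounded_linear_left[OF assms(1)] assms(2)] .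
  then have "((\<lambda>s. c) has_vector_derivative b v z) (at t)" using assms(3) by simp
  then show ?thesis using vector_derivative_unique_at has_vector_derivative_const by metis
qed

lemma has_vector_derivative_form_self_const:
  assumes "bounded_bilinear b" "\<And>x y. b x y = b y x" "(g has_vector_derivative v) (at (t::real))" "\<And>s. b (g s) (g s) = (c::real)"
  shows "b (g t) v = 0"
proof -
  have "((\<lambda>s. b (g s) (g s)) has_vector_derivative (b (g t) v + b v (g t))) (at t)"
    using bounded_bilinear.has_vector_derivative[OF assms(1) assms(3) assms(3)] .
  then have "((\<lambda>s. c) has_vector_derivative (b (g t) v + b v (g t))) (at t)" using assms(4) by simp
  then have "b (g t) v + b v (g t) = 0" using vector_derivative_unique_at has_vector_derivative_const by metis
  then show ?thesis using assms(2)[of v "g t"] by simp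
qed

lemma circle_derivs:
  fixes z f e :: "'a::real_normed_vector" and \<omega> :: real
  shows "((\<lambda>t. z + cos (\<omega> * t) *\<^sub>R f + sin (\<omega> * t) *\<^sub>R e) has_vector_derivative
      (\<omega> *\<^sub>R (- sin (\<omega> * t) *\<^sub>R f + cos (\<omega> * t) *\<^sub>R e))) (at t)"
    and "((\<lambda>t. \<omega> *\<^sub>R (- sin (\<omega> * t) *\<^sub>R f + cos (\<omega> * t) *\<^sub>R e)) has_vector_derivative
      (- \<omega>\<^sup>2) *\<^sub>R (cos (\<omega> * t) *\<^sub>R f + sin (\<omega> * t) *\<^sub>R e)) (at t)"
  by (auto intro!: derivative_eq_intros simp: has_vector_derivative_def algebra_simps power2_eq_square)

section \<open>Normal curvatures of geodesic spheres\<close>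

context quadric
begin

lemma sphere_inner_normal:
  assumes z: "z \<in> M" "p \<in> M" and r: "d z p = r" "proper r"
  obtains Nn where "inner_unit_normal X (geo_sphere X z r) (geo_cball X z r) p Nn"
    "unit_tangent p Nn" "z = geodesic p Nn r"
proof -
  have pz: "d p z = r" using gdist_commute z r by simp
  obtain T where T: "unit_tangent p T" "z = geodesic p T r"
    using geodesic_to[OF z(2,1)] pz r(2) by metis
  have r0: "0 < r" "r \<in> dom" using r(2) proper_dom by (auto simp: proper_def)
  have sr: "0 < sn r" using proper_sn[OF r(2)] .
  have TT: "b T T = 1" "b p T = 0" using T(1) by (auto simp: unit_tangent_def)
  have perp: "b T v = 0" if v: "v \<in> tangent_vectors (geo_sphere X z r) p" for v
  proof -
    obtain g where g: "g 0 = p" "\<And>t::real. g t \<in> geo_sphere X z r" "(g has_vector_derivative v) (at 0)"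
      using v unfolding tangent_vectors_def by blast
    have gM: "g t \<in> M" "d z (g t) = r" for t using g(2)[of t] by (auto simp: geo_sphere_def)
    have "b (g t) z = cs r / \<kappa>" for t using form_gdist[OF z(1) gM(1)[of t]] gM(2) sym by metis
    then have 1: "b v z = 0" using has_vector_derivative_form_const[OF bounded_b g(3)] by blast
    have "b (g t) (g t) = 1 / \<kappa>" for t using M_form[OF gM(1)] .
    then have 2: "b p v = 0" using has_vector_derivative_form_self_const[OF bounded_b sym g(3)] g(1) by metis
    have "b v z = cs r * b v p + sn r * b v T" using T(2) unfolding geodesic_def by (simp add: b_linear)
    then have "sn r * b v T = 0" using 1 2 sym[of v p] by simp
    then show ?thesis using sr sym[of v T] by simp
  qed
  have curve: "\<exists>\<gamma>. \<gamma> 0 = p \<and> (\<forall>t\<ge>0::real. \<gamma> t \<in> geo_cball X z r) \<and> (\<gamma> has_vector_derivative T) (at 0 within {0..})"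
  proof (intro exI conjI allI impI)
    \<comment> \<open>The definition of the inner normal wants a curve that stays in the ball for
      all t \<ge> 0, but a geodesic at unit speed passes the centre and leaves. This
      reparametrisation has speed 1 at the start and never reaches the centre.\<close>
    let ?\<phi> = "\<lambda>t. r * (1 - exp (- t / r))"
    let ?g = "\<lambda>t. geodesic p T (?\<phi> t)"
    show "?g 0 = p" by (simp add: geodesic_0)
    show "?g t \<in> geo_cball X z r" if t: "0 \<le> t" for t
    proof -
      have e: "0 \<le> ?\<phi> t" "?\<phi> t \<le> r" using r0 t by (auto simp: algebra_simps)
      have "r - ?\<phi> t \<in> dom" using dom_down[OF r0(2)] e by simp
      then have "d z (?g t) = r - ?\<phi> t" using gdist_geodesic[OF T(1), of r "?\<phi> t"] T(2) by simp
      then show ?thesis unfolding geo_cball_def using geodesic_mem[OF T(1)] e by simp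
    qed
    have "(?\<phi> has_vector_derivative 1) (at 0)"
      using r0 unfolding has_real_derivative_iff_has_vector_derivative[symmetric]
      by (auto intro!: derivative_eq_intros)
    moreover have "(geodesic p T has_vector_derivative T) (at (?\<phi> 0))"
      using geodesic_deriv[of p T 0] cs_0 sn_0 by simp
    ultimately have "(?g has_vector_derivative T) (at 0)"
      using vector_diff_chain_at[of ?\<phi> 1 0 "geodesic p T" T] by (simp add: o_def)
    then show "(?g has_vector_derivative T) (at 0 within {0..})" by (rule has_vector_derivative_at_within)
  qed
  have "inner_unit_normal X (geo_sphere X z r) (geo_cball X z r) p T"
    unfolding inner_unit_normal_def using geodesic_tangent[OF T(1)] TT perp curve by blast
  then show thesis using that T by blast
qed

text \<open>One realised value is enough, because \<open>sphere_of_curvature\<close> prescribes all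
  of them. The curve is a circle of ambient radius \<open>sn r\<close>, run at unit speed in a
  direction orthogonal to \<open>z\<close> and \<open>p\<close>.\<close>

lemma sphere_normal_curvature:
  assumes z: "z \<in> M" "p \<in> M" and r: "d z p = r" "proper r"
  shows "\<exists>v. has_normal_curvature X (geo_sphere X z r) (geo_cball X z r) p v (cs r / sn r)"
proof -
  obtain T where T: "inner_unit_normal X (geo_sphere X z r) (geo_cball X z r) p T"
    "unit_tangent p T" "z = geodesic p T r"
    using sphere_inner_normal[OF z r] by blast
  obtain f where f: "unit_tangent z f" "p = geodesic z f r"
    using geodesic_to[OF z] r by metis
  obtain e where e: "b e z = 0" "b e p = 0" "b e e = 1" using normal_exists[OF z] by blast
  have sr: "0 < sn r" using proper_sn[OF r(2)] .
  have zz: "b z z = 1 / \<kappa>" "b z f = 0" "b f z = 0" "b f f = 1" "b z e = 0" "b p p = 1 / \<kappa>"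
    using f(1) M_form z sym[of f z] sym[of z e] e by (auto simp: unit_tangent_def)
  have fe: "b f e = 0" "b e f = 0"
  proof -
    have "b e p = cs r * b e z + sn r * b e f" by (subst f(2)) (simp add: geodesic_def b_linear)
    then show "b e f = 0" using e sr by simp
    then show "b f e = 0" using sym[of f e] by simp
  qed
  define \<omega> where "\<omega> = 1 / sn r"
  let ?f = "sn r *\<^sub>R f" and ?e = "sn r *\<^sub>R e"
  let ?g = "\<lambda>t. cs r *\<^sub>R z + cos (\<omega> * t) *\<^sub>R ?f + sin (\<omega> * t) *\<^sub>R ?e"
  let ?g' = "\<lambda>t. \<omega> *\<^sub>R (- sin (\<omega> * t) *\<^sub>R ?f + cos (\<omega> * t) *\<^sub>R ?e)"
  have gz: "b (?g t) z = cs r / \<kappa>" for t by (simp add: b_linear zz e)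
  have gM: "?g t \<in> M" for t
  proof (rule M_I[OF z(1)])
    have "\<kappa> * b (?g t) (?g t) = (cs r)\<^sup>2 + \<kappa> * (sn r)\<^sup>2 * ((cos (\<omega> * t))\<^sup>2 + (sin (\<omega> * t))\<^sup>2)"
      using \<kappa>_nonzero by (simp only: b_linear zz fe e power2_eq_square) (simp add: power2_eq_square algebra_simps del: sin_cos_squared_add3)
    then show "\<kappa> * b (?g t) (?g t) = 1" using pythagoras[of r] by simp
    show "b (?g t) z \<le> 1 / \<kappa>" unfolding gz by (rule cs_le_1)
  qed
  have gS: "?g t \<in> geo_sphere X z r" for t
    unfolding geo_sphere_def using gM[of t] gz[of t] \<kappa>_nonzero proper_dom[OF r(2)] sym[of z "?g t"]
    by (auto intro!: gdist_eqI z)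
  have v0: "?g' 0 = e" using sr by (simp add: \<omega>_def)
  have fT: "b f T = - cs r"
  proof -
    have "sn r * sn r * b f T = b (sn r *\<^sub>R f) (sn r *\<^sub>R T)" by (simp add: b_linear)
    also have "sn r *\<^sub>R f = p - cs r *\<^sub>R z" by (subst f(2)) (simp add: geodesic_def)
    also have "sn r *\<^sub>R T = z - cs r *\<^sub>R p" by (subst T(3)) (simp add: geodesic_def)
    also have "b (p - cs r *\<^sub>R z) (z - cs r *\<^sub>R p) = (1 + (cs r)\<^sup>2) * b z p - 2 * cs r / \<kappa>"
      using zz sym[of p z] by (simp add: b_linear algebra_simps power2_eq_square)
    also have "b z p = cs r / \<kappa>" using form_gdist[OF z] r(1) by simp
    also have "(1 + (cs r)\<^sup>2) * (cs r / \<kappa>) - 2 * cs r / \<kappa> = - cs r * (1 - (cs r)\<^sup>2) / \<kappa>"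
      by (simp add: algebra_simps add_divide_distrib diff_divide_distrib)
    also have "1 - (cs r)\<^sup>2 = \<kappa> * (sn r)\<^sup>2" using pythagoras[of r] by simp
    finally have "(sn r * sn r) * b f T = (sn r * sn r) * (- cs r)"
      using \<kappa>_nonzero by (simp add: power2_eq_square)
    then show ?thesis using sr by (simp only: mult_cancel_left) simp
  qed
  have "has_normal_curvature X (geo_sphere X z r) (geo_cball X z r) p e (cs r / sn r)"
    unfolding has_normal_curvature_def
  proof (intro conjI exI allI)
    show "b e e = 1" by fact
    show "inner_unit_normal X (geo_sphere X z r) (geo_cball X z r) p T" by fact
    show "?g 0 = p" by (subst f(2)) (simp add: geodesic_def)
    show "?g' 0 = e" by fact
    show "?g t \<in> geo_sphere X z r" for t by (rule gS)
    show "(?g has_vector_derivative ?g' t) (at t)" for t by (rule circle_derivs(1))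
    show "(?g' has_vector_derivative (- \<omega>\<^sup>2) *\<^sub>R (cos (\<omega> * 0) *\<^sub>R ?f + sin (\<omega> * 0) *\<^sub>R ?e)) (at 0)"
      by (rule circle_derivs(2))
    show "cs r / sn r = b ((- \<omega>\<^sup>2) *\<^sub>R (cos (\<omega> * 0) *\<^sub>R ?f + sin (\<omega> * 0) *\<^sub>R ?e)) T"
      using sr by (simp add: b_linear fT \<omega>_def power2_eq_square)
  qed
  then show ?thesis by blast
qed

end

context quadric_radius
begin

text \<open>Equal curvatures give \<open>sn (r - R) = 0\<close>. A proper ball keeps
  \<open>r\<close> below the maximal distance, where \<open>sn\<close> has no zero besides
  0.\<close>

lemma sphere_radius:
  assumes "sphere_of_curvature X (cs R / sn R) z r" "p \<in> geo_sphere X z r"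
  shows "r = R"
proof -
  have z: "z \<in> M" "0 < r" "geo_cball X z r \<noteq> M" and p: "p \<in> M" "d z p = r"
    using assms by (auto simp: sphere_of_curvature_def geo_sphere_def)
  have "proper r"
  proof (rule ccontr)
    assume "\<not> proper r"
    then have "\<forall>s\<in>dom. s \<le> r" using z(2) by (auto simp: proper_def)
    then have "geo_cball X z r = M" using gdist_dom z(1) by (auto simp: geo_cball_def)
    then show False using z(3) by simp
  qed
  then obtain v where "has_normal_curvature X (geo_sphere X z r) (geo_cball X z r) p v (cs r / sn r)"
    using sphere_normal_curvature[OF z(1) p] by blast
  then have eq: "cs r / sn r = cs R / sn R"
    using assms unfolding sphere_of_curvature_def by blast
  have s: "0 < sn r" "0 < sn R" using proper_sn \<open>proper r\<close> R_proper by auto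
  have sd: "sn (r - R) = 0" using eq s by (simp add: sn_diff field_simps)
  have "\<not> proper (r - R)" using sd proper_sn[of "r - R"] by auto
  moreover have "\<not> proper (R - r)" using sd proper_sn[of "R - r"] sn_neg[of "r - R"] by auto
  moreover have "proper (r - R)" if "R < r" using proper_less[OF \<open>proper r\<close>] that R_pos by simp
  moreover have "proper (R - r)" if "r < R" using proper_less[OF R_proper] that z(2) by simp
  ultimately show ?thesis by (meson linorder_cases)
qed

lemma convex_body_gconvex:
  assumes "convex_body X K"
  shows "gconvex K" "closed K" "inner K \<noteq> {}" "mfd_top X frontier_of K = K - inner K"
proof -
  have K: "K \<subseteq> M" "compact K" "inner K \<noteq> {}" "\<And>x y. x \<in> K \<Longrightarrow> y \<in> K \<Longrightarrow> geo_segment X x y \<subseteq> K"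
    using assms by (auto simp: convex_body_def)
  show "gconvex K" unfolding gconvex_def using K(1,4) N_segment by blast
  show cl: "closed K" using K(2) by (rule compact_imp_closed)
  show "inner K \<noteq> {}" by fact
  have "closedin (top_of_set M) K" using cl K(1) by (rule closed_subset[rotated])
  then show "mfd_top X frontier_of K = K - inner K"
    by (simp add: frontier_of_def closure_of_closedin)
qed

lemma inscribed_estimate:
  assumes "bounded_region b M c1 c2 W N I"
  shows "\<exists>c\<in>M. \<exists>r. 0 < r \<and> r \<le> R \<and>
    (\<forall>x\<in>closure I - I. r \<le> d c x \<and> cs R / \<kappa> \<le> cs (R - r) * (cs (d c x) / \<kappa>))"
proof -
  interpret bounded_region b M c1 c2 W N I by fact
  obtain c m where ins: "inscribed c m" using inscribed_exists by blast
  have c: "c \<in> I" "c \<in> M" "0 < m" "\<And>p. p \<in> F \<Longrightarrow> m \<le> h c p"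
    "\<And>w. w \<in> tangent_vectors M c \<Longrightarrow> \<exists>P\<in>F. h c P = m \<and> 0 \<le> b w (P - c)"
    using ins I_M by (auto simp: inscribed_def)
  have FM: "x \<in> M" if "x \<in> F" for x using that cl_M by blast
  obtain P0 where P0: "P0 \<in> F" "h c P0 = m"
    using c(5)[OF tangent_vectors_M[OF c(2), of 0]] by (auto simp: b_linear)
  define r where "r = d c P0"
  have r_dom: "r \<in> dom" unfolding r_def using gdist_dom c(2) FM P0 by blast
  have m: "m = (1 - cs r) / \<kappa>" using P0(2) h_gdist[OF c(2) FM[OF P0(1)]] by (simp add: r_def)
  have r_near: "d c P = r" if "P \<in> F" "h c P = m" for P
    using h_eq_iff[OF c(2) FM[OF that(1)] r_dom] that(2) m by simp
  have "0 < r"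
    using m c(3) cs_0 dom_nonneg[OF r_dom] by (cases "r = 0") auto
  have r_prop: "proper r"
  proof (rule ccontr)
    assume "\<not> proper r"
    then have mx: "\<forall>s\<in>dom. s \<le> r" using \<open>0 < r\<close> by (auto simp: proper_def)
    obtain x where x: "x \<in> M" "x \<noteq> P0" "h P0 c \<le> h x c" using not_farthest[OF ins P0] by blast
    have "d x c \<le> r" using mx gdist_dom x(1) c(2) by blast
    then have "h x c \<le> m" using h_le_iff[OF x(1) c(2) r_dom] m by simp
    then have "h x c = m" using x(3) P0(2) h_commute[of P0 c] by simp
    then have "d x c = r" using h_eq_iff[OF x(1) c(2) r_dom] m by simp
    moreover have "cs r = - 1" using dom_max[OF r_dom \<open>0 < r\<close> mx] .
    ultimately have "\<kappa> * b x c = - 1" "\<kappa> * b P0 c = - 1"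
      using gdist_cs[OF x(1) c(2)] gdist_cs[OF c(2) FM[OF P0(1)]] sym[of P0 c] by (auto simp: r_def)
    then have "c = - x" "c = - P0" using antipodal(2) x(1) c(2) FM[OF P0(1)] by blast+
    then show False using x(2) by simp
  qed
  have sr: "0 < sn r" using proper_sn[OF r_prop] .
  have key: "angle (geodesic P T (2 * \<rho>)) P x < 0"
    if P: "P \<in> F" "h c P = m" and T: "unit_tangent P T" "c = geodesic P T r"
      and \<rho>: "R < \<rho>" "proper (2 * \<rho>)" and x: "x \<in> I" for P T \<rho> x
  proof -
    let ?A = "geodesic P T (2 * \<rho>)"
    have PM: "P \<in> M" using FM P by blast
    have AM: "?A \<in> M" using geodesic_mem[OF T(1)] .
    have s2: "0 < sn (2 * \<rho>)" using proper_sn[OF \<rho>(2)] .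
    have csr: "0 < cs \<rho>" using cs_pos[OF \<rho>(2)] .
    have \<rho>0: "0 < \<rho>" "proper \<rho>" using \<rho> R_pos proper_less[OF \<rho>(2), of \<rho>] by auto
    have eta: "cs (2 * \<rho>) / \<kappa> < cs (2 * R) / \<kappa>"
      using cs_mono[OF proper_dom[OF R] proper_dom[OF \<rho>(2)]] \<rho>(1) by simp
    have AP: "b ?A P = cs (2 * \<rho>) / \<kappa>" "b P ?A = cs (2 * \<rho>) / \<kappa>"
      using form_geodesic[OF T(1), of "2 * \<rho>" 0] sym[of P ?A] by (auto simp: geodesic_0)
    have hAP: "h ?A P = (1 - cs (2 * \<rho>)) / \<kappa>" using h_M[OF AM PM] AP by (simp add: diff_divide_distrib)
    have far: "c2 < h ?A P" using eta unfolding hAP c2_def by (simp add: diff_divide_distrib)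
    \<comment> \<open>The coefficient of \<open>A\<close> when \<open>c\<close> is expressed by
      \<open>P\<close> and \<open>A\<close>; with \<open>a\<close> for \<open>P\<close>, the trap
      assumption \<open>centre\<close> holds with s = a - q.\<close>
    define q where "q = sn r / sn (2 * \<rho>)"
    have q: "0 < q" using sr s2 by (simp add: q_def)
    define a where "a = cs r - q * cs (2 * \<rho>)"
    have cPA: "c = a *\<^sub>R P + q *\<^sub>R ?A"
      unfolding T(2) a_def q_def geodesic_def using s2 by (simp add: algebra_simps)
    have ang: "angle ?A P y = 1 / \<kappa> - b y ?A - b y P + b P ?A" if "y \<in> M" for y
      unfolding angle_def using M_form[OF that] sym[of ?A y] sym[of ?A P] by (simp add: b_linear)
    have centre: "h y c - h P c = (a - q) * h P y + q * angle ?A P y" if y: "y \<in> M" for y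
      unfolding ang[OF y] h_M[OF y c(2)] h_M[OF PM c(2)] h_M[OF PM y]
      unfolding cPA using M_form[OF PM] AP sym[of P y]
      by (simp add: b_linear algebra_simps diff_divide_distrib)
    \<comment> \<open>The geodesic midpoint of \<open>P\<close> and \<open>A\<close> serves as the
      point inside the sphere.\<close>
    have y0: "geodesic P T \<rho> \<in> M" "angle ?A P (geodesic P T \<rho>) < 0"
    proof -
      show gM: "geodesic P T \<rho> \<in> M" using geodesic_mem[OF T(1)] .
      have 1: "b (geodesic P T \<rho>) ?A = cs \<rho> / \<kappa>" "b (geodesic P T \<rho>) P = cs \<rho> / \<kappa>"
        using form_geodesic[OF T(1), of \<rho> "2 * \<rho>"] form_geodesic[OF T(1), of \<rho> 0] cs_neg[of \<rho>]
        by (auto simp: geodesic_0)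
      have "angle ?A P (geodesic P T \<rho>) = - (2 * cs \<rho>) * ((1 - cs \<rho>) / \<kappa>)"
        unfolding ang[OF gM] 1 AP cs_double using \<kappa>_nonzero by (simp add: field_simps power2_eq_square)
      moreover have "0 < (1 - cs \<rho>) / \<kappa>"
        using cs_mono[OF dom_0 proper_dom[OF \<rho>0(2)] \<rho>0(1)] cs_0 by (simp add: diff_divide_distrib)
      then have "- (2 * cs \<rho>) * ((1 - cs \<rho>) / \<kappa>) < 0" using csr by (intro mult_neg_pos) simp_all
      ultimately show "angle ?A P (geodesic P T \<rho>) < 0" by (simp only:)
    qed
    obtain e where e: "b e ?A = 0" "b e P = 0" "b e e = 1" using normal_exists[OF AM PM] by blast
    \<comment> \<open>The height over the linear midpoint of \<open>A\<close> and \<open>P\<close>,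
      in a direction orthogonal to both, at which \<open>x0\<close> lies on \<open>M\<close>; the
      same value makes \<open>angle\<close> vanish.\<close>
    define l where "l = sqrt (h ?A P / 2)"
    have hpos: "0 < h ?A P" using far c2_def cs_mono[OF dom_0 proper_dom[OF R]] R_pos cs_0
      by (simp add: c2_def diff_divide_distrib)
    have l: "0 < l" "l * l = h ?A P / 2" using hpos by (auto simp: l_def)
    define x0 where "x0 = (1/2) *\<^sub>R (?A + P) + l *\<^sub>R e"
    have be: "b ?A e = 0" "b P e = 0" using e sym[of ?A e] sym[of P e] by auto
    have x0x0: "b x0 x0 = 1 / \<kappa>"
      unfolding x0_def using e be M_form[OF AM] M_form[OF PM] AP l(2) hAP
      by (simp add: b_linear diff_divide_distrib) (simp add: field_simps \<kappa>_nonzero)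
    have x0b: "b x0 P = (1 / \<kappa> + b ?A P) / 2" "b x0 ?A = (1 / \<kappa> + b ?A P) / 2"
      unfolding x0_def using e be M_form[OF AM] M_form[OF PM] AP by (simp_all add: b_linear)
    have x0M: "x0 \<in> M"
    proof (rule M_I[OF PM])
      show "\<kappa> * b x0 x0 = 1" using x0x0 \<kappa>_nonzero by simp
      have "h ?A P = 1 / \<kappa> - b ?A P" using h_M[OF AM PM] .
      then show "b x0 P \<le> 1 / \<kappa>" unfolding x0b using hpos by simp
    qed
    have x0a: "angle ?A P x0 = 0" unfolding ang[OF x0M] x0b AP by simp
    have x0n: "x0 \<noteq> ?A" "x0 \<noteq> P"
    proof -
      have "b x0 e = l" unfolding x0_def using e be by (simp add: b_linear)
      then show "x0 \<noteq> ?A" "x0 \<noteq> P" using be l by auto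
    qed
    show ?thesis using contained[OF ins P AM far q centre y0 x0M x0a x0n x] .
  qed
  have toward: "\<exists>T. unit_tangent P T \<and> c = geodesic P T r" if P: "P \<in> F" "h c P = m" for P
    using geodesic_to[OF FM[OF P(1)] c(2)] gdist_commute[OF FM[OF P(1)] c(2)] r_near[OF P] r_prop by metis
  obtain u where u: "u \<in> dom" "2 * R < u" using R by (auto simp: proper_def)
  have good: "proper (2 * \<rho>)" if "R < \<rho>" "\<rho> < u / 2" for \<rho>
    using that u R_pos unfolding proper_def by (intro conjI bexI[of _ u]) auto
  have near_R: "\<forall>\<^sub>F \<rho> in at_right R. R < \<rho> \<and> \<rho> < u / 2"
    using eventually_at_right_real[of R "u/2"] u(2) by simp
  have rR: "r \<le> R"
  proof -
    obtain T where T: "unit_tangent P0 T" "c = geodesic P0 T r" using toward[OF P0] by blast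
    have "r \<le> \<rho>" if \<rho>: "R < \<rho>" "\<rho> < u / 2" for \<rho>
    proof (rule ccontr)
      \<comment> \<open>Then \<open>A\<close> would lie in the inscribed ball, hence in
        \<open>I\<close>, although its own \<open>angle\<close> is zero.\<close>
      assume n: "\<not> r \<le> \<rho>"
      let ?A = "geodesic P0 T (2 * \<rho>)"
      have AM: "?A \<in> M" using geodesic_mem[OF T(1)] .
      have "\<bar>2 * \<rho> - r\<bar> < r" using n \<rho>(1) R_pos by auto
      then have "cs r / \<kappa> < cs \<bar>2 * \<rho> - r\<bar> / \<kappa>"
        using cs_mono[OF dom_down[OF r_dom] r_dom] by simp
      moreover have "cs \<bar>2 * \<rho> - r\<bar> = cs (2 * \<rho> - r)" using cs_neg[of "2 * \<rho> - r"] by (simp add: abs_if)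
      moreover have "b ?A c = cs (2 * \<rho> - r) / \<kappa>" using form_geodesic[OF T(1)] T(2) by simp
      ultimately have "h ?A c < m" using h_M[OF AM c(2)] m by (simp add: diff_divide_distrib)
      then have "?A \<in> I" using ball_in_I[OF ins AM] by simp
      then have "angle ?A P0 ?A < 0" using key[OF P0 T \<rho>(1) good[OF \<rho>]] by blast
      then show False by (simp add: angle_eq h_commute)
    qed
    then have "\<forall>\<^sub>F \<rho> in at_right R. r \<le> \<rho>" using near_R by (auto elim: eventually_mono)
    then show ?thesis using tendsto_lowerbound[OF tendsto_ident_at, of r R "{R<..}"] by simp
  qed
  have "r \<le> d c x \<and> cs R / \<kappa> \<le> cs (R - r) * (cs (d c x) / \<kappa>)" if x: "x \<in> F" for x
  proof
    have xM: "x \<in> M" using FM x .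
    have "cs (d c x) / \<kappa> \<le> cs r / \<kappa>" using c(4)[OF x] h_gdist[OF c(2) xM] m by (simp add: diff_divide_distrib)
    then show "r \<le> d c x" using cs_le_iff[OF r_dom gdist_dom[OF c(2) xM]] by simp
    \<comment> \<open>The part of \<open>x\<close> tangent to \<open>M\<close> at \<open>c\<close>.
      The first-order condition for it gives a touching point seen from \<open>c\<close> at an angle
      of at most \<pi>/2 from \<open>x\<close>.\<close>
    define w where "w = x - (\<kappa> * b x c) *\<^sub>R c"
    have "b c w = 0" unfolding w_def using M_form[OF c(2)] sym[of c x] \<kappa>_nonzero by (simp add: b_linear)
    then obtain P where P: "P \<in> F" "h c P = m" "0 \<le> b w (P - c)"
      using c(5) tangent_vectors_M[OF c(2)] by blast
    have PM: "P \<in> M" using FM P by blast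
    obtain T where T: "unit_tangent P T" "c = geodesic P T r" using toward[OF P(1,2)] by blast
    have cP: "b c P = cs r / \<kappa>" using form_gdist[OF c(2) PM] r_near[OF P(1,2)] by simp
    have xP: "b x c * cs r \<le> b x P"
    proof -
      have "b w (P - c) = b x P - \<kappa> * b x c * b c P"
        unfolding w_def using M_form[OF c(2)] \<kappa>_nonzero by (simp add: b_linear algebra_simps)
      then show ?thesis using P(3) cP \<kappa>_nonzero by (simp add: mult.commute)
    qed
    let ?A = "\<lambda>\<rho>. geodesic P T (2 * \<rho>)"
    have ang: "angle (?A \<rho>) P y \<le> 0" if "y \<in> I" "R < \<rho> \<and> \<rho> < u / 2" for y \<rho>
      using key[OF P(1,2) T _ good] that by (simp add: less_imp_le)
    have "angle (?A R) P y \<le> 0" if y: "y \<in> I" for y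
    proof -
      have "isCont cs t" "isCont sn t" for t using cs_deriv sn_deriv DERIV_isCont by blast+
      then have "isCont (\<lambda>\<rho>. cs (2 * \<rho>)) R" "isCont (\<lambda>\<rho>. sn (2 * \<rho>)) R"
        using isCont_o2[where f = "\<lambda>\<rho>. 2 * \<rho>" and g = cs and a = R]
          isCont_o2[where f = "\<lambda>\<rho>. 2 * \<rho>" and g = sn and a = R] by auto
      then have "(?A \<longlongrightarrow> ?A R) (at R)"
        unfolding geodesic_def isCont_def by (intro tendsto_intros)
      then have lim: "(?A \<longlongrightarrow> ?A R) (at_right R)" by (rule filterlim_mono) (auto simp: at_le)
      then have "((\<lambda>\<rho>. angle (?A \<rho>) P y) \<longlongrightarrow> angle (?A R) P y) (at_right R)"
        unfolding angle_def by (intro tendsto_intros lim)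
      moreover have "\<forall>\<^sub>F \<rho> in at_right R. angle (?A \<rho>) P y \<le> 0"
        using near_R by eventually_elim (use ang[OF y] in blast)
      ultimately show ?thesis by (rule tendsto_upperbound) simp
    qed
    moreover have "closed {y. angle (?A R) P y \<le> 0}"
      unfolding angle_def by (rule closed_Collect_le) (auto intro!: continuous_intros)
    ultimately have "closure I \<subseteq> {y. angle (?A R) P y \<le> 0}" by (intro closure_minimal) auto
    then have ax: "angle (?A R) P x \<le> 0" using x by blast
    have AM: "?A R \<in> M" using geodesic_mem[OF T(1)] .
    have AP: "b (?A R) P = cs (2 * R) / \<kappa>" using form_geodesic[OF T(1), of "2 * R" 0] by (simp add: geodesic_0)
    have sum: "?A R + P = (2 * cs R) *\<^sub>R geodesic P T R"
      unfolding geodesic_def cs_double sn_double by (simp add: algebra_simps power2_eq_square)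
    have "angle (?A R) P x = 1 / \<kappa> - b x (?A R + P) + b (?A R) P"
      unfolding angle_def using M_form[OF xM] sym[of "?A R" x] by (simp add: b_linear)
    then have "(1 + cs (2 * R)) / \<kappa> \<le> 2 * cs R * b x (geodesic P T R)"
      using ax unfolding sum AP by (simp add: b_linear add_divide_distrib)
    then have "2 * cs R * (cs R / \<kappa>) \<le> 2 * cs R * b x (geodesic P T R)"
      unfolding cs_double by (simp add: power2_eq_square)
    then have zx: "cs R / \<kappa> \<le> b x (geodesic P T R)"
      by (rule mult_left_le_imp_le) (use cs_R_pos in simp)
    \<comment> \<open>The centre of the ball of radius R is a combination of \<open>P\<close> and
      \<open>c\<close>. Since r \<le> R its weight at \<open>P\<close> is nonpositive, so the lower
      bound on \<open>b x P\<close> becomes an upper bound below.\<close>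
    have z: "geodesic P T R = (sn (r - R) / sn r) *\<^sub>R P + (sn R / sn r) *\<^sub>R c"
    proof -
      have "sn r *\<^sub>R geodesic P T R = sn (r - R) *\<^sub>R P + sn R *\<^sub>R c"
        unfolding T(2) geodesic_def sn_diff by (simp add: algebra_simps)
      then have "(1 / sn r) *\<^sub>R (sn r *\<^sub>R geodesic P T R) = (1 / sn r) *\<^sub>R (sn (r - R) *\<^sub>R P + sn R *\<^sub>R c)" by simp
      then show ?thesis using sr by (simp add: scaleR_right_distrib)
    qed
    have neg: "sn (r - R) \<le> 0"
    proof (cases "r = R")
      case True then show ?thesis using sn_0 by simp
    next
      case False
      then have "proper (R - r)" using proper_less[OF R_proper] rR \<open>0 < r\<close> by simp
      then show ?thesis using proper_sn[of "R - r"] sn_neg[of "R - r"] by simp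
    qed
    have "b x (geodesic P T R) = sn (r - R) / sn r * b x P + sn R / sn r * b x c"
      unfolding z by (simp add: b_linear)
    also have "\<dots> \<le> sn (r - R) / sn r * (b x c * cs r) + sn R / sn r * b x c"
      using mult_left_mono_neg[OF xP, of "sn (r - R) / sn r"] neg sr by (simp add: divide_le_0_iff)
    also have "\<dots> = b x c * ((sn (r - R) * cs r + sn R) / sn r)"
      by (simp add: add_divide_distrib algebra_simps)
    also have "sn (r - R) * cs r + sn R = sn r * cs (R - r)"
      using sn_diff[of r "r - R"] cs_neg[of "r - R"] by simp
    finally have "b x (geodesic P T R) \<le> b x c * cs (R - r)" using sr by simp
    moreover have "b x c = cs (d c x) / \<kappa>" using form_gdist[OF c(2) xM] sym[of x c] by simp
    ultimately show "cs R / \<kappa> \<le> cs (R - r) * (cs (d c x) / \<kappa>)" using zx by (simp add: mult.commute)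
  qed
  then show ?thesis using c(2) \<open>0 < r\<close> rR by blast
qed

end

lemma convex_body_frontier:
  assumes "convex_body X K"
  shows "K \<subseteq> pts X" "closed K" "mfd_top X interior_of K \<noteq> {}"
    "mfd_top X frontier_of K = K - mfd_top X interior_of K"
proof -
  show K: "K \<subseteq> pts X" "closed K" "mfd_top X interior_of K \<noteq> {}"
    using assms compact_imp_closed by (auto simp: convex_body_def)
  have "closedin (mfd_top X) K" using K by (simp add: closed_subset)
  then show "mfd_top X frontier_of K = K - mfd_top X interior_of K"
    by (simp add: frontier_of_def closure_of_closedin)
qed

lemma compact_domain_frontier:
  assumes "compact_domain X \<Omega>"
  shows "compact (mfd_top X frontier_of \<Omega>)" "mfd_top X frontier_of \<Omega> \<subseteq> pts X" "pts X \<noteq> {}"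
proof -
  have \<Omega>: "\<Omega> \<subseteq> pts X" "compact \<Omega>" "mfd_top X interior_of \<Omega> \<noteq> {}"
    using assms by (auto simp: compact_domain_def)
  have "closedin (mfd_top X) \<Omega>" by (rule closed_subset[OF \<Omega>(1) compact_imp_closed[OF \<Omega>(2)]])
  then have S: "mfd_top X frontier_of \<Omega> = \<Omega> - mfd_top X interior_of \<Omega>"
    by (simp add: frontier_of_def closure_of_closedin)
  obtain T where T: "open T" "mfd_top X interior_of \<Omega> = pts X \<inter> T"
    using openin_interior_of[of "mfd_top X" \<Omega>] unfolding openin_open by blast
  have "mfd_top X frontier_of \<Omega> = \<Omega> - T" unfolding S T(2) using \<Omega>(1) by auto
  then show "compact (mfd_top X frontier_of \<Omega>)" using compact_diff[OF \<Omega>(2) T(1)] by simp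
  show "mfd_top X frontier_of \<Omega> \<subseteq> pts X" unfolding S using \<Omega>(1) by auto
  show "pts X \<noteq> {}" using \<Omega>(3) T(2) by auto
qed

text \<open>If the domain is on the concave side its complement takes over, which needs a compact
  \<open>M\<close>. Otherwise \<open>far\<close> provides a farthest-point argument that the domain
  is on the convex side.\<close>

lemma (in model_space) region_of_domain:
  assumes X: "form X = b" "pts X = M"
    and body: "\<And>K. convex_body X K \<Longrightarrow> gconvex K"
    and sphere: "\<And>z r p. sphere_of_curvature X \<mu> z r \<Longrightarrow> p \<in> geo_sphere X z r \<Longrightarrow>
      z \<in> M \<and> h p z = c1 \<and> (\<forall>x\<in>geo_cball X z r. h x z \<le> c1)"
    and domain: "compact_domain X \<Omega>" and S: "S = mfd_top X frontier_of \<Omega>" "S \<noteq> {}"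
    and convex: "lambda_convex X \<mu> S"
    and far: "\<not> compact M \<Longrightarrow> \<exists>p\<in>M. \<forall>Q\<in>M. \<exists>e. \<forall>\<^sub>F t in at 0.
      Q + t *\<^sub>R e \<in> W \<and> h Q p < h (N (Q + t *\<^sub>R e)) p"
  shows "\<exists>I. bounded_region b M c1 c2 W N I \<and> closure I - I = S"
proof -
  let ?E1 = "inner \<Omega>" and ?E2 = "M - \<Omega>"
  have \<Omega>: "\<Omega> \<subseteq> M" "compact \<Omega>" "?E1 \<noteq> {}" "top_of_set M closure_of ?E1 = \<Omega>"
    using domain X by (auto simp: compact_domain_def)
  have cl\<Omega>: "closed \<Omega>" using \<Omega>(2) by (rule compact_imp_closed)
  then have "closedin (top_of_set M) \<Omega>" using \<Omega>(1) by (simp add: closed_subset)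
  then have S_eq: "S = \<Omega> - ?E1" unfolding S(1) X by (simp add: frontier_of_def closure_of_closedin)
  have E1_sub: "?E1 \<subseteq> \<Omega>" by (rule inner_sub)
  have sides: "M = ?E1 \<union> ?E2 \<union> S" "?E1 \<inter> ?E2 = {}" "?E1 \<inter> S = {}" "?E2 \<inter> S = {}"
    using \<Omega>(1) S_eq E1_sub by auto
  have open1: "openin (top_of_set M) ?E1" by simp
  have open2: "openin (top_of_set M) ?E2"
    using \<open>closedin (top_of_set M) \<Omega>\<close> by (simp add: closedin_def)
  have S1: "S \<subseteq> closure ?E1"
  proof -
    have "M \<inter> ?E1 = ?E1" using E1_sub \<Omega>(1) by auto
    then have "top_of_set M closure_of ?E1 \<subseteq> closure ?E1" by (simp add: closure_of_subtopology)
    then show ?thesis using S_eq \<Omega>(4) by auto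
  qed
  have S2: "S \<subseteq> closure ?E2"
  proof
    fix x assume x: "x \<in> S"
    show "x \<in> closure ?E2"
    proof (rule ccontr)
      assume n: "x \<notin> closure ?E2"
      have "M \<inter> - closure ?E2 \<subseteq> \<Omega>" using closure_subset[of ?E2] by auto
      then have "x \<in> ?E1" unfolding inner_iff using x n sides(1)
        by (intro conjI exI[of _ "- closure ?E2"]) auto
      then show False using x sides(3) by auto
    qed
  qed
  have lc: "connected S"
    "\<And>P. P \<in> S \<Longrightarrow> \<exists>U K. openin (mfd_top X) U \<and> P \<in> U \<and> convex_body X K \<and> S \<inter> U = (mfd_top X frontier_of K) \<inter> U"
    "\<And>P. P \<in> S \<Longrightarrow> \<exists>z r. sphere_of_curvature X \<mu> z r \<and> P \<in> geo_sphere X z r \<and>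
        (\<exists>U. openin (mfd_top X) U \<and> P \<in> U \<and> S \<inter> U \<subseteq> geo_cball X z r)"
    using convex by (auto simp: lambda_convex_def locally_convex_hypersurface_def)
  interpret two_sides b M c1 c2 W N S ?E1 ?E2
  proof
    show "\<exists>U K. open U \<and> P \<in> U \<and> gconvex K \<and> closed K \<and> inner K \<noteq> {} \<and> S \<inter> U = (K - inner K) \<inter> U"
      if P: "P \<in> S" for P
    proof -
      obtain U K where UK: "openin (mfd_top X) U" "P \<in> U" "convex_body X K"
        "S \<inter> U = (mfd_top X frontier_of K) \<inter> U" using lc(2)[OF P] by metis
      obtain T where T: "open T" "U = M \<inter> T" using UK(1) X by (auto simp: openin_open)
      have K: "K \<subseteq> M" "closed K" "inner K \<noteq> {}" "mfd_top X frontier_of K = K - inner K"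
        using convex_body_frontier[OF UK(3)] X by auto
      have "S \<inter> T = S \<inter> U" using T(2) sides(1) by auto
      also have "\<dots> = (K - inner K) \<inter> U" by (simp only: UK(4) K(4))
      also have "\<dots> = (K - inner K) \<inter> T" unfolding T(2) using K(1) by blast
      finally have eq: "S \<inter> T = (K - inner K) \<inter> T" .
      have "P \<in> T" using UK(2) T(2) by simp
      then show ?thesis
        by (intro exI[of _ T] exI[of _ K] conjI T(1) body[OF UK(3)] K(2,3) eq)
    qed
    show "\<exists>z. supported S Q z" if Q: "Q \<in> S" for Q
    proof -
      obtain z r U where zr: "sphere_of_curvature X \<mu> z r" "Q \<in> geo_sphere X z r"
        "openin (mfd_top X) U" "Q \<in> U" "S \<inter> U \<subseteq> geo_cball X z r" using lc(3)[OF Q] by metis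
      obtain T where T: "open T" "U = M \<inter> T" using zr(3) X by (auto simp: openin_open)
      have z: "z \<in> M" "h Q z = c1" "\<forall>x\<in>geo_cball X z r. h x z \<le> c1" using sphere[OF zr(1,2)] by auto
      have "S \<inter> T \<subseteq> geo_cball X z r" using zr(5) T(2) sides(1) by auto
      then have "\<forall>x\<in>S \<inter> T. h x z \<le> c1" using z(3) by (meson subsetD)
      moreover have "Q \<in> T" using zr(4) T(2) by simp
      ultimately have "supported S Q z" unfolding supported_def
        by (intro conjI exI[of _ T] z(1,2) T(1))
      then show ?thesis by (intro exI)
    qed
  qed (use open1 open2 sides S1 S2 lc(1) in auto)
  have build: ?thesis if E: "openin (top_of_set M) E" "E \<inter> S = {}" "M \<inter> closure E \<subseteq> E \<union> S"
    "\<forall>P\<in>S. good S E P" "compact (E \<union> S)" for E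
  proof -
    obtain I where I: "openin (top_of_set M) I" "connected I" "I \<subseteq> E" "I \<noteq> {}" "closure I - I = S"
      "\<And>Q. Q \<in> S \<Longrightarrow> \<exists>z. supported I Q z" using region[OF E(1-4) S(2)] by metis
    have "closure I \<subseteq> E \<union> S" using I(3,5) by auto
    then have "compact (closure I)"
      using E(5) by (metis closed_closure compact_Int_closed inf.absorb_iff2)
    then have "bounded_region b M c1 c2 W N I"
      using I S(2) by unfold_locales auto
    then show ?thesis using I(5) by blast
  qed
  have c1: "M \<inter> closure ?E1 \<subseteq> ?E1 \<union> S"
    using closure_minimal[OF E1_sub cl\<Omega>] S_eq by auto
  have D1: "?E1 \<union> S = \<Omega>" using S_eq E1_sub by auto
  show ?thesis
  proof (cases "\<forall>P\<in>S. good S ?E1 P")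
    case True
    then show ?thesis using build[OF open1 sides(3) c1] D1 \<Omega>(2) by simp
  next
    case False
    have cM: "compact M"
    proof (rule ccontr)
      assume "\<not> compact M"
      from far[OF this] obtain p where p: "p \<in> M" "\<forall>Q\<in>M. \<exists>e. \<forall>\<^sub>F t in at 0.
        Q + t *\<^sub>R e \<in> W \<and> h Q p < h (N (Q + t *\<^sub>R e)) p" by (elim bexE)
      have "compact (?E1 \<union> S)" unfolding D1 by (rule \<Omega>(2))
      then have "\<forall>P\<in>S. good S ?E1 P"
        by (rule not_good_outside[OF _ \<Omega>(3) S(2) p(1) p(2)[rule_format]])
      then show False using False by contradiction
    qed
    have g: "\<forall>P\<in>S. good S ?E2 P" using good_global False by simp
    obtain T where T: "open T" "?E1 = M \<inter> T" using inner_open by blast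
    have "closure ?E2 \<subseteq> M" using closed_M by (simp add: closure_minimal)
    moreover have "closure ?E2 \<inter> T = {}"
    proof -
      have "T \<inter> ?E2 = {}" using T(2) sides(2) by auto
      then show ?thesis using open_Int_closure_eq_empty[OF T(1), of ?E2] by auto
    qed
    ultimately have c2: "M \<inter> closure ?E2 \<subseteq> ?E2 \<union> S" using T(2) sides(1) by auto
    have "?E2 \<union> S = M - T" using T(2) sides by auto
    then have "compact (?E2 \<union> S)" using compact_diff[OF cM T(1)] by simp
    then show ?thesis using build[OF open2 sides(4) c2 g] by simp
  qed
qed

text \<open>The alternative in the last assumption covers both geometries: the round sphere is
  compact, and in hyperbolic space the sign condition makes \<open>outside_tangent_ball\<close>
  valid at every distance.\<close>

lemma (in quadric_radius) hypersurface_estimate: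
  assumes domain: "compact_domain X \<Omega>" and S: "S = mfd_top X frontier_of \<Omega>" "S \<noteq> {}"
    and convex: "lambda_convex X (cs R / sn R) S"
    and compact_or_far: "compact M \<or> (\<forall>x\<in>M. \<forall>y\<in>M. 0 < \<kappa> * b x y)"
  shows "\<exists>c\<in>M. \<exists>r. 0 < r \<and> r \<le> R \<and>
    (\<forall>x\<in>S. r \<le> d c x \<and> cs R / \<kappa> \<le> cs (R - r) * (cs (d c x) / \<kappa>))"
proof -
  have "\<exists>I. bounded_region b M c1 c2 W N I \<and> closure I - I = S"
  proof (rule region_of_domain[OF refl refl _ _ domain S convex])
    show "gconvex K" if "convex_body X K" for K using convex_body_gconvex(1)[OF that] .
    show "z \<in> M \<and> h p z = c1 \<and> (\<forall>x\<in>geo_cball X z r. h x z \<le> c1)"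
      if s: "sphere_of_curvature X (cs R / sn R) z r" "p \<in> geo_sphere X z r" for z r p
    proof -
      have r: "r = R" using sphere_radius[OF s] .
      have z: "z \<in> M" using s by (simp add: sphere_of_curvature_def)
      have RD: "R \<in> dom" using proper_dom[OF R_proper] .
      have p: "p \<in> M" "d z p = R" using s(2) r by (auto simp: geo_sphere_def)
      have "h z p = c1" using h_eq_iff[OF z p(1) RD] p(2) by (simp add: c1_def)
      moreover have "h x z \<le> c1" if "x \<in> geo_cball X z r" for x
        using that r h_le_iff[OF z _ RD, of x] h_commute[of x z] by (simp add: c1_def geo_cball_def)
      ultimately show ?thesis using z h_commute[of p z] by simp
    qed
    assume nc: "\<not> compact M"
    obtain p where p: "p \<in> M" using compact_domain_frontier(3)[OF domain] by auto
    have "\<exists>e. \<forall>\<^sub>F t in at 0. Q + t *\<^sub>R e \<in> W \<and> h Q p < h (N (Q + t *\<^sub>R e)) p" if "Q \<in> M" for Q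
      using outside_tangent_ball[OF that p] compact_or_far nc that p by simp
    then show "\<exists>p\<in>M. \<forall>Q\<in>M. \<exists>e. \<forall>\<^sub>F t in at 0. Q + t *\<^sub>R e \<in> W \<and> h Q p < h (N (Q + t *\<^sub>R e)) p"
      using p by (intro bexI[of _ p] ballI)
  qed
  then obtain I where "bounded_region b M c1 c2 W N I" "closure I - I = S" by blast
  then show ?thesis using inscribed_estimate by metis
qed

text \<open>The farthest point \<open>x\<close> is part of the data because a layer must have a
  nonempty outer sphere.\<close>

lemma spherical_layerI:
  assumes "c \<in> pts X" "S \<subseteq> pts X" "0 \<le> r" "x \<in> S" "\<And>y. y \<in> S \<Longrightarrow> r \<le> gdist X c y"
    "\<And>y. y \<in> S \<Longrightarrow> gdist X c y \<le> gdist X c x"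
  shows "\<exists>L. spherical_layer X L (gdist X c x - r) \<and> S \<subseteq> L"
proof (intro exI conjI)
  let ?L = "{y \<in> pts X. r \<le> gdist X c y \<and> gdist X c y \<le> gdist X c x}"
  show "spherical_layer X ?L (gdist X c x - r)" unfolding spherical_layer_def
    using assms by (intro exI[of _ c] exI[of _ r] exI[of _ "gdist X c x"]) (auto simp: geo_sphere_def)
  show "S \<subseteq> ?L" using assms by auto
qed

lemma degenerate_layer:
  assumes "z \<in> pts X" "gdist X z z = 0"
  shows "\<exists>L. spherical_layer X L 0"
  using spherical_layerI[OF assms(1), of "{z}" 0 z] assms by auto

text \<open>\<open>width\<close> is applied with t = R - r and s the largest distance from the
  centre, so that its conclusion reads s - r \<le> w.\<close>

lemma (in quadric_radius) hypersurface_layer: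
  assumes domain: "compact_domain X \<Omega>" and S: "S = mfd_top X frontier_of \<Omega>"
    and convex: "lambda_convex X (cs R / sn R) S"
    and compact_or_far: "compact M \<or> (\<forall>x\<in>M. \<forall>y\<in>M. 0 < \<kappa> * b x y)"
    and width: "\<And>t s. 0 \<le> t \<Longrightarrow> t \<le> R \<Longrightarrow> s \<in> dom \<Longrightarrow> cs R / \<kappa> \<le> cs t * (cs s / \<kappa>) \<Longrightarrow> s + t \<le> w + R"
  shows "\<exists>L e. spherical_layer X L e \<and> S \<subseteq> L \<and> e \<le> w"
proof (cases "S = {}")
  \<comment> \<open>An empty frontier occurs for the whole round sphere. The bound must still be
    nonnegative, which is \<open>width\<close> with t = R and s = 0.\<close>
  case True
  obtain z where z: "z \<in> M" using compact_domain_frontier(3)[OF domain] by auto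
  have "0 \<le> w" using width[of R 0] R_pos dom_0 cs_0 by simp
  then show ?thesis using degenerate_layer[OF z gdist_self[OF z]] True by auto
next
  case False
  obtain c r where c: "c \<in> M" "0 < r" "r \<le> R"
    "\<And>x. x \<in> S \<Longrightarrow> r \<le> d c x \<and> cs R / \<kappa> \<le> cs (R - r) * (cs (d c x) / \<kappa>)"
    using hypersurface_estimate[OF domain S False convex compact_or_far] by metis
  have SM: "S \<subseteq> M" "compact S" using compact_domain_frontier[OF domain] S by auto
  have "continuous_on S (h c)" by (intro continuous_intros)
  then obtain x where x: "x \<in> S" "\<And>y. y \<in> S \<Longrightarrow> h c y \<le> h c x"
    using continuous_attains_sup[OF SM(2) False] by metis
  have xM: "x \<in> M" using x SM by auto
  have far: "d c y \<le> d c x" if y: "y \<in> S" for y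
  proof -
    have "y \<in> M" using y SM by auto
    then show ?thesis
      using h_le_iff[OF c(1), of y "d c x"] gdist_dom[OF c(1) xM] x(2)[OF y] h_gdist[OF c(1) xM] by simp
  qed
  obtain L where L: "spherical_layer X L (d c x - r)" "S \<subseteq> L"
    using spherical_layerI[OF c(1) SM(1) less_imp_le[OF c(2)] x(1)] c(4) far by metis
  have "d c x + (R - r) \<le> w + R"
    using width[of "R - r" "d c x"] c(2,3) c(4)[OF x(1)] gdist_dom[OF c(1) xM] by simp
  then show ?thesis using L by (intro exI[of _ L] exI[of _ "d c x - r"]) simp
qed

section \<open>Spherical and hyperbolic space\<close>

lemma unit_orthogonal_pair:
  fixes x y :: "'v::euclidean_space"
  assumes "3 \<le> DIM('v)"
  obtains e where "e \<noteq> 0" "e \<bullet> x = 0" "e \<bullet> y = 0"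
proof -
  have "dim {x, y} \<le> card {x, y}" by (rule dim_le_card') simp
  also have "card {x, y} \<le> 2" by (simp add: card_insert_if)
  finally have "dim {x, y} < DIM('v)" using assms by simp
  then obtain e where e: "e \<noteq> 0" "\<And>v. v \<in> span {x, y} \<Longrightarrow> orthogonal e v"
    using orthogonal_to_subspace_exists by blast
  have "x \<in> span {x, y}" "y \<in> span {x, y}" by (auto intro: span_base)
  then show thesis using that e unfolding orthogonal_def by blast
qed

lemma spherical_quadric:
  assumes k: "0 < (k::real)" and dim: "2 \<le> DIM('a::euclidean_space)"
  shows "quadric (spherical_form k :: ('a \<times> real) space_form) (k\<^sup>2) (- {0})
    (\<lambda>t. cos (k * t)) (\<lambda>t. sin (k * t) / k) {0..pi / k}"
proof -
  let ?X = "spherical_form k :: ('a \<times> real) space_form"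
  have form: "form ?X = (\<bullet>)" and pts: "pts ?X = {x. x \<bullet> x = 1 / k\<^sup>2}"
    and gd: "gdist ?X = (\<lambda>x y. arccos (k\<^sup>2 * (x \<bullet> y)) / k)" by (simp_all add: spherical_form_def)
  have k2: "k\<^sup>2 > 0" using k by simp
  have nn: "x \<bullet> y \<le> 1 / k\<^sup>2" "- 1 / k\<^sup>2 \<le> x \<bullet> y" "x \<noteq> y \<Longrightarrow> x \<bullet> y < 1 / k\<^sup>2" "x \<bullet> y = - 1 / k\<^sup>2 \<Longrightarrow> y = - x"
    if "x \<bullet> x = 1 / k\<^sup>2" "y \<bullet> y = 1 / k\<^sup>2" for x y :: "'a \<times> real"
  proof -
    have m: "(x - y) \<bullet> (x - y) = 2 / k\<^sup>2 - 2 * (x \<bullet> y)" and p: "(x + y) \<bullet> (x + y) = 2 / k\<^sup>2 + 2 * (x \<bullet> y)"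
      using that by (simp_all add: inner_diff_left inner_diff_right inner_add_left inner_add_right inner_commute[of y x])
    show "x \<bullet> y \<le> 1 / k\<^sup>2" using inner_ge_zero[of "x - y"] unfolding m by simp
    show "- 1 / k\<^sup>2 \<le> x \<bullet> y" using inner_ge_zero[of "x + y"] unfolding p by simp
    show "x \<bullet> y < 1 / k\<^sup>2" if "x \<noteq> y" using inner_gt_zero_iff[of "x - y"] that unfolding m by simp
    show "y = - x" if "x \<bullet> y = - 1 / k\<^sup>2"
    proof -
      have "(x + y) \<bullet> (x + y) = 0" unfolding p that by simp
      then have "x + y = 0" by simp
      then show ?thesis by (simp add: eq_neg_iff_add_eq_0 add.commute)
    qed
  qed
  have scaled: "- 1 \<le> k\<^sup>2 * (x \<bullet> y)" "k\<^sup>2 * (x \<bullet> y) \<le> 1" if "x \<in> pts ?X" "y \<in> pts ?X" for x y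
    using nn(1,2)[of x y] that k2 unfolding pts by (simp_all add: field_simps)
  show ?thesis
  proof
    show "bilinear (form ?X)" unfolding form by (simp add: bilinear_conv_bounded_bilinear bounded_bilinear_inner)
    show "form ?X x y = form ?X y x" for x y unfolding form by (rule inner_commute)
    show "k\<^sup>2 \<noteq> 0" using k by simp
    show "open (- {0 :: 'a \<times> real})" by (rule open_Compl) simp
    show "0 < k\<^sup>2 * form ?X v v" if "v \<in> - {0}" for v unfolding form using that k2 by simp
    show "t *\<^sub>R v \<in> - {0}" if "v \<in> - {0}" "0 < t" for v :: "'a \<times> real" and t using that by simp
    show "(1 - t) *\<^sub>R u + t *\<^sub>R v \<in> - {0}"
      if "u \<in> - {0}" "v \<in> - {0}" "0 \<le> t" "t \<le> 1"
        "0 < k\<^sup>2 * form ?X ((1 - t) *\<^sub>R u + t *\<^sub>R v) ((1 - t) *\<^sub>R u + t *\<^sub>R v)" for u v t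
      using that(5) unfolding form by auto
    show "pts ?X = {x \<in> - {0}. k\<^sup>2 * form ?X x x = 1}"
      unfolding pts form using k2 by (auto simp: field_simps)
    show "closed (pts ?X)" unfolding pts by (intro closed_Collect_eq continuous_intros)
    show "v \<in> - {0}" if "k\<^sup>2 * form ?X v v = 1" for v using that unfolding form by auto
    show "form ?X x y < 1 / k\<^sup>2" if "x \<in> pts ?X" "y \<in> pts ?X" "x \<noteq> y" for x y
      using nn(3) that unfolding pts form by simp
    show "- 1 \<le> k\<^sup>2 * form ?X x y" if "x \<in> pts ?X" "y \<in> pts ?X" for x y
      using scaled(1)[OF that] unfolding form .
    show "y = - x" if "x \<in> pts ?X" "y \<in> pts ?X" "k\<^sup>2 * form ?X x y = - 1" for x y
      using nn(4)[of x y] that k2 unfolding pts form by (simp add: field_simps)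
    show "0 < form ?X w w" if "w \<noteq> 0" for w unfolding form using that by simp
    show "\<exists>e. form ?X e x = 0 \<and> form ?X e y = 0 \<and> form ?X e e = 1" for x y
    proof -
      obtain e :: "'a \<times> real" where e: "e \<noteq> 0" "e \<bullet> x = 0" "e \<bullet> y = 0"
        using unit_orthogonal_pair[of x y] dim by auto
      then show ?thesis unfolding form
        by (intro exI[of _ "(1 / norm e) *\<^sub>R e"]) (simp add: dot_square_norm power2_eq_square)
    qed
    show "cos (k * 0) = 1" "sin (k * 0) / k = 0" by simp_all
    show "cos (k * (s - t)) = cos (k * s) * cos (k * t) + k\<^sup>2 * (sin (k * s) / k) * (sin (k * t) / k)" for s t
      using k by (simp add: right_diff_distrib cos_diff power2_eq_square)
    show "sin (k * (s - t)) / k = sin (k * s) / k * cos (k * t) - cos (k * s) * (sin (k * t) / k)" for s t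
      by (simp add: right_diff_distrib sin_diff diff_divide_distrib)
    show "((\<lambda>t. cos (k * t)) has_real_derivative - k\<^sup>2 * (sin (k * t) / k)) (at t)" for t
      using k by (auto intro!: derivative_eq_intros simp: power2_eq_square)
    show "((\<lambda>t. sin (k * t) / k) has_real_derivative cos (k * t)) (at t)" for t
      using k by (auto intro!: derivative_eq_intros)
    show "0 \<in> {0..pi / k}" using k by simp
    show "0 \<le> t" if "t \<in> {0..pi / k}" for t using that by simp
    show "s \<in> {0..pi / k}" if "t \<in> {0..pi / k}" "0 \<le> s" "s \<le> t" for s t using that by simp
    show "cos (k * t) / k\<^sup>2 < cos (k * s) / k\<^sup>2" if "s \<in> {0..pi / k}" "t \<in> {0..pi / k}" "s < t" for s t
      using that k k2 by (intro divide_strict_right_mono cos_monotone_0_pi) (auto simp: field_simps)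
    show "0 < sin (k * s) / k" if "0 < s" "s < t" "t \<in> {0..pi / k}" for s t
    proof -
      have "k * s < k * t" "k * t \<le> pi" using that k by (auto simp: field_simps)
      then have "k * s < pi" by linarith
      then have "0 < sin (k * s)" using that k by (intro sin_gt_zero) auto
      then show ?thesis using k by simp
    qed
    show "cos (k * t) = - 1" if "t \<in> {0..pi / k}" "0 < t" "\<forall>s\<in>{0..pi / k}. s \<le> t" for t
    proof -
      have "pi / k \<le> t" using that(3) k by simp
      then have "t = pi / k" using that(1) by simp
      then show ?thesis using k by simp
    qed
    show "gdist ?X x y \<in> {0..pi / k} \<and> cos (k * gdist ?X x y) = k\<^sup>2 * form ?X x y"
      if "x \<in> pts ?X" "y \<in> pts ?X" for x y
      using scaled[OF that] k unfolding gd form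
      by (simp add: cos_arccos arccos_lbound arccos_ubound divide_right_mono)
  qed
qed

text \<open>The product of cosines is the mean of cos (a - c) and cos (a + c), hence at most the
  squared cosine of half the sum.\<close>

lemma cos_product_width:
  fixes a c \<theta> :: real
  assumes "0 \<le> a" "a \<le> \<theta>" "0 < \<theta>" "\<theta> < pi / 2" "0 \<le> c" "c \<le> pi" "cos \<theta> \<le> cos a * cos c"
  shows "a + c \<le> 2 * arccos (sqrt (cos \<theta>))"
proof -
  have cp: "0 < cos \<theta>" "0 < cos a" using assms by (auto intro!: cos_gt_zero_pi)
  have "0 < cos c" using assms(7) cp by (smt (verit) mult_nonneg_nonpos)
  then have c: "c < pi / 2" using assms(5,6) cos_monotone_0_pi_le[of "pi/2" c] by fastforce
  let ?m = "(a + c) / 2"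
  have m: "0 \<le> ?m" "?m < pi / 2" using assms c by auto
  have "cos \<theta> \<le> (cos (a - c) + cos (a + c)) / 2" using assms(7) by (simp add: cos_times_cos)
  also have "\<dots> \<le> (1 + cos (a + c)) / 2" by simp
  also have "a + c = 2 * ?m" by simp
  also have "(1 + cos (2 * ?m)) / 2 = (cos ?m)\<^sup>2" by (subst cos_double_cos) simp
  finally have "sqrt (cos \<theta>) \<le> cos ?m" using m by (intro real_le_lsqrt) (auto intro!: cos_ge_zero)
  then have "arccos (cos ?m) \<le> arccos (sqrt (cos \<theta>))"
    using real_sqrt_ge_zero[OF less_imp_le[OF cp(1)]] 
    by (intro arccos_le_arccos cos_le_one) linarith+
  then show ?thesis using m by (simp add: arccos_cos)
qed

lemma spherical_case:
  assumes k: "0 < k1" "0 < k0" and R: "R = 1 / k1 * arccot (k0 / k1)" and dim: "2 \<le> DIM('a::euclidean_space)"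
    and \<Omega>: "compact_domain (spherical_form k1) (\<Omega> :: ('a \<times> real) set)"
    and convex: "lambda_convex (spherical_form k1) k0 (mfd_top (spherical_form k1) frontier_of \<Omega>)"
  shows "\<exists>L d. spherical_layer (spherical_form k1) L d \<and> mfd_top (spherical_form k1) frontier_of \<Omega> \<subseteq> L \<and>
    d \<le> 2 / k1 * arccos (sqrt (cos (k1 * R))) - R"
proof -
  let ?X = "spherical_form k1 :: ('a \<times> real) space_form"
  interpret quadric ?X "k1\<^sup>2" "- {0}" "\<lambda>t. cos (k1 * t)" "\<lambda>t. sin (k1 * t) / k1" "{0..pi / k1}"
    using spherical_quadric[OF k(1) dim] .
  have \<theta>: "k1 * R = arccot (k0 / k1)" using R k by simp
  have a: "0 < arctan (k0 / k1)" using k by simp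
  have \<theta>b: "0 < k1 * R" "k1 * R < pi / 2" unfolding \<theta> arccot_def using a arctan_ubound[of "k0/k1"] by auto
  have curv: "cos (k1 * R) / (sin (k1 * R) / k1) = k0"
  proof -
    have "cos (k1 * R) / sin (k1 * R) = tan (arctan (k0 / k1))"
      unfolding \<theta> arccot_def tan_def by (simp add: cos_diff sin_diff)
    then have "cos (k1 * R) / sin (k1 * R) = k0 / k1" by (simp only: tan_arctan)
    then show ?thesis using k by (simp add: field_simps)
  qed
  interpret quadric_radius ?X "k1\<^sup>2" "- {0}" "\<lambda>t. cos (k1 * t)" "\<lambda>t. sin (k1 * t) / k1" "{0..pi / k1}" R
  proof
    have "2 * R < pi / k1" "0 < R" using \<theta>b k by (auto simp: field_simps zero_less_mult_iff)
    then show "proper (2 * R)" unfolding proper_def using k by (intro conjI bexI[of _ "pi / k1"]) auto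
  qed
  have "compact (pts ?X)"
  proof -
    have "x \<bullet> x = 1 / k1\<^sup>2 \<longleftrightarrow> norm x = 1 / k1" for x :: "'a \<times> real"
      using k power2_eq_iff_nonneg[of "norm x" "1 / k1"]
      by (simp add: power2_norm_eq_inner power_divide)
    then have "pts ?X = sphere 0 (1 / k1)" by (auto simp: spherical_form_def)
    then show ?thesis by simp
  qed
  moreover have "s + t \<le> (2 / k1 * arccos (sqrt (cos (k1 * R))) - R) + R"
    if t: "0 \<le> t" "t \<le> R" and s: "s \<in> {0..pi / k1}"
      and le: "cos (k1 * R) / k1\<^sup>2 \<le> cos (k1 * t) * (cos (k1 * s) / k1\<^sup>2)" for s t
  proof -
    have "cos (k1 * R) \<le> cos (k1 * t) * cos (k1 * s)" using le k by (simp add: divide_le_cancel)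
    then have "k1 * t + k1 * s \<le> 2 * arccos (sqrt (cos (k1 * R)))"
      using t s k \<theta>b by (intro cos_product_width) (auto simp: field_simps)
    then show ?thesis using k by (simp add: field_simps)
  qed
  ultimately show ?thesis using hypersurface_layer[OF \<Omega> refl] convex unfolding curv by blast
qed

lemma bilinear_minkowski: "bilinear (minkowski :: 'a::euclidean_space \<times> real \<Rightarrow> _)"
  unfolding bilinear_def minkowski_def
  by (auto intro!: linearI simp: inner_add_left inner_add_right algebra_simps)

text \<open>Used in contraposition: a timelike vector with negative product with a future vector is
  itself future, which identifies the upper sheet.\<close>

lemma minkowski_future_neg:
  fixes x y :: "'a::euclidean_space \<times> real"
  assumes "minkowski x x < 0" "0 < snd x" "minkowski y y < 0" "snd y \<le> 0"
  shows "0 \<le> minkowski y x"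
proof -
  have n: "norm (fst x) \<le> snd x" "norm (fst y) \<le> - snd y"
    using assms unfolding minkowski_def
    by (auto intro!: norm_le_square[THEN iffD2] simp: power2_eq_square)
  have "- (norm (fst y) * norm (fst x)) \<le> fst y \<bullet> fst x"
    using Cauchy_Schwarz_ineq2[of "fst y" "fst x"] by linarith
  moreover have "norm (fst y) * norm (fst x) \<le> (- snd y) * snd x"
    using n assms by (intro mult_mono) auto
  ultimately show ?thesis by (simp add: minkowski_def)
qed

text \<open>After the time coordinates are eliminated by squaring, what remains beyond
  Cauchy-Schwarz for the space parts is \<open>K\<close> times their squared distance.\<close>

lemma hyperboloid_reversed_cauchy_schwarz:
  fixes x y :: "'a::euclidean_space \<times> real"
  assumes K: "0 < K" and x: "minkowski x x = - K" "0 < snd x" and y: "minkowski y y = - K" "0 < snd y"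
    and ne: "x \<noteq> y"
  shows "minkowski x y < - K"
proof (rule ccontr)
  assume "\<not> minkowski x y < - K"
  then have le: "snd x * snd y \<le> K + fst x \<bullet> fst y" by (simp add: minkowski_def)
  have sq: "(snd x)\<^sup>2 = K + fst x \<bullet> fst x" "(snd y)\<^sup>2 = K + fst y \<bullet> fst y"
    using x y by (auto simp: minkowski_def power2_eq_square)
  have "(snd x * snd y)\<^sup>2 \<le> (K + fst x \<bullet> fst y)\<^sup>2" using le x y by (intro power_mono) auto
  then have "(K + fst x \<bullet> fst x) * (K + fst y \<bullet> fst y) \<le> (K + fst x \<bullet> fst y)\<^sup>2"
    by (simp add: power_mult_distrib sq)
  moreover have "(fst x \<bullet> fst y)\<^sup>2 \<le> (fst x \<bullet> fst x) * (fst y \<bullet> fst y)" by (rule Cauchy_Schwarz_ineq)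
  ultimately have "K * (fst x \<bullet> fst x + fst y \<bullet> fst y - 2 * (fst x \<bullet> fst y)) \<le> 0"
    by (simp add: power2_eq_square algebra_simps)
  moreover have "(fst x - fst y) \<bullet> (fst x - fst y) = fst x \<bullet> fst x + fst y \<bullet> fst y - 2 * (fst x \<bullet> fst y)"
    by (simp add: inner_diff_left inner_diff_right inner_commute)
  ultimately have "(fst x - fst y) \<bullet> (fst x - fst y) \<le> 0" using K by (simp add: mult_le_0_iff)
  then have "fst x - fst y = 0" by (metis inner_ge_zero inner_eq_zero_iff order_antisym)
  then have f: "fst x = fst y" by simp
  then have "(snd x)\<^sup>2 = (snd y)\<^sup>2" using sq by simp
  then have "snd x = snd y" using x y by (simp add: power2_eq_iff_nonneg)
  then show False using f ne by (simp add: prod_eq_iff)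
qed

lemma minkowski_spacelike:
  fixes x w :: "'a::euclidean_space \<times> real"
  assumes "minkowski x x < 0" "minkowski x w = 0" "w \<noteq> 0"
  shows "0 < minkowski w w"
proof -
  have s: "fst x \<bullet> fst x < (snd x)\<^sup>2" "fst x \<bullet> fst w = snd x * snd w"
    using assms by (auto simp: minkowski_def power2_eq_square)
  have sx: "0 < (snd x)\<^sup>2" using s(1) inner_ge_zero[of "fst x"] by linarith
  have fw: "fst w \<noteq> 0"
  proof
    assume "fst w = 0"
    then have "snd w = 0" using s(2) sx by simp
    then show False using \<open>fst w = 0\<close> assms(3) by (simp add: prod_eq_iff)
  qed
  have "(snd x)\<^sup>2 * (snd w)\<^sup>2 = (fst x \<bullet> fst w)\<^sup>2" by (simp add: s(2) power_mult_distrib)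
  also have "\<dots> \<le> (fst x \<bullet> fst x) * (fst w \<bullet> fst w)" by (rule Cauchy_Schwarz_ineq)
  also have "\<dots> < (snd x)\<^sup>2 * (fst w \<bullet> fst w)" using s(1) fw by (intro mult_strict_right_mono) auto
  finally have "(snd w)\<^sup>2 < fst w \<bullet> fst w" using sx by simp
  then show ?thesis by (simp add: minkowski_def power2_eq_square)
qed

lemma hyperbolic_quadric:
  assumes k: "0 < (k::real)" and dim: "2 \<le> DIM('a::euclidean_space)"
  shows "quadric (hyperbolic_form k :: ('a \<times> real) space_form) (- k\<^sup>2) {v. minkowski v v < 0 \<and> 0 < snd v}
    (\<lambda>t. cosh (k * t)) (\<lambda>t. sinh (k * t) / k) {0..}"
proof -
  let ?X = "hyperbolic_form k :: ('a \<times> real) space_form"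
  let ?W = "{v :: 'a \<times> real. minkowski v v < 0 \<and> 0 < snd v}"
  have form: "form ?X = minkowski" and pts: "pts ?X = {x. minkowski x x = - (1 / k\<^sup>2) \<and> snd x > 0}"
    and gd: "gdist ?X = (\<lambda>x y. arcosh (- k\<^sup>2 * minkowski x y) / k)" by (simp_all add: hyperbolic_form_def)
  have k2: "k\<^sup>2 > 0" "1 / k\<^sup>2 > 0" using k by simp_all
  have bb: "bounded_bilinear (minkowski :: 'a \<times> real \<Rightarrow> _)"
    using bilinear_minkowski by (simp add: bilinear_conv_bounded_bilinear)
  note lin = bilinear_lmul[OF bilinear_minkowski] bilinear_rmul[OF bilinear_minkowski]
  have le: "minkowski x y \<le> - (1 / k\<^sup>2)" "x \<noteq> y \<Longrightarrow> minkowski x y < - (1 / k\<^sup>2)" if "x \<in> pts ?X" "y \<in> pts ?X" for x y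
    using hyperboloid_reversed_cauchy_schwarz[OF k2(2), of x y] that unfolding pts by (cases "x = y"; auto)+
  have ge1: "1 \<le> - k\<^sup>2 * minkowski x y" if "x \<in> pts ?X" "y \<in> pts ?X" for x y
    using le(1)[OF that] k2 by (simp add: field_simps)
  show ?thesis
  proof
    show "bilinear (form ?X)" unfolding form by (rule bilinear_minkowski)
    show "form ?X x y = form ?X y x" for x y unfolding form minkowski_def by (simp add: inner_commute)
    show "- k\<^sup>2 \<noteq> 0" using k by simp
    have "continuous_on UNIV (\<lambda>v :: 'a \<times> real. minkowski v v)"
      by (intro bounded_bilinear.continuous_on[OF bb] continuous_intros)
    then show "open ?W" unfolding Collect_conj_eq
      by (intro open_Int open_Collect_less continuous_intros)
    show "0 < - k\<^sup>2 * form ?X v v" if "v \<in> ?W" for v unfolding form using that k2 by (simp add: mult_pos_neg)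
    show "t *\<^sub>R v \<in> ?W" if "v \<in> ?W" "0 < t" for v t
      using that by (simp add: lin mult_pos_neg)
    show "(1 - t) *\<^sub>R u + t *\<^sub>R v \<in> ?W"
      if "u \<in> ?W" "v \<in> ?W" "0 \<le> t" "t \<le> 1"
        "0 < - k\<^sup>2 * form ?X ((1 - t) *\<^sub>R u + t *\<^sub>R v) ((1 - t) *\<^sub>R u + t *\<^sub>R v)" for u v t
    proof -
      have "0 < snd ((1 - t) *\<^sub>R u + t *\<^sub>R v)"
      proof (cases "t = 0")
        case False
        then have "0 < t * snd v" "0 \<le> (1 - t) * snd u" using that by auto
        then show ?thesis by simp
      qed (use that in simp)
      then show ?thesis using that(5) k2 unfolding form by (simp add: mult_less_0_iff)
    qed
    show "pts ?X = {x \<in> ?W. - k\<^sup>2 * form ?X x x = 1}"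
    proof -
      have "minkowski x x = - (1 / k\<^sup>2) \<longleftrightarrow> - k\<^sup>2 * minkowski x x = 1" for x :: "'a \<times> real"
        using k by (auto simp: field_simps)
      moreover have "minkowski x x < 0" if "minkowski x x = - (1 / k\<^sup>2)" for x :: "'a \<times> real"
        using that k2 by simp
      ultimately show ?thesis unfolding pts form by blast
    qed
    show "closed (pts ?X)"
    proof -
      have "snd x > 0 \<longleftrightarrow> snd x \<ge> 0" if "minkowski x x = - (1 / k\<^sup>2)" for x :: "'a \<times> real"
      proof -
        have "snd x \<noteq> 0"
        proof
          assume "snd x = 0"
          then have "0 \<le> minkowski x x" by (simp add: minkowski_def)
          then show False using that k2(2) by linarith
        qed
        then show ?thesis by auto
      qed
      then have "pts ?X = {x. minkowski x x = - (1 / k\<^sup>2)} \<inter> {x. 0 \<le> snd x}" unfolding pts by auto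
      moreover have "closed {x :: 'a \<times> real. minkowski x x = - (1 / k\<^sup>2)}"
        by (intro closed_Collect_eq bounded_bilinear.continuous_on[OF bb] continuous_intros)
      moreover have "closed {x :: 'a \<times> real. 0 \<le> snd x}" by (intro closed_Collect_le continuous_intros)
      ultimately show ?thesis by (simp add: closed_Int)
    qed
    show "v \<in> ?W" if "p \<in> pts ?X" "- k\<^sup>2 * form ?X v v = 1" "form ?X v p \<le> 1 / (- k\<^sup>2)" for p v
    proof -
      have vv: "minkowski v v < 0"
      proof (rule ccontr)
        assume "\<not> minkowski v v < 0"
        then have "0 \<le> k\<^sup>2 * minkowski v v" by simp
        then show False using that(2) unfolding form by simp
      qed
      have "minkowski v p \<le> - (1 / k\<^sup>2)" using that(3) unfolding form by simp
      then have vp: "minkowski v p < 0" using k2(2) by linarith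
      have p: "minkowski p p < 0" "0 < snd p" using that(1) k2(2) unfolding pts by simp_all
      have "0 < snd v" using minkowski_future_neg[OF p vv] vp by linarith
      then show ?thesis using vv by simp
    qed
    show "form ?X x y < 1 / (- k\<^sup>2)" if "x \<in> pts ?X" "y \<in> pts ?X" "x \<noteq> y" for x y
      using le(2)[OF that] unfolding form by simp
    show "- 1 \<le> - k\<^sup>2 * form ?X x y" if "x \<in> pts ?X" "y \<in> pts ?X" for x y
      using ge1[OF that] unfolding form by linarith
    show "y = - x" if "x \<in> pts ?X" "y \<in> pts ?X" "- k\<^sup>2 * form ?X x y = - 1" for x y
      using ge1[OF that(1,2)] that(3) unfolding form by linarith
    show "0 < form ?X w w" if "x \<in> pts ?X" "form ?X x w = 0" "w \<noteq> 0" for x w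
      using minkowski_spacelike[of x w] that k2 unfolding form pts by auto
    show "\<exists>e. form ?X e x = 0 \<and> form ?X e y = 0 \<and> form ?X e e = 1" if "x \<in> pts ?X" "y \<in> pts ?X" for x y
    proof -
      \<comment> \<open>Flipping the sign of the last coordinate turns Minkowski orthogonality into
        Euclidean orthogonality.\<close>
      obtain e :: "'a \<times> real" where e: "e \<noteq> 0" "e \<bullet> (fst x, - snd x) = 0" "e \<bullet> (fst y, - snd y) = 0"
        using unit_orthogonal_pair[of "(fst x, - snd x)" "(fst y, - snd y)"] dim by auto
      have o: "minkowski e x = 0" "minkowski e y = 0" "minkowski x e = 0"
        using e by (auto simp: minkowski_def inner_prod_def inner_commute)
      have pos: "0 < minkowski e e" using minkowski_spacelike[OF _ o(3) e(1)] that k2 unfolding pts by auto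
      let ?s = "sqrt (minkowski e e)"
      have "?s * ?s = minkowski e e" "?s > 0" using pos by auto
      then show ?thesis unfolding form using o pos
        by (intro exI[of _ "(1 / ?s) *\<^sub>R e"]) (simp add: lin field_simps)
    qed
    show "cosh (k * 0) = 1" "sinh (k * 0) / k = 0" by simp_all
    show "cosh (k * (s - t)) = cosh (k * s) * cosh (k * t) + - k\<^sup>2 * (sinh (k * s) / k) * (sinh (k * t) / k)" for s t
      using k by (simp add: right_diff_distrib cosh_diff power2_eq_square)
    show "sinh (k * (s - t)) / k = sinh (k * s) / k * cosh (k * t) - cosh (k * s) * (sinh (k * t) / k)" for s t
      by (simp add: right_diff_distrib sinh_diff diff_divide_distrib)
    show "((\<lambda>t. cosh (k * t)) has_real_derivative - (- k\<^sup>2) * (sinh (k * t) / k)) (at t)" for t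
      using k by (auto intro!: derivative_eq_intros simp: power2_eq_square)
    show "((\<lambda>t. sinh (k * t) / k) has_real_derivative cosh (k * t)) (at t)" for t
      using k by (auto intro!: derivative_eq_intros)
    show "0 \<in> {0::real..}" by simp
    show "0 \<le> t" if "t \<in> {0..}" for t :: real using that by simp
    show "s \<in> {0..}" if "t \<in> {0..}" "0 \<le> s" "s \<le> t" for s t :: real using that by simp
    show "cosh (k * t) / (- k\<^sup>2) < cosh (k * s) / (- k\<^sup>2)" if "s \<in> {0..}" "t \<in> {0..}" "s < t" for s t
    proof -
      have "cosh (k * s) < cosh (k * t)" using that k by (simp add: cosh_real_nonneg_less_iff)
      then show ?thesis using k2 by (simp add: divide_strict_right_mono)
    qed
    show "0 < sinh (k * s) / k" if "0 < s" for s using that k by simp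
    \<comment> \<open>The half-line has no largest element, so the premise is contradictory.\<close>
    show "cosh (k * t) = - 1" if "\<forall>s\<in>{0..}. s \<le> t" for t using that[rule_format, of "\<bar>t\<bar> + 1"] by simp
    show "gdist ?X x y \<in> {0..} \<and> cosh (k * gdist ?X x y) = - k\<^sup>2 * form ?X x y"
      if "x \<in> pts ?X" "y \<in> pts ?X" for x y
      using ge1[OF that] k unfolding gd form by (simp add: cosh_arcosh_real arcosh_nonneg_real)
  qed
qed

lemma cosh_product_width:
  fixes a c \<theta> :: real
  assumes "0 \<le> a" "0 \<le> c" "cosh a * cosh c \<le> cosh \<theta>"
  shows "a + c \<le> 2 * arcosh (sqrt (cosh \<theta>))"
proof -
  let ?m = "(a + c) / 2"
  have m: "0 \<le> ?m" using assms by simp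
  have "(cosh ?m)\<^sup>2 = (1 + cosh (2 * ?m)) / 2" by (subst cosh_double_cosh) simp
  also have "2 * ?m = a + c" by simp
  also have "(1 + cosh (a + c)) / 2 \<le> (cosh (a - c) + cosh (a + c)) / 2"
    using cosh_real_ge_1[of "a - c"] by simp
  also have "\<dots> = cosh a * cosh c" by (simp add: cosh_add cosh_diff)
  finally have "cosh ?m \<le> sqrt (cosh \<theta>)" using assms(3) by (intro real_le_rsqrt) simp
  moreover have "1 \<le> sqrt (cosh \<theta>)" using cosh_real_ge_1[of \<theta>] by simp
  ultimately have "cosh ?m \<le> cosh (arcosh (sqrt (cosh \<theta>)))" by (simp add: cosh_arcosh_real)
  then have "?m \<le> arcosh (sqrt (cosh \<theta>))"
    using cosh_real_nonneg_le_iff[OF m arcosh_nonneg_real[OF \<open>1 \<le> sqrt (cosh \<theta>)\<close>]] by blast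
  then show ?thesis by simp
qed

lemma tanh_artanh_real:
  fixes x :: real
  assumes "\<bar>x\<bar> < 1"
  shows "tanh (artanh x) = x"
proof -
  have "0 < (1 + x) / (1 - x)" using assms by (simp add: abs_less_iff)
  then have "exp (- 2 * artanh x) = (1 - x) / (1 + x)"
    unfolding artanh_def by (simp add: exp_minus)
  moreover have "1 - (1 - x) / (1 + x) = 2 * x / (1 + x)" "1 + (1 - x) / (1 + x) = 2 / (1 + x)"
    using assms by (simp_all add: field_simps abs_less_iff)
  ultimately show ?thesis unfolding tanh_real_altdef using assms by (simp add: abs_less_iff)
qed

lemma hyperbolic_case:
  assumes k: "0 < k1" "k1 < k0" and R: "R = 1 / k1 * arcoth (k0 / k1)" and dim: "2 \<le> DIM('a::euclidean_space)"
    and \<Omega>: "compact_domain (hyperbolic_form k1) (\<Omega> :: ('a \<times> real) set)"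
    and convex: "lambda_convex (hyperbolic_form k1) k0 (mfd_top (hyperbolic_form k1) frontier_of \<Omega>)"
  shows "\<exists>L d. spherical_layer (hyperbolic_form k1) L d \<and> mfd_top (hyperbolic_form k1) frontier_of \<Omega> \<subseteq> L \<and>
    d \<le> 2 / k1 * arcosh (sqrt (cosh (k1 * R))) - R"
proof -
  let ?X = "hyperbolic_form k1 :: ('a \<times> real) space_form"
  let ?W = "{v :: 'a \<times> real. minkowski v v < 0 \<and> 0 < snd v}"
  interpret quadric ?X "- k1\<^sup>2" ?W "\<lambda>t. cosh (k1 * t)" "\<lambda>t. sinh (k1 * t) / k1" "{0..}"
    using hyperbolic_quadric[OF k(1) dim] .
  have q: "\<bar>k1 / k0\<bar> < 1" "0 < k1 / k0" using k by auto
  have \<theta>: "k1 * R = artanh (k1 / k0)" using R k by (simp add: arcoth_def)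
  have tanh: "tanh (k1 * R) = k1 / k0" unfolding \<theta> using q by (simp add: tanh_artanh_real)
  have \<theta>0: "0 < k1 * R" using tanh q(2) by (metis tanh_real_pos_iff)
  have curv: "cosh (k1 * R) / (sinh (k1 * R) / k1) = k0"
  proof -
    have ne: "sinh (k1 * R) \<noteq> 0" using \<theta>0 unfolding sinh_real_zero_iff by linarith
    have "k0 * sinh (k1 * R) = k1 * cosh (k1 * R)" using tanh k by (simp add: tanh_def field_simps)
    then have "cosh (k1 * R) / (sinh (k1 * R) / k1) = (k0 * sinh (k1 * R)) / sinh (k1 * R)"
      by (simp add: mult.commute)
    also have "\<dots> = k0" using ne by (rule nonzero_mult_div_cancel_right)
    finally show ?thesis .
  qed
  interpret quadric_radius ?X "- k1\<^sup>2" ?W "\<lambda>t. cosh (k1 * t)" "\<lambda>t. sinh (k1 * t) / k1" "{0..}" R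
  proof
    have "0 < R" using \<theta>0 k by (simp add: zero_less_mult_iff)
    then show "proper (2 * R)" unfolding proper_def by (intro conjI bexI[of _ "2 * R + 1"]) auto
  qed
  have "0 < - k1\<^sup>2 * form ?X x y" if "x \<in> pts ?X" "y \<in> pts ?X" for x y
    using gdist_cs[OF that] cosh_real_pos[of "k1 * gdist ?X x y"] by simp
  moreover have "s + t \<le> (2 / k1 * arcosh (sqrt (cosh (k1 * R))) - R) + R"
    if t: "0 \<le> t" "t \<le> R" and s: "s \<in> {0..}"
      and le: "cosh (k1 * R) / (- k1\<^sup>2) \<le> cosh (k1 * t) * (cosh (k1 * s) / (- k1\<^sup>2))" for s t
  proof -
    have "cosh (k1 * t) * cosh (k1 * s) \<le> cosh (k1 * R)" using le k by (simp add: divide_le_cancel)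
    then have "k1 * t + k1 * s \<le> 2 * arcosh (sqrt (cosh (k1 * R)))"
      using t s k by (intro cosh_product_width) auto
    then show ?thesis using k by (simp add: field_simps)
  qed
  ultimately show ?thesis using hypersurface_layer[OF \<Omega> refl] convex unfolding curv by blast
qed

section \<open>Euclidean space\<close>

text \<open>Curvature zero is treated separately, since \<open>quadric\<close> divides by \<kappa>.
  The point set is now the whole vector space and the projection is the identity.\<close>

interpretation euclid: symmetric_form "(\<bullet>) :: 'a::euclidean_space \<Rightarrow> 'a \<Rightarrow> real"
  by unfold_locales (simp_all add: bilinear_conv_bounded_bilinear bounded_bilinear_inner inner_commute)

lemma euclid_h: "euclid.h x y = (dist x y)\<^sup>2 / 2"
  by (simp add: euclid.h_def dist_norm power2_norm_eq_inner)

lemma euclid_h_le: "0 \<le> r \<Longrightarrow> euclid.h x y \<le> r\<^sup>2 / 2 \<longleftrightarrow> dist x y \<le> r"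
  by (simp add: euclid_h abs_le_square_iff[symmetric])

lemma euclid_h_eq: "0 \<le> r \<Longrightarrow> euclid.h x y = r\<^sup>2 / 2 \<longleftrightarrow> dist x y = r"
  by (simp add: euclid_h power2_eq_iff_nonneg)

lemma unit_orthogonal:
  fixes x :: "'a::euclidean_space"
  assumes "2 \<le> DIM('a)"
  obtains e where "norm e = 1" "e \<bullet> x = 0"
proof -
  obtain e where e: "e \<noteq> 0" "orthogonal x e" using orthogonal_to_vector_exists[OF assms] by blast
  then show thesis using that[of "(1 / norm e) *\<^sub>R e"] by (simp add: orthogonal_def inner_commute)
qed

lemma euclid_outside:
  fixes Q z :: "'a::euclidean_space"
  assumes "2 \<le> DIM('a)"
  shows "\<exists>e. \<forall>\<^sub>F t in at 0. euclid.h Q z < euclid.h (Q + t *\<^sub>R e) z"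
proof -
  obtain e where e: "norm e = 1" "e \<bullet> (Q - z) = 0" using unit_orthogonal[OF assms] by blast
  have "euclid.h (Q + t *\<^sub>R e) z = euclid.h Q z + t\<^sup>2 / 2" for t
  proof -
    have "Q + t *\<^sub>R e - z = (Q - z) + t *\<^sub>R e" by simp
    then have "(Q + t *\<^sub>R e - z) \<bullet> (Q + t *\<^sub>R e - z) = (Q - z) \<bullet> (Q - z) + 2 * t * (e \<bullet> (Q - z)) + t\<^sup>2 * (e \<bullet> e)"
      by (simp only:) (simp only: inner_add_left inner_add_right inner_scaleR_left inner_scaleR_right
        inner_commute[of "Q - z" e] power2_eq_square, simp add: algebra_simps)
    then show ?thesis using e by (simp add: euclid.h_def norm_eq_1 add_divide_distrib)
  qed
  moreover have "\<forall>\<^sub>F t in at (0::real). t \<noteq> 0" by (simp add: eventually_at_filter)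
  ultimately show ?thesis by (intro exI[of _ e]) (auto elim!: eventually_mono)
qed

lemma euclid_model_space:
  assumes R: "0 < R" and dim: "2 \<le> DIM('a::euclidean_space)"
  shows "model_space ((\<bullet>) :: 'a \<Rightarrow> 'a \<Rightarrow> real) UNIV (R\<^sup>2 / 2) ((2 * R)\<^sup>2 / 2) UNIV (\<lambda>x. x)"
proof
  show "0 < euclid.h x y" if "x \<noteq> y" for x y :: 'a using that by (simp add: euclid_h)
  show "euclid.h x y \<le> (2 * R)\<^sup>2 / 2" if "euclid.h x z \<le> R\<^sup>2 / 2" "euclid.h y z \<le> R\<^sup>2 / 2" for x y z :: 'a
  proof -
    have "dist x z \<le> R" "dist y z \<le> R" using that unfolding euclid_h_le[OF less_imp_le[OF R]] by auto
    then have "dist x y \<le> 2 * R" using dist_triangle2[of x y z] by simp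
    then show ?thesis using R by (intro euclid_h_le[THEN iffD2]) simp_all
  qed
  show "0 < R\<^sup>2 / 2" using R by simp
  show "\<exists>T\<subseteq>UNIV. connected T \<and> c \<in> T \<and> x \<in> T \<and> (\<forall>y\<in>T. euclid.h c y \<le> euclid.h c x)" for c x :: 'a
  proof (intro exI[of _ "closed_segment c x"] conjI ballI)
    fix y assume "y \<in> closed_segment c x"
    then have "dist c y \<le> dist c x" using dist_in_closed_segment[of y c x] by (simp add: dist_commute)
    then show "euclid.h c y \<le> euclid.h c x" by (simp add: euclid_h power_mono)
  qed auto
  show "\<exists>s. continuous_on UNIV s \<and> s v = v \<and> (\<forall>y\<in>UNIV. s y \<in> UNIV \<and> s y = y)" for v :: 'a
    by (intro exI[of _ "\<lambda>x. x"]) simp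
  show "euclid.h ((1 - t) *\<^sub>R u + t *\<^sub>R v) z \<le> R\<^sup>2 / 2"
    if "euclid.h u z \<le> R\<^sup>2 / 2" "euclid.h v z \<le> R\<^sup>2 / 2" "0 \<le> t" "t \<le> 1" for z u v :: 'a and t
  proof -
    have "u \<in> cball z R" "v \<in> cball z R"
      using that(1,2) unfolding euclid_h_le[OF less_imp_le[OF R]] by (simp_all add: dist_commute)
    then have "(1 - t) *\<^sub>R u + t *\<^sub>R v \<in> cball z R" using that by (intro convexD[OF convex_cball]) auto
    then show ?thesis unfolding euclid_h_le[OF less_imp_le[OF R]] by (simp add: dist_commute)
  qed
  show "\<exists>e. \<forall>\<^sub>F t in at 0. Q + t *\<^sub>R e \<in> UNIV \<and> R\<^sup>2 / 2 < euclid.h (Q + t *\<^sub>R e) z"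
    if "euclid.h Q z = R\<^sup>2 / 2" for Q z :: 'a
    using euclid_outside[OF dim, of Q z] that by simp
qed simp_all

text \<open>As on the quadrics, one great circle through \<open>p\<close> realises the curvature
  1/r, and this fixes the radius.\<close>

lemma euclid_sphere_radius:
  fixes z p :: "'a::euclidean_space"
  assumes dim: "2 \<le> DIM('a)" and s: "sphere_of_curvature euclidean_form \<mu> z r" and p: "p \<in> geo_sphere euclidean_form z r"
  shows "r = 1 / \<mu>"
proof -
  let ?S = "geo_sphere euclidean_form z r" and ?B = "geo_cball euclidean_form z r"
  have r: "0 < r" using s by (simp add: sphere_of_curvature_def)
  have pz: "dist z p = r" using p by (simp add: geo_sphere_def euclidean_form_def)
  define T where "T = (1 / r) *\<^sub>R (z - p)"
  have T: "T \<bullet> T = 1" "z = p + r *\<^sub>R T"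
    using r pz by (auto simp: T_def dist_norm dot_square_norm power2_eq_square)
  obtain e where e: "norm e = 1" "e \<bullet> T = 0" using unit_orthogonal[OF dim] by blast
  have ee: "e \<bullet> e = 1" "T \<bullet> e = 0" using e by (auto simp: norm_eq_1 inner_commute)
  have perp: "T \<bullet> v = 0" if v: "v \<in> tangent_vectors ?S p" for v
  proof -
    obtain g where g: "g 0 = p" "\<And>t::real. g t \<in> ?S" "(g has_vector_derivative v) (at 0)"
      using v unfolding tangent_vectors_def by blast
    have "dist (g t) z = r" for t using g(2)[of t] by (simp add: geo_sphere_def euclidean_form_def dist_commute)
    then have "(g t - z) \<bullet> (g t - z) = r\<^sup>2" for t by (simp add: dist_norm dot_square_norm)
    moreover have "((\<lambda>t. g t - z) has_vector_derivative v) (at 0)"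
      using has_vector_derivative_diff[OF g(3) has_vector_derivative_const[of z]] by simp
    ultimately have "(g 0 - z) \<bullet> v = 0"
      using has_vector_derivative_form_self_const[OF bounded_bilinear_inner inner_commute, of "\<lambda>t. g t - z" v 0 "r\<^sup>2"] by simp
    then show ?thesis using g(1) r T(2) by simp
  qed
  have "((\<lambda>t. p + t *\<^sub>R T) has_vector_derivative T) (at 0)"
    by (auto intro!: derivative_eq_intros)
  then have tan: "T \<in> tangent_vectors UNIV p"
    unfolding tangent_vectors_def by (intro CollectI exI[of _ "\<lambda>t. p + t *\<^sub>R T"]) simp
  have curve: "\<exists>\<gamma>. \<gamma> 0 = p \<and> (\<forall>t\<ge>0::real. \<gamma> t \<in> ?B) \<and> (\<gamma> has_vector_derivative T) (at 0 within {0..})"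
  proof (intro exI conjI allI impI)
    let ?\<phi> = "\<lambda>t. r * (1 - exp (- t / r))"
    let ?g = "\<lambda>t. p + ?\<phi> t *\<^sub>R T"
    show "?g 0 = p" by simp
    show "?g t \<in> ?B" if t: "0 \<le> t" for t
    proof -
      have e: "0 \<le> ?\<phi> t" "?\<phi> t \<le> r" using r t by (auto simp: algebra_simps)
      have "z - ?g t = (r - ?\<phi> t) *\<^sub>R T" by (subst T(2)) (simp add: algebra_simps)
      then have "dist z (?g t) = \<bar>r - ?\<phi> t\<bar>" using T(1) by (simp add: dist_norm norm_eq_sqrt_inner)
      then show ?thesis using e by (simp add: geo_cball_def euclidean_form_def)
    qed
    have "(?\<phi> has_vector_derivative 1) (at 0)"
      using r unfolding has_real_derivative_iff_has_vector_derivative[symmetric]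
      by (auto intro!: derivative_eq_intros)
    then have "((\<lambda>t. ?\<phi> t *\<^sub>R T) has_vector_derivative 1 *\<^sub>R T) (at 0)"
      by (rule bounded_linear.has_vector_derivative[OF bounded_linear_scaleR_left])
    then have "(?g has_vector_derivative T) (at 0)"
      using has_vector_derivative_add[OF has_vector_derivative_const[of p]] by fastforce
    then show "(?g has_vector_derivative T) (at 0 within {0..})" by (rule has_vector_derivative_at_within)
  qed
  have normal: "inner_unit_normal euclidean_form ?S ?B p T"
    unfolding inner_unit_normal_def using tan T(1) perp curve by (simp add: euclidean_form_def)
  let ?f = "- (r *\<^sub>R T)" and ?e = "r *\<^sub>R e"
  let ?g = "\<lambda>t. z + cos (1 / r * t) *\<^sub>R ?f + sin (1 / r * t) *\<^sub>R ?e"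
  let ?g' = "\<lambda>t. (1 / r) *\<^sub>R (- sin (1 / r * t) *\<^sub>R ?f + cos (1 / r * t) *\<^sub>R ?e)"
  have gS: "?g t \<in> ?S" for t
  proof -
    have "(?g t - z) \<bullet> (?g t - z) = r\<^sup>2 * ((cos (1 / r * t))\<^sup>2 + (sin (1 / r * t))\<^sup>2)"
      using T(1) ee e by (simp add: inner_diff_left inner_diff_right inner_add_left inner_add_right power2_eq_square algebra_simps
        del: sin_cos_squared_add sin_cos_squared_add2 sin_cos_squared_add3)
    then have "norm (?g t - z) = r" using r by (simp add: norm_eq_sqrt_inner)
    then show ?thesis by (simp add: geo_sphere_def euclidean_form_def dist_norm norm_minus_commute)
  qed
  have "has_normal_curvature euclidean_form ?S ?B p e (1 / r)"
    unfolding has_normal_curvature_def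
  proof (intro conjI exI allI)
    show "form euclidean_form e e = 1" by (simp add: euclidean_form_def ee)
    show "inner_unit_normal euclidean_form ?S ?B p T" by fact
    show "?g 0 = p" using T(2) by simp
    show "?g' 0 = e" using r by simp
    show "?g t \<in> ?S" for t by (rule gS)
    show "(?g has_vector_derivative ?g' t) (at t)" for t by (rule circle_derivs(1))
    show "(?g' has_vector_derivative (- (1 / r)\<^sup>2) *\<^sub>R (cos (1 / r * 0) *\<^sub>R ?f + sin (1 / r * 0) *\<^sub>R ?e)) (at 0)"
      by (rule circle_derivs(2))
    show "1 / r = form euclidean_form ((- (1 / r)\<^sup>2) *\<^sub>R (cos (1 / r * 0) *\<^sub>R ?f + sin (1 / r * 0) *\<^sub>R ?e)) T"
      using r T(1) by (simp add: euclidean_form_def power2_eq_square)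
  qed
  then have "1 / r = \<mu>" using s p unfolding sphere_of_curvature_def by blast
  then show ?thesis by (simp flip: \<open>1 / r = \<mu>\<close>)
qed

lemma half_sum_diff:
  fixes x y :: "'a::real_vector"
  shows "(1/2) *\<^sub>R (x + y) + w - x = w - (1/2) *\<^sub>R (x - y)"
    and "(1/2) *\<^sub>R (x + y) + w - y = w + (1/2) *\<^sub>R (x - y)"
proof -
  have "a = (1/2) *\<^sub>R a + (1/2) *\<^sub>R a" for a :: 'a by (simp flip: scaleR_add_left)
  then obtain x' y' where *: "x = x' + x'" "y = y' + y'" by metis
  have "(1/2) *\<^sub>R (x + y) = x' + y'" "(1/2) *\<^sub>R (x - y) = x' - y'"
    unfolding * using scaleR_half_double[of "x' + y'"] scaleR_half_double[of "x' - y'"]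
    by (simp_all add: algebra_simps)
  then show "(1/2) *\<^sub>R (x + y) + w - x = w - (1/2) *\<^sub>R (x - y)"
    "(1/2) *\<^sub>R (x + y) + w - y = w + (1/2) *\<^sub>R (x - y)"
    unfolding * by (simp_all add: algebra_simps)
qed

lemma midpoint_offset_neq:
  fixes e x y :: "'a::real_inner"
  assumes "norm e = 1" "e \<bullet> (x - y) = 0" "0 < t"
  shows "(1/2) *\<^sub>R (x + y) + t *\<^sub>R e \<noteq> x" "(1/2) *\<^sub>R (x + y) + t *\<^sub>R e \<noteq> y"
proof -
  have "e \<bullet> ((1/2) *\<^sub>R (x + y) + t *\<^sub>R e - x) = t" "e \<bullet> ((1/2) *\<^sub>R (x + y) + t *\<^sub>R e - y) = t"
    unfolding half_sum_diff using assms(1,2)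
    by (simp_all only: inner_add_right inner_diff_right[of e "t *\<^sub>R e"] inner_scaleR_right dot_square_norm) simp_all
  then show "(1/2) *\<^sub>R (x + y) + t *\<^sub>R e \<noteq> x" "(1/2) *\<^sub>R (x + y) + t *\<^sub>R e \<noteq> y"
    using assms(3) by (metis diff_self inner_zero_right less_irrefl)+
qed

lemma euclid_inscribed_estimate:
  fixes I :: "'a::euclidean_space set"
  assumes dim: "2 \<le> DIM('a)" and R: "0 < R"
    and "bounded_region ((\<bullet>) :: 'a \<Rightarrow> 'a \<Rightarrow> real) UNIV (R\<^sup>2 / 2) ((2 * R)\<^sup>2 / 2) UNIV (\<lambda>x. x) I"
  shows "\<exists>c r. 0 < r \<and> r \<le> R \<and> (\<forall>x\<in>closure I - I. r \<le> dist c x \<and> (dist c x)\<^sup>2 + (R - r)\<^sup>2 \<le> R\<^sup>2)"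
proof -
  interpret bounded_region "(\<bullet>) :: 'a \<Rightarrow> 'a \<Rightarrow> real" UNIV "R\<^sup>2 / 2" "(2 * R)\<^sup>2 / 2" UNIV "\<lambda>x. x" I by fact
  obtain c m where ins: "inscribed c m" using inscribed_exists by blast
  define r where "r = sqrt (2 * m)"
  have c: "c \<in> I" "0 < m" "\<And>p. p \<in> F \<Longrightarrow> m \<le> euclid.h c p"
    "\<And>w. w \<in> tangent_vectors UNIV c \<Longrightarrow> \<exists>P\<in>F. euclid.h c P = m \<and> 0 \<le> w \<bullet> (P - c)"
    using ins by (auto simp: inscribed_def)
  have r: "0 < r" "m = r\<^sup>2 / 2" using c(2) by (auto simp: r_def)
  have tangent: "w \<in> tangent_vectors UNIV c" for w :: 'a
  proof -
    have "((\<lambda>t. c + t *\<^sub>R w) has_vector_derivative w) (at 0)" by (auto intro!: derivative_eq_intros)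
    then show ?thesis unfolding tangent_vectors_def by (intro CollectI exI[of _ "\<lambda>t. c + t *\<^sub>R w"]) simp
  qed
  have key: "euclid.angle (P + (2 * \<rho> / r) *\<^sub>R (c - P)) P x < 0"
    if P: "P \<in> F" "euclid.h c P = m" and \<rho>: "R < \<rho>" and x: "x \<in> I" for P \<rho> x
  proof -
    let ?A = "P + (2 * \<rho> / r) *\<^sub>R (c - P)"
    have \<rho>0: "0 < \<rho>" using \<rho> R by simp
    have cP: "norm (c - P) = r" using P(2) r euclid_h_eq[of r c P] by (simp add: dist_norm)
    have AP: "?A - P = (2 * \<rho> / r) *\<^sub>R (c - P)" by simp
    have nAP: "norm (?A - P) = 2 * \<rho>" unfolding AP using cP r \<rho>0 by simp
    have hAP: "euclid.h ?A P = (2 * \<rho>)\<^sup>2 / 2" using nAP by (simp only: euclid_h dist_norm)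
    have far: "(2 * R)\<^sup>2 / 2 < euclid.h ?A P" unfolding hAP using \<rho> R by (simp add: power_strict_mono)
    \<comment> \<open>\<open>c\<close> divides the segment from \<open>P\<close> to \<open>A\<close>
      in this ratio, which gives the trap assumption \<open>centre\<close> with s = 1 - 2q.\<close>
    define q where "q = r / (2 * \<rho>)"
    have q: "0 < q" using r \<rho>0 by (simp add: q_def)
    have cq: "q *\<^sub>R (?A - P) = c - P" unfolding AP q_def using r \<rho>0 by simp
    have centre: "euclid.h y c - euclid.h P c = (1 - 2 * q) * euclid.h P y + q * euclid.angle ?A P y" for y
    proof -
      define u v where "u = y - P" and "v = ?A - P"
      have "c = P + q *\<^sub>R v" unfolding v_def cq by simp
      then have 1: "y - c = u - q *\<^sub>R v" "P - c = - (q *\<^sub>R v)"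
        unfolding u_def by simp_all
      have 2: "y - ?A = u - v" "P - y = - u" "y - P = u" unfolding u_def v_def by simp_all
      show ?thesis unfolding euclid.h_def euclid.angle_def 1 2
        by (simp add: inner_diff_left inner_diff_right inner_commute[of v u] algebra_simps add_divide_distrib diff_divide_distrib)
    qed
    \<comment> \<open>The power of a point with respect to the sphere with diameter
      \<open>AP\<close>, whose radius is \<rho>: offset 0 is inside, and an offset of length \<rho>
      is on the sphere.\<close>
    have half: "euclid.angle ?A P ((1/2) *\<^sub>R (?A + P) + w) = w \<bullet> w - \<rho>\<^sup>2" for w
    proof -
      define v where "v = (1/2) *\<^sub>R (?A - P)"
      have 1: "(1/2) *\<^sub>R (?A + P) + w - ?A = w - v" "(1/2) *\<^sub>R (?A + P) + w - P = w + v"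
        unfolding v_def by (rule half_sum_diff)+
      have "norm v = \<rho>" unfolding v_def using nAP \<rho>0 by simp
      then have "v \<bullet> v = \<rho>\<^sup>2" by (simp add: dot_square_norm)
      then show ?thesis unfolding euclid.angle_def 1 by (simp add: inner_diff_left inner_diff_right inner_add_left inner_add_right inner_commute[of v w])
    qed
    obtain e :: 'a where e: "norm e = 1" "e \<bullet> (?A - P) = 0" using unit_orthogonal[OF dim] by blast
    let ?y = "(1/2) *\<^sub>R (?A + P) + 0" and ?x = "(1/2) *\<^sub>R (?A + P) + \<rho> *\<^sub>R e"
    have y: "euclid.angle ?A P ?y < 0" unfolding half using \<rho>0 by simp
    have xa: "euclid.angle ?A P ?x = 0" unfolding half using e(1) by (simp add: dot_square_norm power2_eq_square)
    have xn: "?x \<noteq> ?A" "?x \<noteq> P" by (rule midpoint_offset_neq[OF e \<rho>0])+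
    show ?thesis using contained[OF ins P UNIV_I far q centre UNIV_I y UNIV_I xa xn x] .
  qed
  have near_R: "\<forall>\<^sub>F \<rho> in at_right R. R < \<rho>" by (simp add: eventually_at_right_less)
  have rR: "r \<le> R"
  proof -
    obtain P where P: "P \<in> F" "euclid.h c P = m" using c(4)[OF tangent, of 0] by blast
    have cP: "norm (c - P) = r" using P(2) r euclid_h_eq[of r c P] by (simp add: dist_norm)
    have "r \<le> \<rho>" if \<rho>: "R < \<rho>" for \<rho>
    proof (rule ccontr)
      assume n: "\<not> r \<le> \<rho>"
      let ?A = "P + (2 * \<rho> / r) *\<^sub>R (c - P)"
      have "?A - c = (2 * \<rho> / r - 1) *\<^sub>R (c - P)" by (simp add: algebra_simps)
      then have "dist ?A c = \<bar>2 * \<rho> / r - 1\<bar> * r" using cP by (simp add: dist_norm)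
      also have "\<dots> = \<bar>(2 * \<rho> / r - 1) * r\<bar>" by (simp only: abs_mult abs_of_pos[OF r(1)])
      also have "\<dots> = \<bar>2 * \<rho> - r\<bar>"
      proof -
        have "(2 * \<rho> / r - 1) * r = 2 * \<rho> - r" using r(1) by (simp add: field_simps)
        then show ?thesis by (simp only:)
      qed
      also have "\<dots> < r" using n \<rho> R by auto
      finally have "dist ?A c < r" .
      then have "(dist ?A c)\<^sup>2 < r\<^sup>2" by (rule power_strict_mono) simp_all
      then have "euclid.h ?A c < m" using r by (simp add: euclid_h)
      then have "?A \<in> I" using ball_in_I[OF ins UNIV_I] by blast
      then have "euclid.angle ?A P ?A < 0" using key[OF P \<rho>] by blast
      then show False by (simp add: euclid.angle_def)
    qed
    then have "\<forall>\<^sub>F \<rho> in at_right R. r \<le> \<rho>" using near_R by (auto elim: eventually_mono)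
    then show ?thesis using tendsto_lowerbound[OF tendsto_ident_at, of r R "{R<..}"] by simp
  qed
  have "r \<le> dist c x \<and> (dist c x)\<^sup>2 + (R - r)\<^sup>2 \<le> R\<^sup>2" if x: "x \<in> F" for x
  proof
    have "r\<^sup>2 \<le> (dist c x)\<^sup>2" using c(3)[OF x] r by (simp add: euclid_h)
    then show "r \<le> dist c x" by (rule power2_le_imp_le) simp
    obtain P where P: "P \<in> F" "euclid.h c P = m" "0 \<le> (x - c) \<bullet> (P - c)" using c(4)[OF tangent, of "x - c"] by blast
    let ?A = "\<lambda>\<rho>. P + (2 * \<rho> / r) *\<^sub>R (c - P)"
    have "euclid.angle (?A R) P y \<le> 0" if y: "y \<in> I" for y
    proof -
      have "((\<lambda>\<rho>. euclid.angle (?A \<rho>) P y) \<longlongrightarrow> euclid.angle (?A R) P y) (at_right R)"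
        unfolding euclid.angle_def by (intro tendsto_intros) (use r in auto)
      moreover have "\<forall>\<^sub>F \<rho> in at_right R. euclid.angle (?A \<rho>) P y \<le> 0"
        using near_R by eventually_elim (use key[OF P(1,2) _ y] in \<open>auto intro: less_imp_le\<close>)
      ultimately show ?thesis by (rule tendsto_upperbound) simp
    qed
    moreover have "closed {y. euclid.angle (?A R) P y \<le> 0}"
      unfolding euclid.angle_def by (rule closed_Collect_le) (auto intro!: continuous_intros)
    ultimately have "closure I \<subseteq> {y. euclid.angle (?A R) P y \<le> 0}" by (intro closure_minimal) auto
    then have ax: "euclid.angle (?A R) P x \<le> 0" using x by blast
    define w u where "w = x - c" and "u = P - c"
    have uu: "u \<bullet> u = r\<^sup>2" using P(2) r euclid_h_eq[of r c P] by (simp add: u_def dist_norm dot_square_norm norm_minus_commute)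
    \<comment> \<open>With this t the term (t - 2)(w \<bullet> u) is nonnegative, because r \<le> R
      and the angle at \<open>c\<close> is at most \<pi>/2; dropping it leaves the Pythagorean
      bound.\<close>
    define t where "t = 2 * R / r"
    have 1: "x - ?A R = w - (1 - t) *\<^sub>R u" "x - P = w - u"
      unfolding w_def u_def t_def by (simp_all add: algebra_simps)
    have "euclid.angle (?A R) P x = w \<bullet> w - (2 - t) * (w \<bullet> u) + (1 - t) * (u \<bullet> u)"
      unfolding euclid.angle_def 1 by (simp add: inner_diff_left inner_diff_right inner_commute[of u w] algebra_simps)
    then have "w \<bullet> w + (t - 2) * (w \<bullet> u) + (1 - t) * r\<^sup>2 \<le> 0" using ax uu by (simp add: algebra_simps)
    moreover have "0 \<le> (t - 2) * (w \<bullet> u)"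
      using rR r P(3) unfolding w_def u_def t_def by (intro mult_nonneg_nonneg) (auto simp: field_simps)
    moreover have "(1 - t) * r\<^sup>2 = (R - r)\<^sup>2 - R\<^sup>2" unfolding t_def using r by (simp add: power2_eq_square field_simps)
    ultimately have "w \<bullet> w + (R - r)\<^sup>2 \<le> R\<^sup>2" by linarith
    then show "(dist c x)\<^sup>2 + (R - r)\<^sup>2 \<le> R\<^sup>2" by (simp add: w_def dist_norm dot_square_norm norm_minus_commute)
  qed
  then show ?thesis using r rR by blast
qed

lemma euclidean_case:
  fixes \<Omega> :: "'a::euclidean_space set"
  assumes dim: "2 \<le> DIM('a)" and k: "0 < k0"
    and \<Omega>: "compact_domain euclidean_form \<Omega>"
    and convex: "lambda_convex euclidean_form k0 (mfd_top euclidean_form frontier_of \<Omega>)"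
  shows "\<exists>L d. spherical_layer euclidean_form L d \<and> mfd_top euclidean_form frontier_of \<Omega> \<subseteq> L \<and> d \<le> (sqrt 2 - 1) / k0"
proof -
  define R where "R = 1 / k0"
  have R: "0 < R" using k by (simp add: R_def)
  let ?X = "euclidean_form :: 'a space_form"
  define S where "S = mfd_top ?X frontier_of \<Omega>"
  interpret model_space "(\<bullet>) :: 'a \<Rightarrow> 'a \<Rightarrow> real" UNIV "R\<^sup>2 / 2" "(2 * R)\<^sup>2 / 2" UNIV "\<lambda>x. x"
    using euclid_model_space[OF R dim] .
  have S: "compact S" unfolding S_def using compact_domain_frontier[OF \<Omega>] by simp
  show ?thesis
  proof (cases "S = {}")
    case True
    obtain L where "spherical_layer ?X L 0"
      using degenerate_layer[of 0 ?X] by (auto simp: euclidean_form_def)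
    then show ?thesis using True k unfolding S_def by (intro exI[of _ L] exI[of _ 0]) simp
  next
    case False
    have "\<exists>I. bounded_region ((\<bullet>) :: 'a \<Rightarrow> 'a \<Rightarrow> real) UNIV (R\<^sup>2 / 2) ((2 * R)\<^sup>2 / 2) UNIV (\<lambda>x. x) I \<and> closure I - I = S"
    proof (rule region_of_domain[of ?X k0, OF _ _ _ _ \<Omega> S_def False])
      show "form ?X = (\<bullet>)" "pts ?X = UNIV" by (simp_all add: euclidean_form_def)
      show "lambda_convex ?X k0 S" unfolding S_def by (rule convex)
      show "gconvex K" if K: "convex_body ?X K" for K
      proof -
        have seg: "z \<in> K" if "x \<in> K" "y \<in> K" "dist x z + dist z y = dist x y" for x y z
          using K that by (auto simp: convex_body_def geo_segment_def euclidean_form_def)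
        have "dist u ((1 - t) *\<^sub>R u + t *\<^sub>R v) + dist ((1 - t) *\<^sub>R u + t *\<^sub>R v) v = dist u v"
          if "0 \<le> t" "t \<le> 1" for u v :: 'a and t
          using that between[of u v "(1 - t) *\<^sub>R u + t *\<^sub>R v"] by (auto simp: between_mem_segment in_segment)
        then have "(1 - t) *\<^sub>R u + t *\<^sub>R v \<in> K" if "u \<in> K" "v \<in> K" "0 \<le> t" "t \<le> 1" for u v t
          using seg[OF that(1,2)] that(3,4) by blast
        then show ?thesis by (simp add: gconvex_def)
      qed
      show "z \<in> UNIV \<and> euclid.h p z = R\<^sup>2 / 2 \<and> (\<forall>x\<in>geo_cball ?X z r. euclid.h x z \<le> R\<^sup>2 / 2)"
        if s: "sphere_of_curvature ?X k0 z r" "p \<in> geo_sphere ?X z r" for z r p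
      proof -
        have "r = R" using euclid_sphere_radius[OF dim s] by (simp add: R_def)
        then have "dist p z = R" "\<And>x. x \<in> geo_cball ?X z r \<Longrightarrow> dist x z \<le> R"
          using s(2) by (auto simp: geo_sphere_def geo_cball_def euclidean_form_def dist_commute)
        then show ?thesis
          unfolding euclid_h_eq[OF less_imp_le[OF R]] euclid_h_le[OF less_imp_le[OF R]] by blast
      qed
      show "\<exists>p\<in>UNIV. \<forall>Q\<in>UNIV. \<exists>e. \<forall>\<^sub>F t in at 0. Q + t *\<^sub>R e \<in> UNIV \<and> euclid.h Q p < euclid.h (Q + t *\<^sub>R e) (p :: 'a)"
        using euclid_outside[OF dim] by simp
    qed
    then obtain I where I: "bounded_region ((\<bullet>) :: 'a \<Rightarrow> 'a \<Rightarrow> real) UNIV (R\<^sup>2 / 2) ((2 * R)\<^sup>2 / 2) UNIV (\<lambda>x. x) I"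
      "closure I - I = S" by blast
    obtain c r where c: "0 < r" "r \<le> R" "\<And>x. x \<in> S \<Longrightarrow> r \<le> dist c x \<and> (dist c x)\<^sup>2 + (R - r)\<^sup>2 \<le> R\<^sup>2"
      using euclid_inscribed_estimate[OF dim R I(1)] unfolding I(2) by metis
    have "continuous_on S (dist c)" by (intro continuous_intros)
    then obtain x where x: "x \<in> S" "\<forall>y\<in>S. dist c y \<le> dist c x"
      using continuous_attains_sup[OF S False] by blast
    obtain L where L: "spherical_layer ?X L (dist c x - r)" "S \<subseteq> L"
      using spherical_layerI[of c ?X S r x] c(1,3) x by (auto simp: euclidean_form_def)
    have "(dist c x + (R - r))\<^sup>2 \<le> 2 * ((dist c x)\<^sup>2 + (R - r)\<^sup>2)"
      using zero_le_power2[of "dist c x - (R - r)"] by (simp add: power2_eq_square algebra_simps)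
    also have "\<dots> \<le> (sqrt 2 * R)\<^sup>2" using c(3)[OF x(1)] by (simp add: power_mult_distrib)
    finally have "dist c x + (R - r) \<le> sqrt 2 * R" by (rule power2_le_imp_le) (use R in simp)
    then have "dist c x - r \<le> (sqrt 2 - 1) / k0" by (simp add: R_def diff_divide_distrib)
    then show ?thesis using L unfolding S_def by blast
  qed
qed

theorem theorem3:
  fixes n :: nat
  assumes "n \<ge> 1" and "DIM('a::euclidean_space) = n + 1"
  shows
    "(\<forall>k\<^sub>0 (\<Omega> :: 'a set).
        0 < k\<^sub>0 \<and> compact_domain euclidean_form \<Omega> \<and>
        lambda_convex euclidean_form k\<^sub>0 (mfd_top euclidean_form frontier_of \<Omega>) \<longrightarrow>
        (\<exists>L d. spherical_layer euclidean_form L d \<and>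
           mfd_top euclidean_form frontier_of \<Omega> \<subseteq> L \<and>
           d \<le> (sqrt 2 - 1) / k\<^sub>0)) \<and>
     (\<forall>k\<^sub>0 k\<^sub>1 R (\<Omega> :: ('a \<times> real) set).
        0 < k\<^sub>1 \<and> 0 < k\<^sub>0 \<and> R = 1 / k\<^sub>1 * arccot (k\<^sub>0 / k\<^sub>1) \<and>
        compact_domain (spherical_form k\<^sub>1) \<Omega> \<and>
        lambda_convex (spherical_form k\<^sub>1) k\<^sub>0 (mfd_top (spherical_form k\<^sub>1) frontier_of \<Omega>) \<longrightarrow>
        (\<exists>L d. spherical_layer (spherical_form k\<^sub>1) L d \<and>
           mfd_top (spherical_form k\<^sub>1) frontier_of \<Omega> \<subseteq> L \<and>
           d \<le> 2 / k\<^sub>1 * arccos (sqrt (cos (k\<^sub>1 * R))) - R)) \<and>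
     (\<forall>k\<^sub>0 k\<^sub>1 R (\<Omega> :: ('a \<times> real) set).
        0 < k\<^sub>1 \<and> k\<^sub>1 < k\<^sub>0 \<and> R = 1 / k\<^sub>1 * arcoth (k\<^sub>0 / k\<^sub>1) \<and>
        compact_domain (hyperbolic_form k\<^sub>1) \<Omega> \<and>
        lambda_convex (hyperbolic_form k\<^sub>1) k\<^sub>0 (mfd_top (hyperbolic_form k\<^sub>1) frontier_of \<Omega>) \<longrightarrow>
        (\<exists>L d. spherical_layer (hyperbolic_form k\<^sub>1) L d \<and>
           mfd_top (hyperbolic_form k\<^sub>1) frontier_of \<Omega> \<subseteq> L \<and>
           d \<le> 2 / k\<^sub>1 * arcosh (sqrt (cosh (k\<^sub>1 * R))) - R))"
proof -
  have dim: "2 \<le> DIM('a)" using assms by simp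
  show ?thesis
  proof (intro conjI allI impI, goal_cases)
    case (1 k\<^sub>0 \<Omega>)
    then show ?case by (elim conjE) (rule euclidean_case[OF dim])
  next
    case (2 k\<^sub>0 k\<^sub>1 R \<Omega>)
    then show ?case by (elim conjE) (rule spherical_case[OF _ _ _ dim])
  next
    case (3 k\<^sub>0 k\<^sub>1 R \<Omega>)
    then show ?case by (elim conjE) (rule hyperbolic_case[OF _ _ _ dim])
  qed
qed

end
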